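(* Let $\alpha\in(0,1)$, $b>0$, $\nu\in(0,\alpha/2)$ and let $S$ be a nonnegative random variable with moments of all orders. Then the local times $(\ell^y(t),y\in\mathbb{R},t\ge 0)$ of a spectrally positive stable process $X$ of index $1+\alpha$ with Laplace exponent $\psi(\eta)=\eta^{1+\alpha}$ have a uniform Hölder constant $$D_\nu^{[0,b]}(\tau^0(S)):=\sup_{0\le t\le\tau^0(S)}\ \sup_{0\le x<y\le b}\frac{|\ell^y(t)-\ell^x(t)|}{|y-x|^\nu}$$ with moments of all orders.
   Context: $X=(X_t,t\ge 0)$ is a Lévy process with $X_0=0$, no negative jumps, and $\mathbb{E}(e^{-\eta X_t})=e^{t\psi(\eta)}$, $\eta\ge 0$. Its jointly continuous local times $(\ell^y(t))$ are normalised by the occupation density formula $\int_0^Tf(X_t)\,dt=\int_{-\infty}^\infty f(y)\ell^y(T)\,dy$ a.s. for all bounded measurable $f:\mathbb{R}\to\mathbb{R}$ and $T\ge0$. The inverse local time at level $y$ is $\tau^y(s)=\inf\{t\ge0:\ell^y(t)>s\}$. The random variable $S$ is defined on the same probability space as $X$; no independence from $X$ is assumed. A random variable $V$ has moments of all orders if $\mathbb{E}(|V|^p)<\infty$ for all $p>0$. *)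

theory Defs
  imports "HOL-Probability.Probability"
begin

text \<open>
  A real-valued process is a function \<open>X t \<omega>\<close>; only times \<open>t \<ge> 0\<close> matter. Path properties
  are required almost surely.
\<close>

definition cadlag :: "(real \<Rightarrow> real) \<Rightarrow> bool" where
  "cadlag x \<longleftrightarrow> (\<forall>t\<ge>0. (x \<longlongrightarrow> x t) (at_right t)) \<and> (\<forall>t>0. \<exists>l. (x \<longlongrightarrow> l) (at_left t))"

definition levy_process :: "'a measure \<Rightarrow> (real \<Rightarrow> 'a \<Rightarrow> real) \<Rightarrow> bool" where
  "levy_process M X \<longleftrightarrow>
     prob_space M \<and>
     (\<forall>t\<ge>0. X t \<in> borel_measurable M) \<and>
     (AE \<omega> in M. X 0 \<omega> = 0) \<and>
     (\<forall>n (t :: nat \<Rightarrow> real). 0 \<le> t 0 \<and> mono t \<longrightarrow>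
        prob_space.indep_vars M (\<lambda>_. borel) (\<lambda>i \<omega>. X (t (Suc i)) \<omega> - X (t i) \<omega>) {..<n}) \<and>
     (\<forall>s\<ge>0. \<forall>h\<ge>0. distr M borel (\<lambda>\<omega>. X (s + h) \<omega> - X s \<omega>) = distr M borel (X h)) \<and>
     (AE \<omega> in M. cadlag (\<lambda>t. X t \<omega>))"

definition no_negative_jumps :: "'a measure \<Rightarrow> (real \<Rightarrow> 'a \<Rightarrow> real) \<Rightarrow> bool" where
  "no_negative_jumps M X \<longleftrightarrow>
     (AE \<omega> in M. \<forall>t>0. X t \<omega> - Lim (at_left t) (\<lambda>s. X s \<omega>) \<ge> 0)"

definition has_laplace_exponent ::
    "'a measure \<Rightarrow> (real \<Rightarrow> 'a \<Rightarrow> real) \<Rightarrow> (real \<Rightarrow> real) \<Rightarrow> bool" where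
  "has_laplace_exponent M X \<psi> \<longleftrightarrow>
     (\<forall>\<eta>\<ge>0. \<forall>t\<ge>0. integrable M (\<lambda>\<omega>. exp (- \<eta> * X t \<omega>)) \<and>
        (\<integral>\<omega>. exp (- \<eta> * X t \<omega>) \<partial>M) = exp (t * \<psi> \<eta>))"

text \<open>
  Stability of index \<open>a\<close>: the processes \<open>(X (c t))\<close> and \<open>(c\<^sup>1\<^sup>/\<^sup>a X t)\<close> have the same law, that
  is, the same finite-dimensional distributions.
\<close>

definition stable_process :: "'a measure \<Rightarrow> real \<Rightarrow> (real \<Rightarrow> 'a \<Rightarrow> real) \<Rightarrow> bool" where
  "stable_process M a X \<longleftrightarrow>
     levy_process M X \<and>
     (\<forall>c>0. \<forall>J. finite J \<and> J \<subseteq> {0..} \<longrightarrow>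
        distr M (PiM J (\<lambda>_. borel)) (\<lambda>\<omega>. \<lambda>t\<in>J. X (c * t) \<omega>) =
        distr M (PiM J (\<lambda>_. borel)) (\<lambda>\<omega>. \<lambda>t\<in>J. c powr (1 / a) * X t \<omega>))"

text \<open>
  \<open>l y t \<omega>\<close> is the local time at level \<open>y\<close> up to time \<open>t\<close>. The exceptional null set of the
  occupation density formula may depend on \<open>f\<close> and \<open>T\<close>. The Bochner integral of a
  non-integrable function is 0, but \<open>f = 1\<close> and \<open>T > 0\<close> make \<open>y \<mapsto> l y T \<omega>\<close> integrable a.s.
\<close>

definition jointly_continuous_local_times ::
    "'a measure \<Rightarrow> (real \<Rightarrow> 'a \<Rightarrow> real) \<Rightarrow> (real \<Rightarrow> real \<Rightarrow> 'a \<Rightarrow> real) \<Rightarrow> bool" where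
  "jointly_continuous_local_times M X l \<longleftrightarrow>
     (\<forall>y. \<forall>t\<ge>0. l y t \<in> borel_measurable M) \<and>
     (AE \<omega> in M. continuous_on (UNIV \<times> {0..}) (\<lambda>(y, t). l y t \<omega>)) \<and>
     (\<forall>f \<in> borel_measurable borel. bounded (range f) \<longrightarrow> (\<forall>T\<ge>0. AE \<omega> in M.
        (LINT t:{0..T}|lborel. f (X t \<omega>)) = (LINT y|lborel. f y * l y T \<omega>)))"

definition inverse_local_time ::
    "(real \<Rightarrow> real \<Rightarrow> 'a \<Rightarrow> real) \<Rightarrow> real \<Rightarrow> real \<Rightarrow> 'a \<Rightarrow> ereal" where
  "inverse_local_time l y s \<omega> = (INF t\<in>{t. 0 \<le> t \<and> l y t \<omega> > s}. ereal t)"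

definition holder_const ::
    "(real \<Rightarrow> real \<Rightarrow> 'a \<Rightarrow> real) \<Rightarrow> real \<Rightarrow> real \<Rightarrow> ereal \<Rightarrow> 'a \<Rightarrow> ennreal" where
  "holder_const l \<nu> b T \<omega> =
     (SUP t\<in>{t. 0 \<le> t \<and> ereal t \<le> T}. SUP (x, y)\<in>{(x, y). 0 \<le> x \<and> x < y \<and> y \<le> b}.
        ennreal (\<bar>l y t \<omega> - l x t \<omega>\<bar> / \<bar>y - x\<bar> powr \<nu>))"

definition moments_of_all_orders :: "'a measure \<Rightarrow> ('a \<Rightarrow> real) \<Rightarrow> bool" where
  "moments_of_all_orders M V \<longleftrightarrow>
     V \<in> borel_measurable M \<and> (\<forall>p>0. integrable M (\<lambda>\<omega>. \<bar>V \<omega>\<bar> powr p))"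

text \<open>
  For extended random variables: a.s. finite with all moments. As path properties only hold
  almost surely, measurability is meant with respect to the completion.
\<close>

definition ext_moments_of_all_orders :: "'a measure \<Rightarrow> ('a \<Rightarrow> ennreal) \<Rightarrow> bool" where
  "ext_moments_of_all_orders M V \<longleftrightarrow>
     (AE \<omega> in M. V \<omega> < \<infinity>) \<and> moments_of_all_orders (completion M) (\<lambda>\<omega>. enn2real (V \<omega>))"

end

theory Submission
  imports Defs "HOL-Complex_Analysis.Conformal_Mappings"
begin

text \<open>Write \<open>\<psi> \<eta> = \<eta> powr (1 + \<alpha>)\<close> and let \<open>W r = max 0 r powr \<alpha> / Gamma (1 + \<alpha>)\<close> be the scale function, whose
  Laplace transform is \<open>1 / \<psi>\<close>. Comparing Laplace transforms shows that \<open>W (y - X t) - l y t\<close> is a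
  martingale (\<open>potential_identity\<close>, integrated over the level). Hence
  \<open>A t = l y t - l x t\<close> differs from a martingale by the value at \<open>X t\<close> of the function
  \<open>f z = W (y - z) - W (x - z)\<close>, and since \<open>\<alpha> < 1\<close> this function is bounded by
  \<open>D = \<bar>y - x\<bar> powr \<alpha> / Gamma (1 + \<alpha>)\<close>.

  The key step is an exponential tilt. If \<open>\<theta> * D \<le> 1 / 2\<close> and \<open>\<kappa> = 2 * \<theta>\<^sup>2 * D\<close>, then
  \<open>exp (\<theta> * A t - \<kappa> * (l x t + l y t)) * (1 - \<theta> * f (X t))\<close> is a positive supermartingale whose second
  factor lies between 1/2 and 3/2. The maximal inequality for positive supermartingales gives, with
  probability at least \<open>1 - 3 * exp (- c)\<close>, the bound \<open>\<theta> * A t \<le> \<kappa> * (l x t + l y t) + c\<close> for all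
  times at once (\<open>local_time_maximal_inequality\<close>). It is proved for the random walk that samples \<open>X\<close> on
  a time grid and for occupation integrals of tents in place of local times, and then passed to the
  limit by Fatou's lemma.

  Taking \<open>\<theta>\<close> proportional to \<open>\<bar>y - x\<bar> powr - (\<alpha> / 2)\<close> bounds the increment by
  \<open>\<bar>y - x\<bar> powr (\<alpha> / 2)\<close> times a combination of \<open>l x t + l y t\<close>, with a small coefficient, and \<open>c\<close>. Chaining
  over dyadic points of \<open>{0..b}\<close>, and absorbing the supremum of the local times into the left-hand side,
  yields
  \<open>\<bar>l y t - l x t\<bar> \<le> H * (l 0 t + \<Lambda> + 1) * (y - x) powr \<nu>\<close> for all \<open>t\<close>, with a constant \<open>H\<close> and a random
  variable \<open>\<Lambda>\<close> that has exponential tails (\<open>uniform_holder_bound\<close>). Up to the inverse local time, \<open>l 0 t\<close> is at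
  most \<open>S\<close>, so the Hoelder constant is at most \<open>H * (S + \<Lambda> + 1)\<close>. The heavy tails of the inverse local
  time never enter.\<close>

section \<open>Uniqueness of two-sided Laplace transforms\<close>

text \<open>A bound on the difference quotients that is uniform in \<open>w\<close> and integrable against any measure with
  exponential moments on both sides of \<open>Re z\<close>; it is the dominating function for differentiating a
  Laplace transform under the integral. The factor \<open>\<bar>v\<bar>\<close> from the mean value inequality is absorbed by
  widening the exponents from \<open>r\<close> to \<open>2 * r\<close>.\<close>

lemma norm_exp_diff_quotient_le:
  fixes z w :: complex and v r :: real
  assumes "w \<noteq> z" "norm (w - z) \<le> r" "0 < r"
  shows "norm ((exp (- w * v) - exp (- z * v)) / (w - z))
    \<le> (exp (- (Re z - 2 * r) * v) + exp (- (Re z + 2 * r) * v)) / r"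
proof -
  have "norm (exp (- w * v) - exp (- z * v)) \<le>
      (\<bar>v\<bar> * exp (- Re z * v + r * \<bar>v\<bar>)) * norm (w - z)"
  proof (rule field_differentiable_bound[of "cball z r" "\<lambda>w. exp (- w * complex_of_real v)"
        "\<lambda>w. - complex_of_real v * exp (- w * complex_of_real v)" "\<bar>v\<bar> * exp (- Re z * v + r * \<bar>v\<bar>)"])
    fix u assume "u \<in> cball z r"
    then have "\<bar>Re u - Re z\<bar> \<le> r"
      by (metis abs_Re_le_cmod dist_commute dist_norm mem_cball minus_complex.simps(1) order_trans)
    then have "\<bar>(Re z - Re u) * v\<bar> \<le> r * \<bar>v\<bar>"
      by (simp add: abs_mult mult_right_mono abs_minus_commute)
    then have "- Re u * v \<le> - Re z * v + r * \<bar>v\<bar>"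
      by (simp add: algebra_simps abs_le_iff)
    then show "norm (- of_real v * exp (- u * v)) \<le> \<bar>v\<bar> * exp (- Re z * v + r * \<bar>v\<bar>)"
      by (simp add: norm_mult mult_left_mono)
  qed (use assms in \<open>auto intro!: derivative_eq_intros simp: dist_norm norm_minus_commute\<close>)
  then have "norm ((exp (- w * v) - exp (- z * v)) / (w - z)) \<le> \<bar>v\<bar> * exp (- Re z * v + r * \<bar>v\<bar>)"
    using assms by (simp add: norm_divide divide_simps)
  also have "\<dots> \<le> (exp (r * \<bar>v\<bar>) / r) * exp (- Re z * v + r * \<bar>v\<bar>)"
  proof (rule mult_right_mono)
    have "r * \<bar>v\<bar> \<le> exp (r * \<bar>v\<bar>)" using exp_ge_add_one_self[of "r * \<bar>v\<bar>"] by linarith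
    then show "\<bar>v\<bar> \<le> exp (r * \<bar>v\<bar>) / r" using assms by (simp add: field_simps)
  qed simp
  also have "\<dots> = exp (- Re z * v + 2 * r * \<bar>v\<bar>) / r"
    by (simp add: exp_add[symmetric] algebra_simps)
  also have "\<dots> \<le> (exp (- (Re z - 2 * r) * v) + exp (- (Re z + 2 * r) * v)) / r"
    using assms by (intro divide_right_mono; cases "v \<ge> 0"; simp add: algebra_simps add_increasing add_increasing2)
  finally show ?thesis .
qed

lemma holomorphic_on_integral_exp:
  fixes \<mu> :: "real measure"
  assumes sets[measurable_cong]: "sets \<mu> = sets borel"
    and int: "\<And>x. a < x \<Longrightarrow> integrable \<mu> (\<lambda>v. exp (- x * v))"
  shows "(\<lambda>z. \<integral>v. exp (- z * complex_of_real v) \<partial>\<mu>) holomorphic_on {z. a < Re z}"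
proof (rule holomorphic_onI)
  fix z :: complex assume "z \<in> {z. a < Re z}"
  then have z: "a < Re z" by simp
  define r where "r = (Re z - a) / 4"
  have r: "0 < r" "a < Re z - 2 * r" "a < Re z + 2 * r" using z by (auto simp: r_def field_simps)
  have cint: "integrable \<mu> (\<lambda>v. exp (- w * complex_of_real v))" if "a < Re w" for w
    by (rule Bochner_Integration.integrable_bound[OF int[OF that]]) (auto simp: algebra_simps)
  let ?q = "\<lambda>w v. (exp (- w * complex_of_real v) - exp (- z * complex_of_real v)) / (w - z)"
  have "((\<lambda>w. \<integral>v. ?q w v \<partial>\<mu>) \<longlongrightarrow> (\<integral>v. - complex_of_real v * exp (- z * complex_of_real v) \<partial>\<mu>)) (at z)"
    unfolding tendsto_at_iff_sequentially comp_def
  proof safe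
    fix W assume W: "\<forall>i. W i \<in> UNIV - {z}" "W \<longlonglongrightarrow> z"
    then have "eventually (\<lambda>i. dist (W i) z < r) sequentially"
      using r by (auto dest: tendstoD)
    then obtain N where N: "\<And>i. i \<ge> N \<Longrightarrow> dist (W i) z < r"
      by (auto simp: eventually_sequentially)
    have "(\<lambda>i. \<integral>v. ?q (W (i + N)) v \<partial>\<mu>) \<longlonglongrightarrow> (\<integral>v. - complex_of_real v * exp (- z * complex_of_real v) \<partial>\<mu>)"
    proof (rule integral_dominated_convergence[where w =
          "\<lambda>v. (exp (- (Re z - 2 * r) * v) + exp (- (Re z + 2 * r) * v)) / r"])
      show "integrable \<mu> (\<lambda>v. (exp (- (Re z - 2 * r) * v) + exp (- (Re z + 2 * r) * v)) / r)"
        using r by (intro integrable_divide_zero Bochner_Integration.integrable_add int) auto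
      show "AE v in \<mu>. (\<lambda>i. ?q (W (i + N)) v) \<longlonglongrightarrow> - complex_of_real v * exp (- z * complex_of_real v)"
      proof (rule AE_I2)
        fix v :: real
        have "((\<lambda>w. exp (- w * complex_of_real v)) has_field_derivative - complex_of_real v * exp (- z * complex_of_real v)) (at z)"
          by (auto intro!: derivative_eq_intros)
        then have "((\<lambda>w. ?q w v) \<longlongrightarrow> - complex_of_real v * exp (- z * complex_of_real v)) (at z)"
          by (simp add: has_field_derivative_iff)
        moreover have "filterlim (\<lambda>i. W (i + N)) (at z) sequentially"
          using W by (auto simp: filterlim_at intro: LIMSEQ_ignore_initial_segment)
        ultimately show "(\<lambda>i. ?q (W (i + N)) v) \<longlonglongrightarrow> - complex_of_real v * exp (- z * complex_of_real v)"
          by (rule filterlim_compose)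
      qed
      show "AE v in \<mu>. norm (?q (W (i + N)) v) \<le>
          (exp (- (Re z - 2 * r) * v) + exp (- (Re z + 2 * r) * v)) / r" for i
        using W N[of "i + N"] r
        by (intro AE_I2 norm_exp_diff_quotient_le) (auto simp: dist_norm less_imp_le)
    qed simp_all
    then show "(\<lambda>i. \<integral>v. ?q (W i) v \<partial>\<mu>) \<longlonglongrightarrow> (\<integral>v. - complex_of_real v * exp (- z * complex_of_real v) \<partial>\<mu>)"
      by (rule LIMSEQ_offset)
  qed
  moreover have "eventually (\<lambda>w. (\<integral>v. ?q w v \<partial>\<mu>) =
      ((\<integral>v. exp (- w * v) \<partial>\<mu>) - (\<integral>v. exp (- z * v) \<partial>\<mu>)) / (w - z)) (at z)"
  proof -
    have "eventually (\<lambda>w. w \<in> {z. a < Re z}) (at z)"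
      using z by (intro eventually_at_in_open') (auto intro: open_halfspace_Re_gt)
    then show ?thesis
    proof eventually_elim
      case (elim w)
      then have "a < Re w" by simp
      note * = cint[OF this] cint[OF z]
      show ?case
        unfolding integral_divide_zero Bochner_Integration.integral_diff[OF *] ..
    qed
  qed
  ultimately have "((\<lambda>w. ((\<integral>v. exp (- w * v) \<partial>\<mu>) - (\<integral>v. exp (- z * v) \<partial>\<mu>)) / (w - z))
      \<longlongrightarrow> (\<integral>v. - complex_of_real v * exp (- z * complex_of_real v) \<partial>\<mu>)) (at z)"
    by (rule Lim_transform_eventually)
  then have "((\<lambda>z. \<integral>v. exp (- z * complex_of_real v) \<partial>\<mu>) has_field_derivative
      (\<integral>v. - complex_of_real v * exp (- z * complex_of_real v) \<partial>\<mu>)) (at z)"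
    by (rule has_field_derivative_iff[THEN iffD2])
  then have "(\<lambda>z. \<integral>v. exp (- z * complex_of_real v) \<partial>\<mu>) field_differentiable at z"
    unfolding field_differentiable_def by (rule exI)
  then show "(\<lambda>z. \<integral>v. exp (- z * complex_of_real v) \<partial>\<mu>) field_differentiable at z within {z. a < Re z}"
    by (rule field_differentiable_at_within)
qed

text \<open>The transforms are holomorphic on a half plane that contains the imaginary axis, so equality for
  real arguments extends to the characteristic functions by the identity theorem.\<close>

lemma prob_eq_of_laplace_eq:
  fixes \<mu> \<nu> :: "real measure"
  assumes "real_distribution \<mu>" "real_distribution \<nu>"
    and imu: "\<And>x. -1 < x \<Longrightarrow> integrable \<mu> (\<lambda>v. exp (- x * v))"
    and inu: "\<And>x. -1 < x \<Longrightarrow> integrable \<nu> (\<lambda>v. exp (- x * v))"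
    and eq: "\<And>x. -1 < x \<Longrightarrow> (\<integral>v. exp (- x * v) \<partial>\<mu>) = (\<integral>v. exp (- x * v) \<partial>\<nu>)"
  shows "\<mu> = \<nu>"
proof (rule Levy_uniqueness[OF assms(1,2)], rule ext)
  interpret m: real_distribution \<mu> by fact
  interpret n: real_distribution \<nu> by fact
  fix t :: real
  let ?S = "{z. -1 < Re z}"
  define F where "F = (\<lambda>z. (\<integral>v. exp (- z * complex_of_real v) \<partial>\<mu>) - (\<integral>v. exp (- z * complex_of_real v) \<partial>\<nu>))"
  have "F (- \<i> * complex_of_real t) = 0"
  proof (rule analytic_continuation[of F ?S "complex_of_real ` {0<..}" 0])
    show "F holomorphic_on ?S"
      unfolding F_def
      by (intro holomorphic_on_diff holomorphic_on_integral_exp imu inu) simp_all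
    show "open ?S" by (rule open_halfspace_Re_gt)
    show "connected ?S" by (intro convex_connected convex_halfspace_Re_gt)
    have "(\<lambda>n. complex_of_real (inverse (real (Suc n)))) \<longlonglongrightarrow> of_real 0"
      by (intro tendsto_of_real LIMSEQ_inverse_real_of_nat)
    then show "0 islimpt complex_of_real ` {0<..}"
      unfolding islimpt_sequential
      by (intro exI[of _ "\<lambda>n. complex_of_real (inverse (real (Suc n)))"])
         (auto simp del: of_real_inverse of_nat_Suc)
    fix z assume "z \<in> complex_of_real ` {0<..}"
    then obtain x where x: "z = of_real x" "x > 0" by auto
    have "(\<integral>v. exp (- z * complex_of_real v) \<partial>M) = of_real (\<integral>v. exp (- x * v) \<partial>M)" for M
      unfolding integral_complex_of_real[symmetric] by (simp add: x exp_of_real[symmetric])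
    then show "F z = 0" unfolding F_def using eq[of x] x by simp
  qed auto
  moreover have "exp (- (- \<i> * complex_of_real t) * complex_of_real v) = iexp (t * v)" for v
    by (simp add: algebra_simps)
  ultimately show "char \<mu> t = char \<nu> t"
    unfolding F_def char_def by (simp only:) simp
qed

text \<open>
  The measures may be infinite. Damping both by \<open>exp (- v)\<close> and normalising gives probability
  measures whose transforms agree on \<open>(-1, \<infinity>)\<close>, and the damping can be undone.\<close>

lemma measure_eq_of_laplace_eq:
  fixes \<mu> \<nu> :: "real measure"
  assumes smu[measurable_cong]: "sets \<mu> = sets borel" and snu[measurable_cong]: "sets \<nu> = sets borel"
    and lmu: "\<And>x. 0 < x \<Longrightarrow> (\<integral>\<^sup>+v. ennreal (exp (- x * v)) \<partial>\<mu>) = ennreal (c x)"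
    and lnu: "\<And>x. 0 < x \<Longrightarrow> (\<integral>\<^sup>+v. ennreal (exp (- x * v)) \<partial>\<nu>) = ennreal (c x)"
    and c: "\<And>x. 0 < x \<Longrightarrow> 0 < c x"
  shows "\<mu> = \<nu>"
proof -
  define d where "d m = density m (\<lambda>v. ennreal (exp (- v) / c 1))" for m :: "real measure"
  have c1: "c 1 > 0" by (rule c) simp
  have nn: "(\<integral>\<^sup>+v. ennreal (exp (- x * v)) \<partial>d m) = ennreal (c (x + 1) / c 1)"
    if m: "sets m = sets borel"
      and l: "\<And>x. 0 < x \<Longrightarrow> (\<integral>\<^sup>+v. ennreal (exp (- x * v)) \<partial>m) = ennreal (c x)" and x: "-1 < x" for m x
  proof -
    note m[measurable_cong]
    have "(\<integral>\<^sup>+v. ennreal (exp (- x * v)) \<partial>d m) =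
        (\<integral>\<^sup>+v. ennreal (1 / c 1) * ennreal (exp (- (x + 1) * v)) \<partial>m)"
      unfolding d_def using c1
      by (subst nn_integral_density)
         (auto intro!: nn_integral_cong simp: ennreal_mult[symmetric] exp_add[symmetric] algebra_simps)
    also have "\<dots> = ennreal (1 / c 1) * ennreal (c (x + 1))"
      using l[of "x + 1"] x by (subst nn_integral_cmult) auto
    finally show ?thesis using c1 by (simp add: ennreal_mult'[symmetric])
  qed
  have rd: "real_distribution (d m)"
    and li: "\<And>x. -1 < x \<Longrightarrow> integrable (d m) (\<lambda>v. exp (- x * v))"
    and le: "\<And>x. -1 < x \<Longrightarrow> (\<integral>v. exp (- x * v) \<partial>d m) = c (x + 1) / c 1"
    if m: "sets m = sets borel"
      and l: "\<And>x. 0 < x \<Longrightarrow> (\<integral>\<^sup>+v. ennreal (exp (- x * v)) \<partial>m) = ennreal (c x)" for m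
  proof -
    note m[measurable_cong]
    have s[measurable_cong]: "sets (d m) = sets borel" by (simp add: d_def m)
    have "emeasure (d m) (space (d m)) = (\<integral>\<^sup>+v. ennreal (exp (- 0 * v)) \<partial>d m)" by simp
    also have "\<dots> = 1" using nn[OF m l, of 0] c1 by simp
    finally show "real_distribution (d m)"
      using s by (intro real_distribution.intro prob_spaceI real_distribution_axioms.intro)
    show "(\<integral>v. exp (- x * v) \<partial>d m) = c (x + 1) / c 1" if "-1 < x" for x
      using nn[OF m l that] c1 c[of "x + 1"] that by (subst integral_eq_nn_integral) auto
    show "integrable (d m) (\<lambda>v. exp (- x * v))" if "-1 < x" for x
      using nn[OF m l that] by (intro integrableI_nonneg) auto
  qed
  have "d \<mu> = d \<nu>"
    using rd[OF smu lmu] rd[OF snu lnu] li[OF smu lmu] li[OF snu lnu] le[OF smu lmu] le[OF snu lnu]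
    by (intro prob_eq_of_laplace_eq) simp_all
  have inv: "density (d m) (\<lambda>v. ennreal (c 1 * exp v)) = m" if "sets m = sets borel" for m
  proof -
    note that[measurable_cong]
    have "density (d m) (\<lambda>v. ennreal (c 1 * exp v)) =
      density m (\<lambda>v. ennreal (exp (- v) / c 1) * ennreal (c 1 * exp v))"
      unfolding d_def by (subst density_density_eq) auto
    also have "\<dots> = density m (\<lambda>_. 1)"
      using c1 by (intro density_cong) (auto simp: ennreal_mult[symmetric] exp_minus)
    finally show ?thesis by (simp add: density_1)
  qed
  show ?thesis using inv[OF smu] inv[OF snu] unfolding \<open>d \<mu> = d \<nu>\<close> by simp
qed

section \<open>A jointly measurable version of a right-continuous process\<close>

definition dyadic_ceiling :: "nat \<Rightarrow> real \<Rightarrow> real" where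
  "dyadic_ceiling n s = of_int \<lceil>s * 2 ^ n\<rceil> / 2 ^ n"

lemma dyadic_ceiling_ge: "s \<le> dyadic_ceiling n s"
  by (simp add: dyadic_ceiling_def field_simps)

lemma dyadic_ceiling_tendsto: "(\<lambda>n. dyadic_ceiling n s) \<longlonglongrightarrow> s"
proof (rule tendsto_sandwich[of "\<lambda>_. s"])
  show "\<forall>\<^sub>F n in sequentially. dyadic_ceiling n s \<le> s + (1 / 2) ^ n"
  proof (rule always_eventually, rule allI)
    fix n :: nat
    have "of_int \<lceil>s * 2 ^ n\<rceil> \<le> s * 2 ^ n + 1" by linarith
    then show "dyadic_ceiling n s \<le> s + (1 / 2) ^ n"
      by (simp add: dyadic_ceiling_def field_simps)
  qed
  have "(\<lambda>n. s + (1 / 2 :: real) ^ n) \<longlonglongrightarrow> s + 0"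
    by (intro tendsto_intros LIMSEQ_power_zero) simp
  then show "(\<lambda>n. s + (1 / 2 :: real) ^ n) \<longlonglongrightarrow> s" by simp
qed (auto simp: dyadic_ceiling_ge)

lemma tendsto_dyadic_ceiling:
  fixes x :: "real \<Rightarrow> real"
  assumes "(x \<longlongrightarrow> x s) (at_right s)"
  shows "(\<lambda>n. x (dyadic_ceiling n s)) \<longlonglongrightarrow> x s"
proof -
  have "(x \<longlongrightarrow> x s) (at s within {s..})"
    using assms by (simp add: at_within_Ici_at_right)
  then have "(x \<longlongrightarrow> x s) (inf (nhds s) (principal {s..}))"
    unfolding at_within_def
    by (auto simp: tendsto_def eventually_inf_principal elim!: eventually_mono dest: eventually_nhds_x_imp_x)
  moreover have "filterlim (\<lambda>n. dyadic_ceiling n s) (inf (nhds s) (principal {s..})) sequentially"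
    by (auto simp: filterlim_inf filterlim_principal dyadic_ceiling_ge dyadic_ceiling_tendsto)
  ultimately show ?thesis by (rule filterlim_compose)
qed

text \<open>Fubini arguments need joint measurability in time and chance, but only the individual \<open>X t\<close> are
  known to be measurable. The limit of \<open>X\<close> along dyadic times from the right is jointly measurable, and
  by right-continuity it agrees with \<open>X\<close> almost surely at all times.\<close>

lemma right_continuous_version:
  fixes X :: "real \<Rightarrow> 'a \<Rightarrow> real"
  assumes meas: "\<And>t. 0 \<le> t \<Longrightarrow> X t \<in> borel_measurable M"
    and rc: "AE \<omega> in M. \<forall>t\<ge>0. ((\<lambda>t. X t \<omega>) \<longlongrightarrow> X t \<omega>) (at_right t)"
  obtains Y :: "real \<times> 'a \<Rightarrow> real" where
    "Y \<in> borel_measurable (borel \<Otimes>\<^sub>M M)" "AE \<omega> in M. \<forall>s\<ge>0. Y (s, \<omega>) = X s \<omega>"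
proof -
  define Z where "Z n p = X (max 0 (dyadic_ceiling n (fst p))) (snd p)" for n :: nat and p :: "real \<times> 'a"
  let ?Y = "\<lambda>p. lim (\<lambda>n. Z n p)"
  have [measurable]: "Z n \<in> borel_measurable (borel \<Otimes>\<^sub>M M)" for n
  proof -
    have "(\<lambda>p :: real \<times> 'a. (\<lambda>k p. X (max 0 (of_int k / 2 ^ n)) (snd p)) \<lceil>fst p * 2 ^ n\<rceil> p)
        \<in> borel_measurable (borel \<Otimes>\<^sub>M M)"
    proof (rule measurable_compose_countable[where f = "\<lambda>k p. X (max 0 (of_int k / 2 ^ n)) (snd p)"])
      fix k :: int
      have [measurable]: "X (max 0 (of_int k / 2 ^ n)) \<in> borel_measurable M" by (rule meas) simp
      show "(\<lambda>p. X (max 0 (of_int k / 2 ^ n)) (snd p)) \<in> borel_measurable (borel \<Otimes>\<^sub>M M)" by measurable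
    qed measurable
    then show ?thesis by (simp add: Z_def[abs_def] dyadic_ceiling_def)
  qed
  have "?Y \<in> borel_measurable (borel \<Otimes>\<^sub>M M)" by measurable
  moreover have "AE \<omega> in M. \<forall>s\<ge>0. ?Y (s, \<omega>) = X s \<omega>"
    using rc
  proof eventually_elim
    case (elim \<omega>)
    show ?case
    proof safe
      fix s :: real assume s: "0 \<le> s"
      have "max 0 (dyadic_ceiling n s) = dyadic_ceiling n s" for n
        using dyadic_ceiling_ge[of s n] s by simp
      then have "(\<lambda>n. Z n (s, \<omega>)) \<longlonglongrightarrow> X s \<omega>"
        using tendsto_dyadic_ceiling[of "\<lambda>t. X t \<omega>" s] elim s by (simp add: Z_def)
      then show "?Y (s, \<omega>) = X s \<omega>" by (rule limI)
    qed
  qed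
  ultimately show ?thesis by (rule that)
qed

section \<open>The scale function and the potential identity\<close>

text \<open>The scale function of the spectrally positive stable process, characterised by the Laplace transform
  \<open>1 / \<psi>\<close> computed in the lemma \<open>nn_integral_scale_exp\<close>; it vanishes on the negative half line.\<close>

definition scale :: "real \<Rightarrow> real \<Rightarrow> real" where
  "scale \<alpha> r = max 0 r powr \<alpha> / Gamma (1 + \<alpha>)"

lemma scale_measurable[measurable]: "scale \<alpha> \<in> borel_measurable borel"
  unfolding scale_def[abs_def] by measurable

lemma scale_nonneg: "0 < \<alpha> \<Longrightarrow> 0 \<le> scale \<alpha> r"
  by (simp add: scale_def Gamma_real_pos less_imp_le)

lemma scale_eq_0: "0 < \<alpha> \<Longrightarrow> r \<le> 0 \<Longrightarrow> scale \<alpha> r = 0"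
  by (simp add: scale_def)

lemma nn_integral_scale_exp:
  assumes \<alpha>: "0 < \<alpha>" and \<eta>: "0 < \<eta>"
  shows "(\<integral>\<^sup>+r. ennreal (exp (- \<eta> * r) * scale \<alpha> r) \<partial>lborel) = ennreal (\<eta> powr - (1 + \<alpha>))"
proof -
  let ?G = "Gamma (1 + \<alpha>)"
  have G: "0 < ?G" using \<alpha> by (intro Gamma_real_pos) simp
  have "((\<lambda>t. t powr \<alpha> / exp t / ?G) has_integral ?G / ?G) {0..}"
    using Gamma_integral_real[of "1 + \<alpha>"] \<alpha> by (intro has_integral_divide) simp
  then have "(\<integral>\<^sup>+t. ennreal (t powr \<alpha> / exp t / ?G) * indicator {0..} t \<partial>lborel) = ennreal (?G / ?G)"
    using G by (intro nn_integral_has_integral_lebesgue') auto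
  also have "(\<integral>\<^sup>+t. ennreal (t powr \<alpha> / exp t / ?G) * indicator {0..} t \<partial>lborel) =
      (\<integral>\<^sup>+t. ennreal (exp (- t) * scale \<alpha> t) \<partial>lborel)"
    using \<alpha> by (intro nn_integral_cong) (auto simp: scale_def indicator_def exp_minus field_simps)
  also have "\<dots> = ennreal \<bar>\<eta>\<bar> * (\<integral>\<^sup>+t. ennreal (exp (- (0 + \<eta> * t)) * scale \<alpha> (0 + \<eta> * t)) \<partial>lborel)"
    using \<eta> by (subst nn_integral_real_affine[of _ \<eta> 0]) auto
  also have "\<dots> = ennreal \<eta> * (\<integral>\<^sup>+t. ennreal (\<eta> powr \<alpha>) * ennreal (exp (- \<eta> * t) * scale \<alpha> t) \<partial>lborel)"
  proof -
    have "max 0 (\<eta> * t) = \<eta> * max 0 t" for t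
      using \<eta> by (auto simp: max_def zero_le_mult_iff)
    then show ?thesis
      using \<eta> by (simp add: scale_def powr_mult ennreal_mult'[symmetric] mult_ac)
  qed
  also have "\<dots> = ennreal (\<eta> powr (1 + \<alpha>)) * (\<integral>\<^sup>+t. ennreal (exp (- \<eta> * t) * scale \<alpha> t) \<partial>lborel)"
    using \<eta> by (subst nn_integral_cmult) (auto simp: mult.assoc[symmetric] ennreal_mult'[symmetric] powr_add)
  finally have *: "ennreal (\<eta> powr (1 + \<alpha>)) * (\<integral>\<^sup>+t. ennreal (exp (- \<eta> * t) * scale \<alpha> t) \<partial>lborel) = 1"
    using G by simp
  let ?I = "(\<integral>\<^sup>+t. ennreal (exp (- \<eta> * t) * scale \<alpha> t) \<partial>lborel)"
  have "?I = (ennreal (\<eta> powr - (1 + \<alpha>)) * ennreal (\<eta> powr (1 + \<alpha>))) * ?I"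
    using \<eta> by (simp add: ennreal_mult'[symmetric] powr_minus del: minus_add_distrib)
  also have "\<dots> = ennreal (\<eta> powr - (1 + \<alpha>))"
    unfolding mult.assoc * by simp
  finally show ?thesis .
qed

lemma nn_integral_exp_Icc:
  assumes "0 < p" "0 \<le> h"
  shows "(\<integral>\<^sup>+s. indicator {0..h} s * ennreal (exp (s * p)) \<partial>lborel) = ennreal ((exp (h * p) - 1) / p)"
proof -
  have "(\<integral>\<^sup>+s. ennreal (exp (s * p)) * indicator {0..h} s \<partial>lborel) =
      ennreal (exp (h * p) / p - exp (0 * p) / p)"
    using assms by (intro nn_integral_FTC_Icc) (auto intro!: derivative_eq_intros)
  then show ?thesis by (simp add: mult.commute diff_divide_distrib)
qed

text \<open>The measurable version \<open>Y\<close> of \<open>X\<close> is a parameter, so that integrals over time can be written without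
  choosing it again each time.\<close>

locale stable_levy = prob_space M for M :: "'a measure" +
  fixes X :: "real \<Rightarrow> 'a \<Rightarrow> real" and \<alpha> :: real and Y :: "real \<times> 'a \<Rightarrow> real"
  assumes \<alpha>: "0 < \<alpha>" "\<alpha> < 1"
    and X_measurable: "\<And>t. 0 \<le> t \<Longrightarrow> X t \<in> borel_measurable M"
    and X_0: "AE \<omega> in M. X 0 \<omega> = 0"
    and X_indep: "\<And>n t. 0 \<le> t 0 \<Longrightarrow> mono t \<Longrightarrow>
        indep_vars (\<lambda>_. borel) (\<lambda>i \<omega>. X (t (Suc i)) \<omega> - X (t i) \<omega>) {..<n :: nat}"
    and X_stationary: "\<And>s h. 0 \<le> s \<Longrightarrow> 0 \<le> h \<Longrightarrow>
        distr M borel (\<lambda>\<omega>. X (s + h) \<omega> - X s \<omega>) = distr M borel (X h)"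
    and X_right_continuous: "AE \<omega> in M. \<forall>t\<ge>0. ((\<lambda>t. X t \<omega>) \<longlongrightarrow> X t \<omega>) (at_right t)"
    and X_laplace_integrable: "\<And>\<eta> t. 0 \<le> \<eta> \<Longrightarrow> 0 \<le> t \<Longrightarrow> integrable M (\<lambda>\<omega>. exp (- \<eta> * X t \<omega>))"
    and X_laplace: "\<And>\<eta> t. 0 \<le> \<eta> \<Longrightarrow> 0 \<le> t \<Longrightarrow>
        (\<integral>\<omega>. exp (- \<eta> * X t \<omega>) \<partial>M) = exp (t * \<eta> powr (1 + \<alpha>))"
    and Y_measurable[measurable]: "Y \<in> borel_measurable (borel \<Otimes>\<^sub>M M)"
    and Y_eq: "AE \<omega> in M. \<forall>s\<ge>0. Y (s, \<omega>) = X s \<omega>"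
begin

sublocale P: pair_sigma_finite lborel M ..

abbreviation W :: "real \<Rightarrow> real" where "W \<equiv> scale \<alpha>"

lemma W_nonneg[simp]: "0 \<le> W r" using \<alpha> by (intro scale_nonneg)

lemma nn_laplace: "0 \<le> \<eta> \<Longrightarrow> 0 \<le> t \<Longrightarrow>
    (\<integral>\<^sup>+\<omega>. ennreal (exp (- \<eta> * X t \<omega>)) \<partial>M) = ennreal (exp (t * \<eta> powr (1 + \<alpha>)))"
  using X_laplace_integrable X_laplace by (subst nn_integral_eq_integral) auto

lemma nn_integral_Y_cong:
  assumes "0 \<le> s" "f \<in> borel_measurable borel"
  shows "(\<integral>\<^sup>+\<omega>. f (Y (s, \<omega>)) \<partial>M) = (\<integral>\<^sup>+\<omega>. f (X s \<omega>) \<partial>M)"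
  using Y_eq assms by (intro nn_integral_cong_AE) auto

text \<open>This is the Tanaka formula in integrated form: \<open>W (v - X h) - W v\<close> has the expectation of the local
  time at \<open>v\<close>, up to integration over \<open>v\<close>. Both sides are integrals of \<open>\<phi>\<close> against a measure on the line.
  At \<open>\<eta> > 0\<close> the transform of the left one is \<open>exp (h * \<psi> \<eta>) / \<psi> \<eta>\<close>, that of the right one is
  \<open>1 / \<psi> \<eta> + (exp (h * \<psi> \<eta>) - 1) / \<psi> \<eta>\<close>, so they coincide. The two-sided transforms converge
  because the upward jumps leave all negative exponential moments of \<open>X\<close> finite.\<close>

lemma potential_identity:
  assumes h: "0 \<le> h" and \<phi>[measurable]: "\<phi> \<in> borel_measurable borel"
  shows "(\<integral>\<^sup>+\<omega>. (\<integral>\<^sup>+r. ennreal (W r) * \<phi> (r + X h \<omega>) \<partial>lborel) \<partial>M) =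
    (\<integral>\<^sup>+r. ennreal (W r) * \<phi> r \<partial>lborel) +
    (\<integral>\<^sup>+s. (\<integral>\<^sup>+\<omega>. indicator {0..h} s * \<phi> (Y (s, \<omega>)) \<partial>M) \<partial>lborel)"
proof -
  note [measurable] = X_measurable[OF h]
  define \<mu> where "\<mu> = distr (density (lborel \<Otimes>\<^sub>M M) (\<lambda>(r, \<omega>). ennreal (W r))) borel (\<lambda>(r, \<omega>). r + X h \<omega>)"
  \<comment> \<open>The sum of two measures as one image measure: negative first coordinates carry the density \<open>W\<close>,
      those in \<open>{0..h}\<close> the occupation measure of \<open>Y\<close>.\<close>
  define \<nu> where "\<nu> = distr (density (lborel \<Otimes>\<^sub>M M)
      (\<lambda>(s, \<omega>). if s < 0 then ennreal (W (- s)) else indicator {0..h} s)) borel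
      (\<lambda>(s, \<omega>). if s < 0 then - s else Y (s, \<omega>))"
  have Y': "Y \<in> borel_measurable (lborel \<Otimes>\<^sub>M M)" by simp
  have nn_\<mu>: "(\<integral>\<^sup>+v. f v \<partial>\<mu>) = (\<integral>\<^sup>+\<omega>. (\<integral>\<^sup>+r. ennreal (W r) * f (r + X h \<omega>) \<partial>lborel) \<partial>M)"
    if [measurable]: "f \<in> borel_measurable borel" for f
  proof -
    have "(\<integral>\<^sup>+v. f v \<partial>\<mu>) = (\<integral>\<^sup>+p. (case p of (r, \<omega>) \<Rightarrow> ennreal (W r) * f (r + X h \<omega>)) \<partial>(lborel \<Otimes>\<^sub>M M))"
      unfolding \<mu>_def by (simp add: nn_integral_distr nn_integral_density split_beta')
    then show ?thesis by (simp add: P.nn_integral_snd[symmetric])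
  qed
  have nn_\<nu>: "(\<integral>\<^sup>+v. f v \<partial>\<nu>) = (\<integral>\<^sup>+r. ennreal (W r) * f r \<partial>lborel) +
      (\<integral>\<^sup>+s. (\<integral>\<^sup>+\<omega>. indicator {0..h} s * f (Y (s, \<omega>)) \<partial>M) \<partial>lborel)"
    if [measurable]: "f \<in> borel_measurable borel" for f
  proof -
    have "(\<integral>\<^sup>+v. f v \<partial>\<nu>) = (\<integral>\<^sup>+p. (case p of (s, \<omega>) \<Rightarrow>
        (if s < 0 then ennreal (W (- s)) else indicator {0..h} s) *
        f (if s < 0 then - s else Y (s, \<omega>))) \<partial>(lborel \<Otimes>\<^sub>M M))"
      unfolding \<nu>_def by (simp add: nn_integral_distr nn_integral_density split_beta')
    also have "\<dots> = (\<integral>\<^sup>+p. ennreal (W (- fst p)) * f (- fst p) +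
        indicator {0..h} (fst p) * f (Y p) \<partial>(lborel \<Otimes>\<^sub>M M))"
      using \<alpha> by (intro nn_integral_cong) (auto simp: indicator_def scale_eq_0)
    also have "\<dots> = (\<integral>\<^sup>+p. ennreal (W (- fst p)) * f (- fst p) \<partial>(lborel \<Otimes>\<^sub>M M)) +
        (\<integral>\<^sup>+p. indicator {0..h} (fst p) * f (Y p) \<partial>(lborel \<Otimes>\<^sub>M M))"
      by (rule nn_integral_add) measurable
    also have "(\<integral>\<^sup>+p. ennreal (W (- fst p)) * f (- fst p) \<partial>(lborel \<Otimes>\<^sub>M M)) =
        (\<integral>\<^sup>+s. ennreal (W (- s)) * f (- s) \<partial>lborel)"
      by (subst nn_integral_fst[symmetric]) (simp_all add: emeasure_space_1)
    also have "\<dots> = (\<integral>\<^sup>+r. ennreal (W r) * f r \<partial>lborel)"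
      by (subst nn_integral_real_affine[of "\<lambda>r. ennreal (W r) * f r" "-1" 0]) simp_all
    finally show ?thesis
      by (simp add: nn_integral_fst[symmetric])
  qed
  let ?c = "\<lambda>\<eta>. \<eta> powr - (1 + \<alpha>) * exp (h * \<eta> powr (1 + \<alpha>))"
  have "\<mu> = \<nu>"
  proof (rule measure_eq_of_laplace_eq)
    show "sets \<mu> = sets borel" "sets \<nu> = sets borel" by (simp_all add: \<mu>_def \<nu>_def)
    fix \<eta> :: real assume \<eta>: "0 < \<eta>"
    show "0 < ?c \<eta>" using \<eta> by simp
    have "(\<integral>\<^sup>+v. ennreal (exp (- \<eta> * v)) \<partial>\<mu>) =
      (\<integral>\<^sup>+\<omega>. (\<integral>\<^sup>+r. ennreal (exp (- \<eta> * X h \<omega>)) * ennreal (exp (- \<eta> * r) * W r) \<partial>lborel) \<partial>M)"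
      by (subst nn_\<mu>) (auto intro!: nn_integral_cong
            simp: ennreal_mult'[symmetric] exp_add[symmetric] algebra_simps)
    also have "\<dots> = (\<integral>\<^sup>+\<omega>. ennreal (exp (- \<eta> * X h \<omega>)) * ennreal (\<eta> powr - (1 + \<alpha>)) \<partial>M)"
      using nn_integral_scale_exp[OF \<alpha>(1) \<eta>] by (subst nn_integral_cmult) auto
    also have "\<dots> = ennreal (exp (h * \<eta> powr (1 + \<alpha>))) * ennreal (\<eta> powr - (1 + \<alpha>))"
      using nn_laplace[of \<eta> h] \<eta> h by (subst nn_integral_multc) auto
    finally show "(\<integral>\<^sup>+v. ennreal (exp (- \<eta> * v)) \<partial>\<mu>) = ennreal (?c \<eta>)"
      by (simp add: ennreal_mult'[symmetric] mult.commute)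
    let ?p = "\<eta> powr (1 + \<alpha>)"
    have "(\<integral>\<^sup>+s. (\<integral>\<^sup>+\<omega>. indicator {0..h} s * ennreal (exp (- \<eta> * Y (s, \<omega>))) \<partial>M) \<partial>lborel) =
        (\<integral>\<^sup>+s. indicator {0..h} s * ennreal (exp (s * ?p)) \<partial>lborel)"
    proof (rule nn_integral_cong)
      fix s :: real
      show "(\<integral>\<^sup>+\<omega>. indicator {0..h} s * ennreal (exp (- \<eta> * Y (s, \<omega>))) \<partial>M) =
          indicator {0..h} s * ennreal (exp (s * ?p))"
        using nn_integral_Y_cong[of s "\<lambda>x. ennreal (exp (- \<eta> * x))"] nn_laplace[of \<eta> s] \<eta>
        by (cases "s \<in> {0..h}") auto
    qed
    also have "\<dots> = ennreal ((exp (h * ?p) - 1) / ?p)"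
      using \<eta> h by (intro nn_integral_exp_Icc) auto
    finally have "(\<integral>\<^sup>+v. ennreal (exp (- \<eta> * v)) \<partial>\<nu>) =
        ennreal (\<eta> powr - (1 + \<alpha>)) + ennreal ((exp (h * ?p) - 1) / ?p)"
      using nn_integral_scale_exp[OF \<alpha>(1) \<eta>]
      by (subst nn_\<nu>) (auto simp: ennreal_mult'[symmetric] mult.commute)
    also have "\<dots> = ennreal (?c \<eta>)"
      using \<eta> h by (subst ennreal_plus[symmetric])
        (auto simp: powr_minus field_simps simp del: minus_add_distrib ennreal_plus)
    finally show "(\<integral>\<^sup>+v. ennreal (exp (- \<eta> * v)) \<partial>\<nu>) = ennreal (?c \<eta>)" .
  qed
  then have "(\<integral>\<^sup>+v. \<phi> v \<partial>\<mu>) = (\<integral>\<^sup>+v. \<phi> v \<partial>\<nu>)" by simp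
  then show ?thesis by (simp add: nn_\<mu> nn_\<nu>)
qed
end

section \<open>A maximal inequality for random walks\<close>

lemma (in prob_space) nn_integral_indep_next:
  fixes \<xi> :: "nat \<Rightarrow> 'a \<Rightarrow> real"
  assumes ind: "indep_vars (\<lambda>_. borel) \<xi> {..<n}" and k: "k < n"
    and F[measurable]: "F \<in> borel_measurable (PiM {..<k} (\<lambda>_. borel) \<Otimes>\<^sub>M borel)"
  shows "(\<integral>\<^sup>+\<omega>. F (\<lambda>i\<in>{..<k}. \<xi> i \<omega>, \<xi> k \<omega>) \<partial>M) =
    (\<integral>\<^sup>+\<omega>. (\<integral>\<^sup>+x. F (\<lambda>i\<in>{..<k}. \<xi> i \<omega>, x) \<partial>distr M borel (\<xi> k)) \<partial>M)"
proof -
  let ?P = "PiM {..<k} (\<lambda>_. borel :: real measure)" and ?Q = "PiM {k} (\<lambda>_. borel :: real measure)"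
  let ?V = "\<lambda>\<omega>. \<lambda>i\<in>{..<k}. \<xi> i \<omega>" and ?U = "\<lambda>\<omega>. \<lambda>i\<in>{k}. \<xi> i \<omega>"
  have iv: "indep_var ?P ?V ?Q ?U"
    by (rule indep_var_restrict[OF ind]) (use k in auto)
  note rv[measurable] = indep_var_rv1[OF iv] indep_var_rv2[OF iv]
  have [measurable]: "\<xi> k \<in> borel_measurable M"
    using ind k by (auto simp: indep_vars_def)
  interpret D: prob_space "distr M ?Q ?U" by (rule prob_space_distr) measurable
  have [measurable]: "(\<lambda>w. w k) \<in> borel_measurable ?Q" by simp
  have "(\<integral>\<^sup>+\<omega>. F (?V \<omega>, \<xi> k \<omega>) \<partial>M) =
      (\<integral>\<^sup>+p. F (fst p, snd p k) \<partial>distr M (?P \<Otimes>\<^sub>M ?Q) (\<lambda>\<omega>. (?V \<omega>, ?U \<omega>)))"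
    by (subst nn_integral_distr) simp_all
  also have "\<dots> = (\<integral>\<^sup>+p. F (fst p, snd p k) \<partial>(distr M ?P ?V \<Otimes>\<^sub>M distr M ?Q ?U))"
    using iv by (simp add: indep_var_distribution_eq)
  also have "\<dots> = (\<integral>\<^sup>+v. (\<integral>\<^sup>+w. F (v, w k) \<partial>distr M ?Q ?U) \<partial>distr M ?P ?V)"
    by (subst D.nn_integral_fst[symmetric]) simp_all
  also have "\<dots> = (\<integral>\<^sup>+\<omega>. (\<integral>\<^sup>+w. F (?V \<omega>, w k) \<partial>distr M ?Q ?U) \<partial>M)"
    by (subst nn_integral_distr) simp_all
  also have "\<dots> = (\<integral>\<^sup>+\<omega>. (\<integral>\<^sup>+x. F (?V \<omega>, x) \<partial>distr M borel (\<xi> k)) \<partial>M)"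
  proof (rule nn_integral_cong)
    fix \<omega> assume "\<omega> \<in> space M"
    then have [measurable]: "(\<lambda>x. F (?V \<omega>, x)) \<in> borel_measurable borel"
      using measurable_space[OF rv(1)] by (intro measurable_compose[OF _ F]) simp
    show "(\<integral>\<^sup>+w. F (?V \<omega>, w k) \<partial>distr M ?Q ?U) = (\<integral>\<^sup>+x. F (?V \<omega>, x) \<partial>distr M borel (\<xi> k))"
      by (subst (1 2) nn_integral_distr) simp_all
  qed
  finally show ?thesis .
qed

text \<open>By \<open>super\<close>, the process \<open>exp (A k) * u (S k)\<close> with \<open>A k = (\<Sum>j<k. a (S j))\<close> is a positive supermartingale
  for the walk \<open>S\<close>, started at a value of at most \<open>3 / 2\<close>; when \<open>A\<close> first reaches \<open>c\<close> it is at least \<open>exp c / 2\<close>. Optional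
  stopping is done by hand: \<open>R\<close> is this process frozen at the value \<open>exp c / 2\<close> once \<open>A\<close> has hit \<open>c\<close>, and its
  expectation decreases because \<open>A (k + 1)\<close> depends on the first \<open>k\<close> steps only, so that the next step can
  be integrated out.\<close>

lemma (in prob_space) random_walk_maximal_inequality:
  fixes \<xi> :: "nat \<Rightarrow> 'a \<Rightarrow> real" and u a :: "real \<Rightarrow> real"
  assumes ind: "indep_vars (\<lambda>_. borel) \<xi> {..<n}"
    and dist: "\<And>i. i < n \<Longrightarrow> distr M borel (\<xi> i) = \<mu>"
    and [measurable]: "u \<in> borel_measurable borel" "a \<in> borel_measurable borel"
    and u: "\<And>z. 1 / 2 \<le> u z" "\<And>z. u z \<le> 3 / 2"
    and super: "\<And>z. ennreal (exp (a z)) * (\<integral>\<^sup>+x. ennreal (u (z + x)) \<partial>\<mu>) \<le> ennreal (u z)"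
  shows "emeasure M {\<omega>\<in>space M. \<exists>k\<le>n. c \<le> (\<Sum>j<k. a (\<Sum>i<j. \<xi> i \<omega>))} \<le> ennreal (3 * exp (- c))"
proof -
  define S where "S v j = (\<Sum>i<j. v i)" for v :: "nat \<Rightarrow> real" and j
  define A where "A v k = (\<Sum>j<k. a (S v j))" for v k
  define hit where "hit v k \<longleftrightarrow> (\<exists>j\<le>k. c \<le> A v j)" for v k
  define R where "R v k = (if hit v k then exp c / 2 else exp (A v k) * u (S v k))" for v k
  define rest where "rest v k = (if hit v k then 0 else exp (A v (Suc k)))" for v k
  define \<xi>' where "\<xi>' \<omega> = (\<lambda>i. \<xi> i \<omega>)" for \<omega>
  have [measurable]: "\<xi> i \<in> borel_measurable M" if "i < n" for i
    using ind that by (auto simp: indep_vars_def)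
  have S_cong: "S v j = S w j" if "\<And>i. i < j \<Longrightarrow> v i = w i" for v w j
    using that unfolding S_def by (intro sum.cong) auto
  have A_cong: "A v j = A w j" if "\<And>i. Suc i < j \<Longrightarrow> v i = w i" for v w j
    unfolding A_def using that by (intro sum.cong refl arg_cong[of _ _ a] S_cong) auto
  have hit_cong: "hit v j = hit w j" if "\<And>i. i < j \<Longrightarrow> v i = w i" for v w j
    unfolding hit_def using that by (intro ex_cong conj_cong refl arg_cong[of _ _ "\<lambda>x. c \<le> x"] A_cong) auto
  have rest_cong: "rest v k = rest w k" if "\<And>i. i < k \<Longrightarrow> v i = w i" for v w k
    using hit_cong[of k v w] A_cong[of "Suc k" v w] that by (simp add: rest_def)
  have mS[measurable]: "(\<lambda>v. S v j) \<in> borel_measurable (PiM {..<k} (\<lambda>_. borel))" if "j \<le> k" for j k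
    unfolding S_def using that by (intro borel_measurable_sum measurable_component_singleton) auto
  have mA[measurable]: "(\<lambda>v. A v j) \<in> borel_measurable (PiM {..<k} (\<lambda>_. borel))" if "j \<le> Suc k" for j k
    unfolding A_def using that by (intro borel_measurable_sum measurable_compose[OF mS]) auto
  have mhit[measurable]: "Measurable.pred (PiM {..<k} (\<lambda>_. borel)) (\<lambda>v. hit v k)" for k
    unfolding hit_def by measurable
  have mrest[measurable]: "(\<lambda>v. rest v k) \<in> borel_measurable (PiM {..<k} (\<lambda>_. borel))" for k
    unfolding rest_def by measurable
  have mR[measurable]: "(\<lambda>v. R v k) \<in> borel_measurable (PiM {..<k} (\<lambda>_. borel))" for k
    unfolding R_def by measurable
  have restr[measurable]: "(\<lambda>\<omega>. \<lambda>i\<in>{..<k}. \<xi> i \<omega>) \<in> measurable M (PiM {..<k} (\<lambda>_. borel))" if "k \<le> n" for k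
    using that by (intro measurable_restrict) auto
  have R_cong: "R v k = R w k" if "\<And>i. i < k \<Longrightarrow> v i = w i" for v w k
    using hit_cong[of k v w] A_cong[of k v w] S_cong[of k v w] that by (simp add: R_def)
  have restrict_eq: "R (\<xi>' \<omega>) k = R (\<lambda>i\<in>{..<k}. \<xi> i \<omega>) k" "rest (\<xi>' \<omega>) k = rest (\<lambda>i\<in>{..<k}. \<xi> i \<omega>) k"
      "hit (\<xi>' \<omega>) k = hit (\<lambda>i\<in>{..<k}. \<xi> i \<omega>) k" "S (\<xi>' \<omega>) k = S (\<lambda>i\<in>{..<k}. \<xi> i \<omega>) k" for k \<omega>
    by (auto intro!: R_cong rest_cong hit_cong S_cong simp: \<xi>'_def)
  have mR'[measurable]: "(\<lambda>\<omega>. R (\<xi>' \<omega>) k) \<in> borel_measurable M" if "k \<le> n" for k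
    unfolding restrict_eq using that by measurable
  have mrest'[measurable]: "(\<lambda>\<omega>. rest (\<xi>' \<omega>) k) \<in> borel_measurable M" if "k \<le> n" for k
    unfolding restrict_eq using that by measurable
  have mhit'[measurable]: "Measurable.pred M (\<lambda>\<omega>. hit (\<xi>' \<omega>) k)" if "k \<le> n" for k
    unfolding restrict_eq using that by measurable
  have unn: "0 \<le> u z" for z using u(1)[of z] by simp
  have step: "(\<integral>\<^sup>+\<omega>. ennreal (R (\<xi>' \<omega>) (Suc k)) \<partial>M) \<le> (\<integral>\<^sup>+\<omega>. ennreal (R (\<xi>' \<omega>) k) \<partial>M)" if k: "k < n" for k
  proof -
    have [measurable]: "Measurable.pred M (\<lambda>\<omega>. hit (\<xi>' \<omega>) k)" "(\<lambda>\<omega>. rest (\<xi>' \<omega>) k) \<in> borel_measurable M"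
        "(\<lambda>\<omega>. R (\<xi>' \<omega>) k) \<in> borel_measurable M"
      using k by (auto intro!: mhit' mrest' mR')
    have [measurable]: "(\<lambda>v. S v k) \<in> borel_measurable (PiM {..<k} (\<lambda>_. borel))"
      by (rule mS) simp
    have le: "R v (Suc k) \<le> (if hit v k then exp c / 2 else 0) + rest v k * u (S v k + v k)" for v
    proof (cases "hit v k")
      case True
      then have "hit v (Suc k)" unfolding hit_def using le_SucI by blast
      with True show ?thesis by (simp add: R_def rest_def)
    next
      case False
      show ?thesis
      proof (cases "hit v (Suc k)")
        case True
        with False have "c \<le> A v (Suc k)" unfolding hit_def using le_Suc_eq by auto
        then have "exp c * (1 / 2) \<le> exp (A v (Suc k)) * u (S v k + v k)"
          by (intro mult_mono u) auto
        with False True show ?thesis by (simp add: R_def rest_def)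
      qed (use False in \<open>simp add: R_def rest_def S_def\<close>)
    qed
    have "(\<integral>\<^sup>+\<omega>. ennreal (R (\<xi>' \<omega>) (Suc k)) \<partial>M) \<le>
      (\<integral>\<^sup>+\<omega>. ennreal (if hit (\<xi>' \<omega>) k then exp c / 2 else 0) +
        ennreal (rest (\<xi>' \<omega>) k * u (S (\<xi>' \<omega>) k + \<xi>' \<omega> k)) \<partial>M)"
    proof (intro nn_integral_mono)
      fix \<omega>
      have "0 \<le> rest v k * u (S v k + v k)" for v
        using unn by (simp add: rest_def)
      then show "ennreal (R (\<xi>' \<omega>) (Suc k)) \<le> ennreal (if hit (\<xi>' \<omega>) k then exp c / 2 else 0) +
          ennreal (rest (\<xi>' \<omega>) k * u (S (\<xi>' \<omega>) k + \<xi>' \<omega> k))"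
        by (subst ennreal_plus[symmetric]) (simp_all only: le ennreal_leI, simp)
    qed
    also have "\<dots> = (\<integral>\<^sup>+\<omega>. ennreal (if hit (\<xi>' \<omega>) k then exp c / 2 else 0) \<partial>M) +
        (\<integral>\<^sup>+\<omega>. ennreal (rest (\<xi>' \<omega>) k * u (S (\<xi>' \<omega>) k + \<xi>' \<omega> k)) \<partial>M)"
    proof (rule nn_integral_add)
      show "(\<lambda>\<omega>. ennreal (rest (\<xi>' \<omega>) k * u (S (\<xi>' \<omega>) k + \<xi>' \<omega> k))) \<in> borel_measurable M"
      proof -
        have [measurable]: "(\<lambda>\<omega>. S (\<xi>' \<omega>) k) \<in> borel_measurable M"
          using k unfolding S_def \<xi>'_def by (intro borel_measurable_sum) auto
        have [measurable]: "(\<lambda>\<omega>. \<xi>' \<omega> k) \<in> borel_measurable M"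
          using k by (simp add: \<xi>'_def)
        have [measurable]: "(\<lambda>\<omega>. u (S (\<xi>' \<omega>) k + \<xi>' \<omega> k)) \<in> borel_measurable M"
          by (rule measurable_compose[where N = borel]) measurable
        show ?thesis by measurable
      qed
    qed (use k in measurable)
    also have "(\<integral>\<^sup>+\<omega>. ennreal (rest (\<xi>' \<omega>) k * u (S (\<xi>' \<omega>) k + \<xi>' \<omega> k)) \<partial>M) =
      (\<integral>\<^sup>+\<omega>. (case (\<lambda>i\<in>{..<k}. \<xi> i \<omega>, \<xi> k \<omega>) of (v, x) \<Rightarrow> ennreal (rest v k * u (S v k + x))) \<partial>M)"
      using restrict_eq by (simp add: \<xi>'_def)
    also have "\<dots> = (\<integral>\<^sup>+\<omega>. (\<integral>\<^sup>+x. (case (\<lambda>i\<in>{..<k}. \<xi> i \<omega>, x) of (v, x) \<Rightarrow>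
        ennreal (rest v k * u (S v k + x))) \<partial>distr M borel (\<xi> k)) \<partial>M)"
      by (rule nn_integral_indep_next[OF ind k]) measurable
    also have "\<dots> = (\<integral>\<^sup>+\<omega>. (\<integral>\<^sup>+x. ennreal (rest (\<xi>' \<omega>) k) * ennreal (u (S (\<xi>' \<omega>) k + x)) \<partial>\<mu>) \<partial>M)"
      using restrict_eq dist[OF k]
      by (simp add: ennreal_mult' rest_def)
    also have "\<dots> = (\<integral>\<^sup>+\<omega>. ennreal (rest (\<xi>' \<omega>) k) * (\<integral>\<^sup>+x. ennreal (u (S (\<xi>' \<omega>) k + x)) \<partial>\<mu>) \<partial>M)"
      unfolding dist[OF k, symmetric] by (intro nn_integral_cong nn_integral_cmult) measurable
    also have "\<dots> \<le> (\<integral>\<^sup>+\<omega>. (if hit (\<xi>' \<omega>) k then 0 else ennreal (R (\<xi>' \<omega>) k)) \<partial>M)"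
    proof (rule nn_integral_mono)
      fix \<omega>
      have "ennreal (exp (A v k)) * (ennreal (exp (a (S v k))) * (\<integral>\<^sup>+x. ennreal (u (S v k + x)) \<partial>\<mu>)) \<le>
          ennreal (exp (A v k)) * ennreal (u (S v k))" for v
        by (intro mult_left_mono super) simp
      then have "ennreal (exp (A v (Suc k))) * (\<integral>\<^sup>+x. ennreal (u (S v k + x)) \<partial>\<mu>) \<le>
          ennreal (exp (A v k) * u (S v k))" for v
        by (simp add: A_def exp_add ennreal_mult' mult.assoc)
      then show "ennreal (rest (\<xi>' \<omega>) k) * (\<integral>\<^sup>+x. ennreal (u (S (\<xi>' \<omega>) k + x)) \<partial>\<mu>)
          \<le> (if hit (\<xi>' \<omega>) k then 0 else ennreal (R (\<xi>' \<omega>) k))"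
        by (simp add: rest_def R_def)
    qed
    also have "(\<integral>\<^sup>+\<omega>. ennreal (if hit (\<xi>' \<omega>) k then exp c / 2 else 0) \<partial>M) + \<dots> =
      (\<integral>\<^sup>+\<omega>. ennreal (if hit (\<xi>' \<omega>) k then exp c / 2 else 0) +
        (if hit (\<xi>' \<omega>) k then 0 else ennreal (R (\<xi>' \<omega>) k)) \<partial>M)"
      using k by (intro nn_integral_add[symmetric]) simp_all
    also have "\<dots> = (\<integral>\<^sup>+\<omega>. ennreal (R (\<xi>' \<omega>) k) \<partial>M)"
      by (intro nn_integral_cong) (simp add: R_def)
    finally show ?thesis by (simp add: add_left_mono)
  qed
  have "(\<integral>\<^sup>+\<omega>. ennreal (R (\<xi>' \<omega>) k) \<partial>M) \<le> ennreal (3 / 2)" if "k \<le> n" for k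
    using that
  proof (induction k)
    case 0
    have "R v 0 \<le> 3 / 2" for v
      using u(2)[of 0] order_trans[of "exp c" 1 3] by (auto simp: R_def hit_def A_def S_def)
    then have "(\<integral>\<^sup>+\<omega>. ennreal (R (\<xi>' \<omega>) 0) \<partial>M) \<le> (\<integral>\<^sup>+\<omega>. ennreal (3 / 2) \<partial>M)"
      by (intro nn_integral_mono ennreal_leI)
    then show ?case by (simp add: emeasure_space_1)
  next
    case (Suc k)
    then show ?case using step[of k] by (auto intro: order_trans)
  qed
  from this[of n] have fin: "(\<integral>\<^sup>+\<omega>. ennreal (R (\<xi>' \<omega>) n) \<partial>M) \<le> ennreal (3 / 2)" by simp
  have "emeasure M {\<omega>\<in>space M. hit (\<xi>' \<omega>) n} =
      ennreal (2 * exp (- c)) * (\<integral>\<^sup>+\<omega>. ennreal (exp c / 2) * indicator {\<omega>\<in>space M. hit (\<xi>' \<omega>) n} \<omega> \<partial>M)"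
    by (subst nn_integral_cmult_indicator)
       (auto simp: mult.assoc[symmetric] ennreal_mult[symmetric] exp_minus)
  also have "\<dots> \<le> ennreal (2 * exp (- c)) * (\<integral>\<^sup>+\<omega>. ennreal (R (\<xi>' \<omega>) n) \<partial>M)"
    by (intro mult_left_mono nn_integral_mono) (auto simp: R_def indicator_def)
  also have "\<dots> \<le> ennreal (2 * exp (- c)) * ennreal (3 / 2)"
    by (intro mult_left_mono fin) simp
  also have "\<dots> = ennreal (3 * exp (- c))"
    by (simp add: ennreal_mult[symmetric])
  finally show ?thesis
    by (simp add: hit_def A_def S_def \<xi>'_def)
qed

section \<open>Tools for the passage to continuous time\<close>

text \<open>Fatou's lemma for events. It carries a probability bound through the two limits below, in which the
  time mesh and the width of the test functions go to 0.\<close>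

lemma (in prob_space) emeasure_le_of_eventually:
  assumes A[measurable]: "\<And>i. A i \<in> sets M" and B[measurable]: "B \<in> sets M"
    and ev: "AE \<omega> in M. \<omega> \<in> B \<longrightarrow> eventually (\<lambda>i. \<omega> \<in> A i) sequentially"
    and le: "\<And>i. emeasure M (A i) \<le> p"
  shows "emeasure M B \<le> p"
proof -
  have "emeasure M B = (\<integral>\<^sup>+\<omega>. indicator B \<omega> \<partial>M)" by simp
  also have "\<dots> \<le> (\<integral>\<^sup>+\<omega>. liminf (\<lambda>i. indicator (A i) \<omega>) \<partial>M)"
  proof (rule nn_integral_mono_AE)
    show "AE \<omega> in M. indicator B \<omega> \<le> liminf (\<lambda>i. indicator (A i) \<omega> :: ennreal)"
      using ev
    proof eventually_elim
      case (elim \<omega>)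
      show ?case
      proof (cases "\<omega> \<in> B")
        case True
        with elim have "eventually (\<lambda>i. 1 \<le> (indicator (A i) \<omega> :: ennreal)) sequentially"
          by (auto elim: eventually_mono)
        then have "1 \<le> liminf (\<lambda>i. indicator (A i) \<omega> :: ennreal)"
          by (rule Liminf_bounded)
        with True show ?thesis by simp
      qed simp
    qed
  qed
  also have "\<dots> \<le> liminf (\<lambda>i. \<integral>\<^sup>+\<omega>. indicator (A i) \<omega> \<partial>M)"
    by (rule nn_integral_liminf) simp
  also have "\<dots> \<le> p"
    using le by (intro Liminf_le always_eventually allI) auto
  finally show ?thesis .
qed

text \<open>With \<open>u = 1 - \<theta> * f\<close>, the factor \<open>u - \<theta> * G\<close> is \<open>u * (1 - \<theta> * G / u) \<le> u * exp (- \<theta> * G / u)\<close>. Replacing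
  \<open>G / u\<close> by \<open>G\<close> costs \<open>\<theta>\<^sup>2 * f * G / u\<close>, which is of second order in \<open>\<theta>\<close> and small with \<open>f\<close>; this is where
  the compensator \<open>2 * \<theta>\<^sup>2 * D\<close> comes from.\<close>

lemma exp_tilt_le:
  fixes G f D \<theta> :: real
  assumes \<theta>: "0 < \<theta>" and f: "\<bar>f\<bar> \<le> D" and D: "\<theta> * D \<le> 1 / 2"
  shows "exp (\<theta> * G - 2 * \<theta>\<^sup>2 * D * \<bar>G\<bar>) * ((1 - \<theta> * f) - \<theta> * G) \<le> 1 - \<theta> * f"
proof -
  define u where "u = 1 - \<theta> * f"
  have "\<bar>\<theta> * f\<bar> \<le> \<theta> * D" using \<theta> f by (simp add: abs_mult)
  then have u: "1 / 2 \<le> u" using D by (auto simp: u_def abs_le_iff)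
  have "\<bar>\<theta> * (\<theta> * f) * G\<bar> / u \<le> (\<theta> * (\<theta> * D) * \<bar>G\<bar>) / (1 / 2)"
    using u \<theta> f by (intro frac_le) (auto simp: abs_mult intro!: mult_mono mult_nonneg_nonneg)
  then have "- (2 * \<theta>\<^sup>2 * D * \<bar>G\<bar>) \<le> \<theta> * (\<theta> * f) * G / u"
    using u by (simp add: power2_eq_square abs_le_iff divide_simps split: if_splits)
  moreover have "\<theta> * G / u = \<theta> * G + \<theta> * (\<theta> * f) * G / u"
    using u by (simp add: u_def field_simps)
  ultimately have a: "\<theta> * G - 2 * \<theta>\<^sup>2 * D * \<bar>G\<bar> \<le> \<theta> * G / u" by linarith
  have "u - \<theta> * G = u * (1 + (- (\<theta> * G / u)))" using u by (simp add: field_simps)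
  also have "\<dots> \<le> u * exp (- (\<theta> * G / u))"
    using u by (intro mult_left_mono exp_ge_add_one_self) auto
  finally have "exp (\<theta> * G - 2 * \<theta>\<^sup>2 * D * \<bar>G\<bar>) * (u - \<theta> * G) \<le>
      exp (\<theta> * G - 2 * \<theta>\<^sup>2 * D * \<bar>G\<bar>) * (u * exp (- (\<theta> * G / u)))"
    by (rule mult_left_mono) simp
  also have "\<dots> \<le> exp (\<theta> * G / u) * (u * exp (- (\<theta> * G / u)))"
    using a u by (intro mult_right_mono) auto
  also have "\<dots> = u" by (simp add: exp_minus)
  finally show ?thesis by (simp add: u_def)
qed

lemma has_bochner_integral_dyadic_step:
  fixes f :: "real \<Rightarrow> real"
  shows "has_bochner_integral lborel (\<lambda>s. indicator {0<..real n / 2 ^ m} s * f (dyadic_ceiling m s))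
    (\<Sum>j<n. 1 / 2 ^ m * f (real (Suc j) / 2 ^ m))"
proof (induction n)
  case 0
  then show ?case by (simp add: has_bochner_integral_zero)
next
  case (Suc n)
  have "has_bochner_integral lborel (indicator {real n / 2 ^ m<..real (Suc n) / 2 ^ m} :: real \<Rightarrow> real)
      (measure lborel {real n / 2 ^ m<..real (Suc n) / 2 ^ m})"
    by (rule has_bochner_integral_real_indicator) (auto simp: divide_right_mono)
  moreover have "measure lborel {real n / 2 ^ m<..real (Suc n) / 2 ^ m} = 1 / 2 ^ m"
    by (simp add: divide_right_mono diff_divide_distrib[symmetric])
  ultimately have "has_bochner_integral lborel
      (\<lambda>s. indicator {real n / 2 ^ m<..real (Suc n) / 2 ^ m} s * f (real (Suc n) / 2 ^ m))
      (1 / 2 ^ m * f (real (Suc n) / 2 ^ m))"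
    by (intro has_bochner_integral_mult_left) simp
  from has_bochner_integral_add[OF Suc this]
  have "has_bochner_integral lborel (\<lambda>s. indicator {0<..real n / 2 ^ m} s * f (dyadic_ceiling m s) +
      indicator {real n / 2 ^ m<..real (Suc n) / 2 ^ m} s * f (real (Suc n) / 2 ^ m))
      (\<Sum>j<Suc n. 1 / 2 ^ m * f (real (Suc j) / 2 ^ m))" by simp
  also have "(\<lambda>s. indicator {0<..real n / 2 ^ m} s * f (dyadic_ceiling m s) +
      indicator {real n / 2 ^ m<..real (Suc n) / 2 ^ m} s * f (real (Suc n) / 2 ^ m)) =
      (\<lambda>s. indicator {0<..real (Suc n) / 2 ^ m} s * f (dyadic_ceiling m s))"
  proof (rule ext)
    fix s :: real
    consider "s \<le> 0" | "0 < s" "s \<le> real n / 2 ^ m" | "real n / 2 ^ m < s" "s \<le> real (Suc n) / 2 ^ m"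
      | "real (Suc n) / 2 ^ m < s" by linarith
    then show "indicator {0<..real n / 2 ^ m} s * f (dyadic_ceiling m s) +
      indicator {real n / 2 ^ m<..real (Suc n) / 2 ^ m} s * f (real (Suc n) / 2 ^ m) =
      indicator {0<..real (Suc n) / 2 ^ m} s * f (dyadic_ceiling m s)"
    proof cases
      case 1
      then have "\<not> real n / 2 ^ m < s" by (meson divide_nonneg_pos dual_order.strict_trans1 less_le_not_le of_nat_0_le_iff zero_less_numeral zero_less_power)
      with 1 show ?thesis by simp
    next
      case 2
      then have "s \<le> real (Suc n) / 2 ^ m" by (simp add: field_simps)
      with 2 show ?thesis by simp
    next
      case 3
      then have "0 < s" by (meson divide_nonneg_pos le_less_trans of_nat_0_le_iff zero_less_numeral zero_less_power)
      moreover have "\<lceil>s * 2 ^ m\<rceil> = int (Suc n)"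
        using 3 by (intro ceiling_unique) (simp_all add: field_simps)
      ultimately show ?thesis using 3 by (simp add: dyadic_ceiling_def)
    next
      case 4
      moreover have "real n / 2 ^ m \<le> real (Suc n) / 2 ^ m" by (simp add: divide_right_mono)
      ultimately have "real n / 2 ^ m < s" by linarith
      with 4 show ?thesis by simp
    qed
  qed
  finally show ?case .
qed

text \<open>The grid sums along the walk use left endpoints. Right endpoints are handled first, since
  right-continuity of \<open>f\<close> makes the step functions converge at every time; passing to left endpoints changes the sum by a telescoping term of the order of the
  mesh.\<close>

lemma riemann_sum_tendsto:
  fixes f :: "real \<Rightarrow> real"
  assumes rc: "\<And>t. 0 \<le> t \<Longrightarrow> (f \<longlongrightarrow> f t) (at_right t)"
    and bd: "\<And>t. 0 \<le> t \<Longrightarrow> \<bar>f t\<bar> \<le> C"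
    and g[measurable]: "g \<in> borel_measurable borel" and fg: "\<And>t. 0 \<le> t \<Longrightarrow> g t = f t"
  shows "(\<lambda>i. \<Sum>j<k * 2 ^ i. 1 / 2 ^ (m + i) * f (real j / 2 ^ (m + i))) \<longlonglongrightarrow>
    (\<integral>s. indicator {0<..real k / 2 ^ m} s * g s \<partial>lborel)"
proof -
  let ?t = "real k / 2 ^ m" and ?h = "\<lambda>i. 1 / 2 ^ (m + i) :: real"
  have t: "real (k * 2 ^ i) / 2 ^ (m + i) = ?t" for i by (simp add: power_add field_simps)
  have hb: "has_bochner_integral lborel (\<lambda>s. indicator {0<..?t} s * f (dyadic_ceiling (m + i) s))
      (\<Sum>j<k * 2 ^ i. ?h i * f (real (Suc j) / 2 ^ (m + i)))" for i
    using has_bochner_integral_dyadic_step[of "k * 2 ^ i" "m + i" f] unfolding t .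
  have "(\<lambda>i. \<integral>s. indicator {0<..?t} s * f (dyadic_ceiling (m + i) s) \<partial>lborel) \<longlonglongrightarrow>
      (\<integral>s. indicator {0<..?t} s * g s \<partial>lborel)"
  proof (rule integral_dominated_convergence[where w = "\<lambda>s. indicator {0<..?t} s * C"])
    show "(\<lambda>s. indicator {0<..?t} s * f (dyadic_ceiling (m + i) s)) \<in> borel_measurable lborel" for i
      using hb[of i] by (rule borel_measurable_has_bochner_integral)
    show "integrable lborel (\<lambda>s. indicator {0<..?t} s * C)"
      by (intro integrable_mult_left integrable_real_indicator) auto
    show "AE s in lborel. (\<lambda>i. indicator {0<..?t} s * f (dyadic_ceiling (m + i) s)) \<longlonglongrightarrow> indicator {0<..?t} s * g s"
    proof (rule AE_I2)
      fix s
      show "(\<lambda>i. indicator {0<..?t} s * f (dyadic_ceiling (m + i) s)) \<longlonglongrightarrow> indicator {0<..?t} s * g s"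
      proof (cases "0 < s")
        case True
        then have "(\<lambda>n. f (dyadic_ceiling n s)) \<longlonglongrightarrow> f s"
          by (intro tendsto_dyadic_ceiling rc) simp
        then have "(\<lambda>i. f (dyadic_ceiling (i + m) s)) \<longlonglongrightarrow> f s"
          by (rule LIMSEQ_ignore_initial_segment)
        then show ?thesis using fg[of s] True by (intro tendsto_intros) (simp add: add.commute)
      qed simp
    qed
    show "AE s in lborel. norm (indicator {0<..?t} s * f (dyadic_ceiling (m + i) s)) \<le> indicator {0<..?t} s * C" for i
    proof (rule AE_I2)
      fix s
      show "norm (indicator {0<..?t} s * f (dyadic_ceiling (m + i) s)) \<le> indicator {0<..?t} s * C"
        using bd[of "dyadic_ceiling (m + i) s"] dyadic_ceiling_ge[of s "m + i"]
        by (auto simp: indicator_def)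
    qed
  qed measurable
  then have 1: "(\<lambda>i. \<Sum>j<k * 2 ^ i. ?h i * f (real (Suc j) / 2 ^ (m + i))) \<longlonglongrightarrow>
      (\<integral>s. indicator {0<..?t} s * g s \<partial>lborel)"
    unfolding has_bochner_integral_integral_eq[OF hb] .
  have "(\<lambda>i. (1 / 2) ^ i * ((1 / 2) ^ m * (f 0 - f ?t))) \<longlonglongrightarrow> 0 * ((1 / 2) ^ m * (f 0 - f ?t))"
    by (intro tendsto_intros LIMSEQ_power_zero) simp
  then have 2: "(\<lambda>i. ?h i * (f 0 - f ?t)) \<longlonglongrightarrow> 0"
    by (simp add: power_add power_divide mult_ac)
  have 3: "(\<Sum>j<k * 2 ^ i. ?h i * f (real (Suc j) / 2 ^ (m + i))) + ?h i * (f 0 - f ?t) =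
      (\<Sum>j<k * 2 ^ i. ?h i * f (real j / 2 ^ (m + i)))" for i
  proof -
    let ?F = "\<lambda>j. ?h i * f (real j / 2 ^ (m + i))"
    have "(\<Sum>j<n. ?F (Suc j)) + (?F 0 - ?F n) = (\<Sum>j<n. ?F j)" for n
      by (induction n) auto
    from this[of "k * 2 ^ i"] show ?thesis unfolding t by (simp add: right_diff_distrib)
  qed
  from tendsto_add[OF 1 2] show ?thesis unfolding 3 by simp
qed

section \<open>Potentials and occupation integrals of test functions\<close>

text \<open>Test functions that approximate a point mass. One constant \<open>L\<close> serves as bound and as Lipschitz
  constant, and \<open>K\<close> bounds the support.\<close>

definition bump :: "real \<Rightarrow> real \<Rightarrow> (real \<Rightarrow> real) \<Rightarrow> bool" where
  "bump L K g \<longleftrightarrow> (\<forall>v. 0 \<le> g v \<and> g v \<le> L) \<and> (\<forall>v w. \<bar>g v - g w\<bar> \<le> L * \<bar>v - w\<bar>) \<and>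
    (\<forall>v. K < \<bar>v\<bar> \<longrightarrow> g v = 0)"

lemma bumpD:
  assumes "bump L K g"
  shows "0 \<le> g v" "g v \<le> L" "\<bar>g v - g w\<bar> \<le> L * \<bar>v - w\<bar>" "K < \<bar>v\<bar> \<Longrightarrow> g v = 0" "0 \<le> L"
proof -
  show *: "0 \<le> g v" "g v \<le> L" "\<bar>g v - g w\<bar> \<le> L * \<bar>v - w\<bar>" "K < \<bar>v\<bar> \<Longrightarrow> g v = 0"
    using assms by (auto simp: bump_def)
  show "0 \<le> L" using *(1,2) by linarith
qed

lemma bump_continuous: assumes "bump L K g" shows "continuous_on UNIV g"
proof (rule lipschitz_on_continuous_on)
  show "L-lipschitz_on UNIV g"
    using bumpD[OF assms] by (intro lipschitz_onI) (auto simp: dist_real_def)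
qed

lemma bump_measurable: "bump L K g \<Longrightarrow> g \<in> borel_measurable borel"
  using bump_continuous borel_measurable_continuous_onI by blast

lemma bump_increment: assumes "bump L K g" shows "\<bar>g (z + v) - g z\<bar> \<le> L * min 1 \<bar>v\<bar>"
proof -
  have "\<bar>g (z + v) - g z\<bar> \<le> L"
    using bumpD(1,2)[OF assms, of z] bumpD(1,2)[OF assms, of "z + v"] by linarith
  moreover have "\<bar>g (z + v) - g z\<bar> \<le> L * \<bar>v\<bar>" using bumpD(3)[OF assms, of "z + v" z] by simp
  ultimately show ?thesis by (simp add: min_def)
qed

lemma abs_min_one_le: "\<bar>min 1 \<bar>y\<bar>\<bar> \<le> (1 :: real)"
  by (cases "\<bar>y\<bar> \<le> 1") (simp_all add: min_def)

context stable_levy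
begin

text \<open>After a translation, this is the integral of \<open>W (v - z) * g v\<close> over \<open>v\<close>. The process is recurrent, so the
  integral over time of the expectation of \<open>g\<close> along the path diverges;
  \<open>potential g\<close> plays the role of minus that integral.\<close>

definition potential :: "(real \<Rightarrow> real) \<Rightarrow> real \<Rightarrow> real" where
  "potential g z = (\<integral>r. W r * g (z + r) \<partial>lborel)"

definition occupation :: "(real \<Rightarrow> real) \<Rightarrow> real \<Rightarrow> real \<Rightarrow> real" where
  "occupation g h z = (\<integral>p. indicator {0..h} (fst p) * g (z + Y p) \<partial>(lborel \<Otimes>\<^sub>M M))"

text \<open>The mean truncated displacement accumulated until time \<open>h\<close>. It is \<open>o(h)\<close>, which makes \<open>h * g z\<close> an
  approximation of \<open>occupation g h z\<close> with an error that is uniform in \<open>z\<close>.\<close>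

definition small_displacement :: "real \<Rightarrow> real" where
  "small_displacement h = (\<integral>p. indicator {0..h} (fst p) * min 1 \<bar>Y p\<bar> \<partial>(lborel \<Otimes>\<^sub>M M))"

lemma W_le: "r \<le> s \<Longrightarrow> W r \<le> W s"
  using \<alpha> by (auto simp: scale_def intro!: divide_right_mono powr_mono2 less_imp_le[OF Gamma_real_pos])

lemma potential_integrable:
  assumes g: "bump L K g"
  shows "integrable lborel (\<lambda>r. W r * g (z + r))"
proof (rule Bochner_Integration.integrable_bound)
  note [measurable] = bump_measurable[OF g]
  show "(\<lambda>r. W r * g (z + r)) \<in> borel_measurable lborel" by measurable
  show "integrable lborel (\<lambda>r. W (K + \<bar>z\<bar>) * L * indicator {- (K + \<bar>z\<bar>)..K + \<bar>z\<bar>} r)"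
    by (intro integrable_mult_right integrable_real_indicator) (auto simp: emeasure_lborel_Icc_eq)
  show "AE r in lborel. norm (W r * g (z + r)) \<le>
      norm (W (K + \<bar>z\<bar>) * L * indicator {- (K + \<bar>z\<bar>)..K + \<bar>z\<bar>} r)"
  proof (rule AE_I2)
    fix r
    show "norm (W r * g (z + r)) \<le> norm (W (K + \<bar>z\<bar>) * L * indicator {- (K + \<bar>z\<bar>)..K + \<bar>z\<bar>} r)"
    proof (cases "\<bar>z + r\<bar> \<le> K")
      case True
      then have "- (K + \<bar>z\<bar>) \<le> r" "r \<le> K + \<bar>z\<bar>" by linarith+
      then show ?thesis
        using bumpD(1,2,5)[OF g] W_le[of r "K + \<bar>z\<bar>"] by (auto simp: abs_mult intro!: mult_mono)
    qed (use bumpD(4)[OF g, of "z + r"] in simp)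
  qed
qed

lemma potential_measurable: "bump L K g \<Longrightarrow> potential g \<in> borel_measurable borel"
  using bump_measurable[of L K g, measurable] unfolding potential_def[abs_def] by measurable

lemma integrable_strip:
  fixes f :: "real \<times> 'a \<Rightarrow> real"
  assumes [measurable]: "f \<in> borel_measurable (borel \<Otimes>\<^sub>M M)" and B: "\<And>p. \<bar>f p\<bar> \<le> B"
  shows "integrable (lborel \<Otimes>\<^sub>M M) (\<lambda>p. indicator {0..h} (fst p) * f p)"
proof (rule Bochner_Integration.integrable_bound)
  show "integrable (lborel \<Otimes>\<^sub>M M) (\<lambda>p. B * indicator ({0..h} \<times> space M) p)"
    by (intro integrable_mult_right integrable_real_indicator)
       (auto simp: emeasure_pair_measure_Times emeasure_space_1 emeasure_lborel_Icc_eq)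
  show "AE p in lborel \<Otimes>\<^sub>M M. norm (indicator {0..h} (fst p) * f p) \<le> norm (B * indicator ({0..h} \<times> space M) p)"
    using order_trans[OF B abs_ge_self]
    by (intro AE_I2) (auto simp: space_pair_measure indicator_def)
qed measurable

lemma integral_strip:
  fixes h :: real
  assumes "0 \<le> h"
  shows "(\<integral>p. indicator {0..h} (fst p) \<partial>(lborel \<Otimes>\<^sub>M M)) = h"
proof -
  have "(\<integral>s. (\<integral>\<omega>. indicat_real {0..h} s * 1 \<partial>M) \<partial>lborel) =
      (\<integral>p. indicat_real {0..h} (fst p) * 1 \<partial>(lborel \<Otimes>\<^sub>M M))"
    by (rule P.integral_fst'[OF integrable_strip[of "\<lambda>_. 1" 1 h], unfolded fst_conv]) auto
  then show ?thesis using assms by (simp add: prob_space)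
qed

lemma truncation_measurable: "(\<lambda>p. min 1 \<bar>Y p\<bar>) \<in> borel_measurable (borel \<Otimes>\<^sub>M M)"
  by (rule borel_measurable_min[OF borel_measurable_abs[OF Y_measurable] borel_measurable_const])

lemma occupation_integrable:
  "bump L K g \<Longrightarrow> integrable (lborel \<Otimes>\<^sub>M M) (\<lambda>p. indicator {0..h} (fst p) * g (z + Y p))"
  using bump_measurable[of L K g, measurable] bumpD[of L K g] by (intro integrable_strip[where B = L]) auto

lemma potential_nonneg: "bump L K g \<Longrightarrow> 0 \<le> potential g z"
  unfolding potential_def using bumpD(1) by (intro integral_nonneg_AE AE_I2) auto

lemma occupation_nonneg: "bump L K g \<Longrightarrow> 0 \<le> occupation g h z"
  unfolding occupation_def using bumpD(1) by (intro integral_nonneg_AE AE_I2) auto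

text \<open>The one-step form of the fact that \<open>potential g\<close> along the path, minus the occupation integral of \<open>g\<close>,
  is a martingale.\<close>

lemma expectation_potential:
  assumes g: "bump L K g" and h: "0 \<le> h"
  shows "has_bochner_integral M (\<lambda>\<omega>. potential g (z + X h \<omega>)) (potential g z + occupation g h z)"
proof (rule has_bochner_integral_nn_integral)
  note [measurable] = bump_measurable[OF g] X_measurable[OF h] potential_measurable[OF g]
  show "(\<lambda>\<omega>. potential g (z + X h \<omega>)) \<in> borel_measurable M" by measurable
  show "AE \<omega> in M. 0 \<le> potential g (z + X h \<omega>)" using potential_nonneg[OF g] by simp
  show "0 \<le> potential g z + occupation g h z" using potential_nonneg[OF g] occupation_nonneg[OF g] by simp
  have potential: "(\<integral>\<^sup>+r. ennreal (W r) * ennreal (g (z + (r + x))) \<partial>lborel) = ennreal (potential g (z + x))" for x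
    using potential_integrable[OF g, of "z + x"] bumpD(1)[OF g] unfolding potential_def
    by (subst nn_integral_eq_integral[symmetric]) (auto simp: ennreal_mult' ac_simps)
  have occupation: "(\<integral>\<^sup>+s. (\<integral>\<^sup>+\<omega>. indicator {0..h} s * ennreal (g (z + Y (s, \<omega>))) \<partial>M) \<partial>lborel) = ennreal (occupation g h z)"
    using occupation_integrable[OF g, of h z] bumpD(1)[OF g] unfolding occupation_def
    by (subst nn_integral_eq_integral[symmetric])
       (auto simp: ennreal_mult' ennreal_indicator nn_integral_fst[symmetric])
  have "(\<integral>\<^sup>+\<omega>. ennreal (potential g (z + X h \<omega>)) \<partial>M) = ennreal (potential g (z + 0)) + ennreal (occupation g h z)"
    unfolding potential[symmetric] occupation[symmetric]
    using potential_identity[OF h, of "\<lambda>v. ennreal (g (z + v))"] by (simp add: add.assoc)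
  then show "(\<integral>\<^sup>+\<omega>. ennreal (potential g (z + X h \<omega>)) \<partial>M) = ennreal (potential g z + occupation g h z)"
    using potential_nonneg[OF g] occupation_nonneg[OF g] by simp
qed

lemma occupation_approx:
  assumes g: "bump L K g" and h: "0 \<le> h"
  shows "\<bar>occupation g h z - h * g z\<bar> \<le> L * small_displacement h"
proof -
  note [measurable] = bump_measurable[OF g]
  let ?N = "lborel \<Otimes>\<^sub>M M"
  have i1: "integrable ?N (\<lambda>p. indicator {0..h} (fst p) * g z)"
    by (rule integrable_strip[where B = "\<bar>g z\<bar>"]) auto
  have i2: "integrable ?N (\<lambda>p. indicator {0..h} (fst p) * min 1 \<bar>Y p\<bar>)"
    by (rule integrable_strip[OF truncation_measurable abs_min_one_le])
  have "(\<integral>p. indicator {0..h} (fst p) * g z \<partial>?N) = h * g z"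
    using integral_strip[OF h] by (subst integral_mult_left_zero) simp
  then have "occupation g h z - h * g z = occupation g h z - (\<integral>p. indicator {0..h} (fst p) * g z \<partial>?N)"
    by (simp only:)
  also have "\<dots> = (\<integral>p. indicator {0..h} (fst p) * g (z + Y p) - indicator {0..h} (fst p) * g z \<partial>?N)"
    unfolding occupation_def by (rule Bochner_Integration.integral_diff[OF occupation_integrable[OF g] i1, symmetric])
  finally have "\<bar>occupation g h z - h * g z\<bar> =
      \<bar>\<integral>p. indicator {0..h} (fst p) * g (z + Y p) - indicator {0..h} (fst p) * g z \<partial>?N\<bar>"
    by (rule arg_cong)
  also have "\<dots> \<le> (\<integral>p. \<bar>indicator {0..h} (fst p) * g (z + Y p) - indicator {0..h} (fst p) * g z\<bar> \<partial>?N)"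
    by (rule integral_abs_bound)
  also have "\<dots> \<le> (\<integral>p. L * (indicator {0..h} (fst p) * min 1 \<bar>Y p\<bar>) \<partial>?N)"
  proof (rule integral_mono)
    show "integrable ?N (\<lambda>p. \<bar>indicator {0..h} (fst p) * g (z + Y p) - indicator {0..h} (fst p) * g z\<bar>)"
      by (intro integrable_abs Bochner_Integration.integrable_diff occupation_integrable[OF g] i1)
    show "integrable ?N (\<lambda>p. L * (indicator {0..h} (fst p) * min 1 \<bar>Y p\<bar>))"
      by (intro integrable_mult_right i2)
    show "\<bar>indicator {0..h} (fst p) * g (z + Y p) - indicator {0..h} (fst p) * g z\<bar>
        \<le> L * (indicator {0..h} (fst p) * min 1 \<bar>Y p\<bar>)" for p
      using bump_increment[OF g, of z "Y p"] by (simp add: indicator_def)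
  qed
  also have "\<dots> = L * small_displacement h" by (simp add: small_displacement_def)
  finally show ?thesis .
qed

lemma small_displacement_le:
  assumes e: "0 < e"
  shows "\<exists>h0>0. \<forall>h. 0 < h \<and> h \<le> h0 \<longrightarrow> small_displacement h \<le> e * h"
proof -
  define m where "m s = (\<integral>\<omega>. min 1 \<bar>Y (s, \<omega>)\<bar> \<partial>M)" for s
  have "(m \<longlongrightarrow> 0) (at_right 0)"
    unfolding tendsto_at_iff_sequentially comp_def
  proof safe
    fix s :: "nat \<Rightarrow> real" assume s: "\<forall>i. s i \<in> {0<..} - {0}" "s \<longlonglongrightarrow> 0"
    then have pos: "0 < s i" for i by auto
    have "s i \<noteq> 0" for i using pos[of i] by simp
    with pos have "eventually (\<lambda>i. s i \<in> {0<..} \<and> s i \<noteq> 0) sequentially"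
      by (simp add: always_eventually)
    with s(2) have fl: "filterlim s (at_right 0) sequentially" by (simp only: filterlim_at)
    have "(\<lambda>i. \<integral>\<omega>. min 1 \<bar>Y (s i, \<omega>)\<bar> \<partial>M) \<longlonglongrightarrow> (\<integral>\<omega>. 0 \<partial>M)"
    proof (rule integral_dominated_convergence[where w = "\<lambda>_. 1"])
      show "AE \<omega> in M. (\<lambda>i. min 1 \<bar>Y (s i, \<omega>)\<bar>) \<longlonglongrightarrow> 0"
        using X_0 X_right_continuous Y_eq
      proof eventually_elim
        case (elim \<omega>)
        then have "(\<lambda>i. X (s i) \<omega>) \<longlonglongrightarrow> 0"
          using filterlim_compose[OF _ fl, of "\<lambda>t. X t \<omega>" "nhds 0"] by fastforce
        then have "(\<lambda>i. min 1 \<bar>X (s i) \<omega>\<bar>) \<longlonglongrightarrow> min 1 \<bar>0\<bar>" by (intro tendsto_intros)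
        moreover have "Y (s i, \<omega>) = X (s i) \<omega>" for i
          using elim(3) pos[of i] by simp
        ultimately show ?case by simp
      qed
      show "(\<lambda>\<omega>. min 1 \<bar>Y (s i, \<omega>)\<bar>) \<in> borel_measurable M" for i
        by (rule measurable_compose[OF measurable_Pair1' truncation_measurable]) simp
      show "AE \<omega> in M. norm (min 1 \<bar>Y (s i, \<omega>)\<bar>) \<le> 1" for i
        unfolding real_norm_def by (intro AE_I2 abs_min_one_le)
    qed simp_all
    then show "(\<lambda>i. m (s i)) \<longlonglongrightarrow> 0" by (simp add: m_def)
  qed
  then have "\<forall>\<^sub>F s in at_right 0. m s < e" using e by (rule order_tendstoD)
  then obtain b where b: "0 < b" "\<And>s. 0 < s \<Longrightarrow> s < b \<Longrightarrow> m s < e"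
    by (auto simp: eventually_at_right_field)
  have m0: "m 0 = 0"
    unfolding m_def
  proof (rule integral_eq_zero_AE)
    show "AE \<omega> in M. min 1 \<bar>Y (0, \<omega>)\<bar> = 0"
      using X_0 Y_eq by eventually_elim simp
  qed
  have "small_displacement h \<le> e * h" if h: "0 < h" "h \<le> b / 2" for h
  proof -
    have int: "integrable (lborel \<Otimes>\<^sub>M M) (\<lambda>p. indicator {0..h} (fst p) * min 1 \<bar>Y p\<bar>)"
      by (rule integrable_strip[OF truncation_measurable abs_min_one_le])
    have "small_displacement h = (\<integral>s. (\<integral>\<omega>. indicator {0..h} s * min 1 \<bar>Y (s, \<omega>)\<bar> \<partial>M) \<partial>lborel)"
      unfolding small_displacement_def using P.integral_fst'[OF int] by simp
    also have "\<dots> \<le> (\<integral>s. e * indicator {0..h} s \<partial>lborel)"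
    proof (rule integral_mono)
      show "integrable lborel (\<lambda>s. \<integral>\<omega>. indicator {0..h} s * min 1 \<bar>Y (s, \<omega>)\<bar> \<partial>M)"
        using P.integrable_fst'[OF int] by simp
      show "(\<integral>\<omega>. indicator {0..h} s * min 1 \<bar>Y (s, \<omega>)\<bar> \<partial>M) \<le> e * indicator {0..h} s" for s
      proof (cases "s \<in> {0..h}")
        case True
        then have "m s \<le> e" using b(2)[of s] b(1) h m0 e by (cases "s = 0") simp_all
        with True show ?thesis by (simp add: m_def)
      qed simp
      show "integrable lborel (\<lambda>s. e * indicator {0..h} s)"
        by (intro integrable_mult_right integrable_real_indicator) (simp_all add: emeasure_lborel_Icc_eq)
    qed
    also have "\<dots> = e * h" using h by simp
    finally show ?thesis .
  qed
  then show ?thesis using b(1) by (intro exI[of _ "b / 2"]) auto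
qed

end

section \<open>The exponential maximal inequality for occupation integrals\<close>

context stable_levy
begin

lemma occupation_measurable:
  assumes g: "bump L K g"
  shows "occupation g h \<in> borel_measurable borel"
proof -
  note [measurable] = bump_measurable[OF g]
  have "(\<lambda>(z, p). indicator {0..h} (fst p) * g (z + Y p)) \<in> borel_measurable (borel \<Otimes>\<^sub>M (lborel \<Otimes>\<^sub>M M))"
    by measurable
  then show ?thesis
    unfolding occupation_def[abs_def] by (rule P.borel_measurable_lebesgue_integral)
qed

text \<open>Sampled on a grid of mesh \<open>h\<close>, the path is a random walk. The walk inequality applies with
  \<open>u = 1 - \<theta> * (potential g1 - potential g2)\<close>, for which one step multiplies \<open>u\<close> in the mean by
  \<open>(u - \<theta> * G) / u\<close>, where \<open>G\<close> is the expected occupation difference during a step.\<close>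

lemma discrete_maximal_inequality:
  assumes g1: "bump L K g1" and g2: "bump L K g2"
    and D: "\<And>z. \<bar>potential g1 z - potential g2 z\<bar> \<le> D"
    and \<theta>: "0 < \<theta>" "\<theta> * D \<le> 1 / 2" and h: "0 \<le> h"
  defines "a \<equiv> \<lambda>z. \<theta> * (occupation g1 h z - occupation g2 h z) - 2 * \<theta>\<^sup>2 * D * \<bar>occupation g1 h z - occupation g2 h z\<bar>"
  shows "emeasure M {\<omega>\<in>space M. \<exists>k\<le>n. c \<le> (\<Sum>j<k. a (X (real j * h) \<omega> - X 0 \<omega>))} \<le> ennreal (3 * exp (- c))"
proof -
  note [measurable] = potential_measurable[OF g1] potential_measurable[OF g2] occupation_measurable[OF g1] occupation_measurable[OF g2]
    X_measurable[OF h]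
  define \<xi> where "\<xi> i \<omega> = X (real (Suc i) * h) \<omega> - X (real i * h) \<omega>" for i \<omega>
  define u where "u z = 1 - \<theta> * (potential g1 z - potential g2 z)" for z
  have sum: "(\<Sum>i<j. \<xi> i \<omega>) = X (real j * h) \<omega> - X 0 \<omega>" for j \<omega>
    by (induction j) (simp_all add: \<xi>_def)
  have "emeasure M {\<omega>\<in>space M. \<exists>k\<le>n. c \<le> (\<Sum>j<k. a (\<Sum>i<j. \<xi> i \<omega>))} \<le> ennreal (3 * exp (- c))"
  proof (rule random_walk_maximal_inequality[where \<mu> = "distr M borel (X h)" and u = u])
    show "indep_vars (\<lambda>_. borel) \<xi> {..<n}"
      using X_indep[of "\<lambda>i. real i * h" n] h by (simp add: \<xi>_def[abs_def] mono_def mult_right_mono)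
    show "distr M borel (\<xi> i) = distr M borel (X h)" for i
      using X_stationary[of "real i * h" h] h by (simp add: \<xi>_def[abs_def] algebra_simps)
    show "u \<in> borel_measurable borel" "a \<in> borel_measurable borel"
      unfolding u_def[abs_def] a_def by measurable
    have "\<bar>\<theta> * (potential g1 z - potential g2 z)\<bar> \<le> 1 / 2" for z
    proof -
      have "\<bar>\<theta> * (potential g1 z - potential g2 z)\<bar> = \<theta> * \<bar>potential g1 z - potential g2 z\<bar>" using \<theta> by (simp add: abs_mult)
      also have "\<dots> \<le> \<theta> * D" using D[of z] \<theta> by (intro mult_left_mono) auto
      finally show ?thesis using \<theta> by linarith
    qed
    from this[unfolded abs_le_iff] show u: "1 / 2 \<le> u z" "u z \<le> 3 / 2" for z
      unfolding u_def by (smt (verit) field_sum_of_halves)+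
    show "ennreal (exp (a z)) * (\<integral>\<^sup>+x. ennreal (u (z + x)) \<partial>distr M borel (X h)) \<le> ennreal (u z)" for z
    proof -
      let ?G = "occupation g1 h z - occupation g2 h z"
      have "has_bochner_integral M (\<lambda>\<omega>. u (z + X h \<omega>))
          (1 - \<theta> * ((potential g1 z + occupation g1 h z) - (potential g2 z + occupation g2 h z)))"
        unfolding u_def
        by (intro has_bochner_integral_diff has_bochner_integral_mult_right expectation_potential[OF g1 h]
              expectation_potential[OF g2 h]) (simp add: has_bochner_integral_iff prob_space)
      also have "1 - \<theta> * ((potential g1 z + occupation g1 h z) - (potential g2 z + occupation g2 h z)) = u z - \<theta> * ?G"
        by (simp add: u_def algebra_simps)
      finally have hb: "has_bochner_integral M (\<lambda>\<omega>. u (z + X h \<omega>)) (u z - \<theta> * ?G)" .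
      have nn: "0 \<le> u y" for y using u(1)[of y] by simp
      have "(\<integral>\<^sup>+x. ennreal (u (z + x)) \<partial>distr M borel (X h)) = (\<integral>\<^sup>+\<omega>. ennreal (u (z + X h \<omega>)) \<partial>M)"
        unfolding u_def by (subst nn_integral_distr) simp_all
      also have "\<dots> = ennreal (u z - \<theta> * ?G)"
        using hb nn by (subst nn_integral_eq_integral) (auto simp: has_bochner_integral_iff)
      finally have "ennreal (exp (a z)) * (\<integral>\<^sup>+x. ennreal (u (z + x)) \<partial>distr M borel (X h)) =
          ennreal (exp (a z) * (u z - \<theta> * ?G))"
        by (simp add: ennreal_mult')
      also have "\<dots> \<le> ennreal (u z)"
        unfolding a_def u_def by (intro ennreal_leI exp_tilt_le \<theta> D)
      finally show ?thesis .
    qed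
  qed
  then show ?thesis by (simp add: sum)
qed

lemma occupation_tilt_ge:
  assumes g1: "bump L K g1" and g2: "bump L K g2" and \<theta>: "0 \<le> \<theta>" and \<kappa>: "0 \<le> \<kappa>" and h: "0 \<le> h"
  shows "h * (\<theta> * (g1 z - g2 z) - \<kappa> * (g1 z + g2 z)) - (\<theta> + \<kappa>) * (2 * L) * small_displacement h \<le>
    \<theta> * (occupation g1 h z - occupation g2 h z) - \<kappa> * \<bar>occupation g1 h z - occupation g2 h z\<bar>"
proof -
  define e where "e = L * small_displacement h"
  have o: "\<bar>occupation g1 h z - h * g1 z\<bar> \<le> e" "\<bar>occupation g2 h z - h * g2 z\<bar> \<le> e" "0 \<le> occupation g1 h z" "0 \<le> occupation g2 h z"
    using occupation_approx[OF g1 h] occupation_approx[OF g2 h] occupation_nonneg[OF g1] occupation_nonneg[OF g2] by (auto simp: e_def)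
  have "h * g1 z - h * g2 z - 2 * e \<le> occupation g1 h z - occupation g2 h z" using o by linarith
  then have 1: "\<theta> * (h * g1 z - h * g2 z - 2 * e) \<le> \<theta> * (occupation g1 h z - occupation g2 h z)"
    using \<theta> by (rule mult_left_mono)
  have "\<bar>occupation g1 h z - occupation g2 h z\<bar> \<le> h * g1 z + h * g2 z + 2 * e" using o by linarith
  then have 2: "\<kappa> * \<bar>occupation g1 h z - occupation g2 h z\<bar> \<le> \<kappa> * (h * g1 z + h * g2 z + 2 * e)"
    using \<kappa> by (rule mult_left_mono)
  have "h * (\<theta> * (g1 z - g2 z) - \<kappa> * (g1 z + g2 z)) - (\<theta> + \<kappa>) * (2 * L) * small_displacement h =
      \<theta> * (h * g1 z - h * g2 z - 2 * e) - \<kappa> * (h * g1 z + h * g2 z + 2 * e)"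
    by (simp add: e_def algebra_simps)
  with 1 2 show ?thesis by linarith
qed

text \<open>As the mesh tends to 0, the grid sums converge to time integrals along the path: replacing
  \<open>occupation g h\<close> by \<open>h * g\<close> costs \<open>o(h)\<close> per step, and what remains is a Riemann sum.\<close>

lemma occupation_maximal_inequality:
  fixes N m :: nat and c :: real
  assumes g1: "bump L K g1" and g2: "bump L K g2"
    and D: "\<And>z. \<bar>potential g1 z - potential g2 z\<bar> \<le> D"
    and \<theta>: "0 < \<theta>" "\<theta> * D \<le> 1 / 2"
  defines "q \<equiv> \<lambda>z. \<theta> * (g1 z - g2 z) - 2 * \<theta>\<^sup>2 * D * (g1 z + g2 z)"
  defines "B \<equiv> {\<omega>\<in>space M. \<exists>k\<le>N. c < (\<integral>s. indicator {0<..real k / 2 ^ m} s * q (Y (s, \<omega>)) \<partial>lborel)}"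
  shows "B \<in> sets M" "emeasure M B \<le> ennreal (3 * exp (- c))"
proof -
  note [measurable] = bump_measurable[OF g1] bump_measurable[OF g2] occupation_measurable[OF g1] occupation_measurable[OF g2]
  have [measurable]: "q \<in> borel_measurable borel" unfolding q_def by measurable
  have "(\<lambda>(\<omega>, s). indicator {0<..real k / 2 ^ m} s * q (Y (s, \<omega>))) \<in> borel_measurable (M \<Otimes>\<^sub>M lborel)" for k
    by measurable
  from lborel.borel_measurable_lebesgue_integral[OF this]
  have [measurable]: "(\<lambda>\<omega>. \<integral>s. indicator {0<..real k / 2 ^ m} s * q (Y (s, \<omega>)) \<partial>lborel) \<in> borel_measurable M" for k .
  show B: "B \<in> sets M" unfolding B_def by measurable
  define \<kappa> where "\<kappa> = 2 * \<theta>\<^sup>2 * D"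
  have "0 \<le> D" using D[of 0] by linarith
  then have \<kappa>: "0 \<le> \<kappa>" by (simp add: \<kappa>_def)
  define h where "h i = 1 / (2 :: real) ^ (m + i)" for i
  have h: "0 < h i" for i by (simp add: h_def)
  define a where "a i z = \<theta> * (occupation g1 (h i) z - occupation g2 (h i) z) - \<kappa> * \<bar>occupation g1 (h i) z - occupation g2 (h i) z\<bar>" for i z
  define A where "A i = {\<omega>\<in>space M. \<exists>k\<le>N * 2 ^ i. c \<le> (\<Sum>j<k. a i (X (real j * h i) \<omega> - X 0 \<omega>))}" for i
  show "emeasure M B \<le> ennreal (3 * exp (- c))"
  proof (rule emeasure_le_of_eventually[of A])
    show "A i \<in> sets M" for i
    proof -
      have [measurable]: "a i \<in> borel_measurable borel" unfolding a_def[abs_def] by measurable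
      have [measurable]: "X (real j * h i) \<in> borel_measurable M" for j
        using h[of i] by (intro X_measurable) simp
      have [measurable]: "X 0 \<in> borel_measurable M" by (rule X_measurable) simp
      show ?thesis unfolding A_def by measurable
    qed
    show "B \<in> sets M" by (rule B)
    show "emeasure M (A i) \<le> ennreal (3 * exp (- c))" for i
      using discrete_maximal_inequality[OF g1 g2 D \<theta>, of "h i" "N * 2 ^ i" c] h[of i]
      by (simp add: A_def a_def \<kappa>_def)
    show "AE \<omega> in M. \<omega> \<in> B \<longrightarrow> eventually (\<lambda>i. \<omega> \<in> A i) sequentially"
      using X_0 X_right_continuous Y_eq AE_space
    proof eventually_elim
      case (elim \<omega>)
      show ?case
      proof
        assume "\<omega> \<in> B"
        then obtain k where k: "k \<le> N" and ck: "c < (\<integral>s. indicator {0<..real k / 2 ^ m} s * q (Y (s, \<omega>)) \<partial>lborel)"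
          by (auto simp: B_def)
        define I where "I = (\<integral>s. indicator {0<..real k / 2 ^ m} s * q (Y (s, \<omega>)) \<partial>lborel)"
        define x where "x t = X t \<omega>" for t
        define R where "R i = (\<Sum>j<k * 2 ^ i. h i * q (x (real j * h i)))" for i
        have qc: "continuous_on UNIV q"
          unfolding q_def by (intro continuous_intros bump_continuous[OF g1] bump_continuous[OF g2])
        have "(\<lambda>i. \<Sum>j<k * 2 ^ i. 1 / 2 ^ (m + i) * q (x (real j / 2 ^ (m + i)))) \<longlonglongrightarrow> I"
          unfolding I_def
        proof (rule riemann_sum_tendsto)
          show "((\<lambda>t. q (x t)) \<longlongrightarrow> q (x t)) (at_right t)" if "0 \<le> t" for t
            using qc elim(2) that unfolding x_def
            by (auto intro!: isCont_tendsto_compose[of _ q] simp: continuous_on_eq_continuous_at)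
          show "\<bar>q (x t)\<bar> \<le> \<theta> * (L + L) + \<kappa> * (L + L)" for t
          proof -
            have "\<bar>g1 (x t) - g2 (x t)\<bar> \<le> L + L" "\<bar>g1 (x t) + g2 (x t)\<bar> \<le> L + L"
              using bumpD(1,2)[OF g1, of "x t"] bumpD(1,2)[OF g2, of "x t"] by linarith+
            then have "\<bar>\<theta> * (g1 (x t) - g2 (x t))\<bar> \<le> \<theta> * (L + L)" "\<bar>\<kappa> * (g1 (x t) + g2 (x t))\<bar> \<le> \<kappa> * (L + L)"
              using \<theta> \<kappa> by (auto simp: abs_mult intro!: mult_left_mono)
            then show ?thesis unfolding q_def \<kappa>_def[symmetric] by linarith
          qed
          show "(\<lambda>s. q (Y (s, \<omega>))) \<in> borel_measurable borel"
            using elim(4) by measurable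
          show "q (Y (t, \<omega>)) = q (x t)" if "0 \<le> t" for t using elim(3) that by (simp add: x_def)
        qed
        then have "R \<longlonglongrightarrow> I" by (simp add: R_def[abs_def] h_def)
        moreover have "(c + I) / 2 < I" using ck unfolding I_def[symmetric] by (simp add: field_simps)
        ultimately have R: "\<forall>\<^sub>F i in sequentially. (c + I) / 2 < R i"
          by (rule order_tendstoD)
        define C where "C = (\<theta> + \<kappa>) * (2 * L) * real k / 2 ^ m + 1"
        have "0 \<le> L" using bumpD(5)[OF g1] .
        then have C: "0 < C" using \<theta> \<kappa> unfolding C_def by (intro add_nonneg_pos) auto
        have e: "0 < (I - c) / 2 / C" using C ck by (simp add: I_def)
        from small_displacement_le[OF e] obtain h0 where h0: "0 < h0"
          "\<And>h. 0 < h \<Longrightarrow> h \<le> h0 \<Longrightarrow> small_displacement h \<le> (I - c) / 2 / C * h" by blast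
        have "h \<longlonglongrightarrow> 0"
        proof -
          have "(\<lambda>i. (1 / 2) ^ m * (1 / 2 :: real) ^ i) \<longlonglongrightarrow> (1 / 2) ^ m * 0"
            by (intro tendsto_intros LIMSEQ_power_zero) simp
          then show ?thesis by (simp add: h_def[abs_def] power_add power_divide)
        qed
        then have "\<forall>\<^sub>F i in sequentially. h i < h0"
          using h0(1) by (rule order_tendstoD)
        with R show "\<forall>\<^sub>F i in sequentially. \<omega> \<in> A i"
        proof eventually_elim
          case (elim i)
          let ?sd = "small_displacement (h i)"
          have C1: "(\<theta> + \<kappa>) * (2 * L) * (real k / 2 ^ m) = C - 1" by (simp add: C_def)
          have hk: "real (k * 2 ^ i) * h i = real k / 2 ^ m" by (simp add: h_def power_add)
          have sd: "(\<theta> + \<kappa>) * (2 * L) * (real (k * 2 ^ i) * ?sd) \<le>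
              (\<theta> + \<kappa>) * (2 * L) * (real (k * 2 ^ i) * ((I - c) / 2 / C * h i))"
            using h0(2)[of "h i"] h[of i] elim \<theta> \<kappa> \<open>0 \<le> L\<close>
            by (intro mult_left_mono) auto
          have sd': "(\<theta> + \<kappa>) * (2 * L) * (real (k * 2 ^ i) * ?sd) \<le> (C - 1) * ((I - c) / 2 / C)"
          proof -
            have "(\<theta> + \<kappa>) * (2 * L) * (real (k * 2 ^ i) * ((I - c) / 2 / C * h i)) =
              (\<theta> + \<kappa>) * (2 * L) * ((I - c) / 2 / C) * (real (k * 2 ^ i) * h i)" by (simp only: mult_ac)
            also have "\<dots> = (C - 1) * ((I - c) / 2 / C)" 
              unfolding hk C1[symmetric] by (simp only: mult_ac)
            finally show ?thesis using sd by (simp only:)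
          qed
          have "c = (c + I) / 2 - (I - c) / 2" by (simp add: field_simps)
          also have "(c + I) / 2 - (I - c) / 2 \<le> R i - (I - c) / 2" using elim by simp
          also have "R i - (I - c) / 2 \<le> R i - (\<theta> + \<kappa>) * (2 * L) * (real (k * 2 ^ i) * ?sd)"
          proof -
            have "(C - 1) * ((I - c) / 2 / C) \<le> C * ((I - c) / 2 / C)"
              using e by (intro mult_right_mono) auto
            also have "\<dots> = (I - c) / 2" using C by simp
            finally show ?thesis using sd' by linarith
          qed
          also have "R i - (\<theta> + \<kappa>) * (2 * L) * (real (k * 2 ^ i) * ?sd) =
              (\<Sum>j<k * 2 ^ i. h i * q (x (real j * h i)) - (\<theta> + \<kappa>) * (2 * L) * ?sd)"
            unfolding R_def sum_subtractf by simp
          also have "\<dots> \<le> (\<Sum>j<k * 2 ^ i. a i (x (real j * h i)))"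
            unfolding a_def q_def \<kappa>_def[symmetric] using \<theta> \<kappa> h[of i]
            by (intro sum_mono occupation_tilt_ge[OF g1 g2]) auto
          finally have "c \<le> (\<Sum>j<k * 2 ^ i. a i (X (real j * h i) \<omega> - X 0 \<omega>))"
            using \<open>X 0 \<omega> = 0\<close> by (simp add: x_def)
          moreover have "k * 2 ^ i \<le> N * 2 ^ i" using k by simp
          ultimately show ?case using \<open>\<omega> \<in> space M\<close> unfolding A_def by blast
        qed
      qed
    qed
  qed
qed
end

section \<open>The exponential maximal inequality for local times\<close>

text \<open>Tents of integral 1 whose width shrinks with \<open>1 / n\<close>; they turn occupation integrals into averages of
  local times over small intervals.\<close>

definition tent :: "real \<Rightarrow> real \<Rightarrow> real" where
  "tent n v = n * max 0 (1 - n * \<bar>v\<bar>)"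

lemma tent_nonneg: "0 \<le> n \<Longrightarrow> 0 \<le> tent n v"
  by (simp add: tent_def)

lemma tent_eq_0: "0 < n \<Longrightarrow> 1 / n < \<bar>v\<bar> \<Longrightarrow> tent n v = 0"
  by (simp add: tent_def field_simps)

lemma tent_continuous: "continuous_on A (tent n)"
  unfolding tent_def[abs_def] by (intro continuous_intros)

lemma tent_measurable[measurable]: "tent n \<in> borel_measurable borel"
  using tent_continuous borel_measurable_continuous_onI by blast

lemma bump_tent:
  assumes n: "0 < n" and K: "\<bar>y\<bar> + 1 / n \<le> K"
  shows "bump (n + n * n) K (\<lambda>v. tent n (v - y))"
  unfolding bump_def
proof (intro conjI allI impI)
  fix v w
  show "0 \<le> tent n (v - y)" using n by (simp add: tent_nonneg)
  have "tent n (v - y) \<le> n * 1"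
    unfolding tent_def using n by (intro mult_left_mono) auto
  then show "tent n (v - y) \<le> n + n * n" using n by (simp add: add_increasing2)
  have "\<bar>max 0 (1 - n * \<bar>v - y\<bar>) - max 0 (1 - n * \<bar>w - y\<bar>)\<bar> \<le> \<bar>n * \<bar>w - y\<bar> - n * \<bar>v - y\<bar>\<bar>"
    by (simp add: max_def)
  also have "\<dots> = n * \<bar>\<bar>w - y\<bar> - \<bar>v - y\<bar>\<bar>"
    using n by (simp add: right_diff_distrib[symmetric] abs_mult)
  also have "\<dots> \<le> n * \<bar>v - w\<bar>" using n by (intro mult_left_mono) auto
  finally have "\<bar>tent n (v - y) - tent n (w - y)\<bar> \<le> n * (n * \<bar>v - w\<bar>)"
    unfolding tent_def right_diff_distrib[symmetric] abs_mult using n by (simp add: mult_left_mono)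
  also have "\<dots> \<le> (n + n * n) * \<bar>v - w\<bar>" using n by (simp add: distrib_right)
  finally show "\<bar>tent n (v - y) - tent n (w - y)\<bar> \<le> (n + n * n) * \<bar>v - w\<bar>" .
next
  fix v assume "K < \<bar>v\<bar>"
  then show "tent n (v - y) = 0" using n K by (intro tent_eq_0) linarith+
qed

lemma has_bochner_integral_tent:
  assumes n: "0 < n"
  shows "has_bochner_integral lborel (\<lambda>v. tent n (v - y)) 1"
proof -
  have "has_bochner_integral lborel (\<lambda>v. (1 + v) * indicator {-1..0} v) ((0 + 0\<^sup>2 / 2) - (-1 + (-1)\<^sup>2 / 2) :: real)"
    by (rule has_bochner_integral_FTC_Icc_nonneg[where F = "\<lambda>v. v + v\<^sup>2 / 2"])
       (auto intro!: derivative_eq_intros continuous_intros)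
  moreover have "has_bochner_integral lborel (\<lambda>v. (1 - v) * indicator {0..1} v) ((1 - 1\<^sup>2 / 2) - (0 - 0\<^sup>2 / 2) :: real)"
    by (rule has_bochner_integral_FTC_Icc_nonneg[where F = "\<lambda>v. v - v\<^sup>2 / 2"])
       (auto intro!: derivative_eq_intros continuous_intros)
  ultimately have "has_bochner_integral lborel
      (\<lambda>v. (1 + v) * indicator {-1..0} v + (1 - v) * indicator {0..1} v) (1 :: real)"
    using has_bochner_integral_add by fastforce
  moreover have "AE v in lborel. (1 + v) * indicator {-1..0} v + (1 - v) * indicator {0..1} v = tent 1 v"
    using AE_lborel_singleton[of 0] by eventually_elim (auto simp: tent_def indicator_def)
  ultimately have "has_bochner_integral lborel (tent 1) 1"
    by (subst (asm) has_bochner_integral_cong_AE) auto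
  then have "has_bochner_integral lborel (\<lambda>v. tent 1 ((- (n * y)) + n * v)) (1 /\<^sub>R \<bar>n\<bar>)"
    using n by (subst (asm) lborel_has_bochner_integral_real_affine_iff[of n _ _ "- (n * y)"]) auto
  then have "has_bochner_integral lborel (\<lambda>v. n * tent 1 ((- (n * y)) + n * v)) (n * (1 /\<^sub>R \<bar>n\<bar>))"
    by (rule has_bochner_integral_mult_right)
  moreover have "n * tent 1 ((- (n * y)) + n * v) = tent n (v - y)" for v
  proof -
    have "(- (n * y)) + n * v = n * (v - y)" by (simp add: right_diff_distrib)
    then have "\<bar>(- (n * y)) + n * v\<bar> = n * \<bar>v - y\<bar>"
      using n by (simp add: abs_mult)
    then show ?thesis by (simp add: tent_def)
  qed
  ultimately show ?thesis using n by simp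
qed

lemma integral_tent_mult: "0 < n \<Longrightarrow> (\<integral>v. tent n (v - y) * c \<partial>lborel) = c"
  using has_bochner_integral_tent[of n y] by (simp add: has_bochner_integral_iff)

lemma integrable_tent_mult:
  assumes n: "0 < n" and \<phi>: "continuous_on UNIV \<phi>"
  shows "integrable lborel (\<lambda>v. tent n (v - y) * \<phi> v)"
proof -
  have "integrable lborel (\<lambda>v. indicator {y - 1 / n..y + 1 / n} v *\<^sub>R (tent n (v - y) * \<phi> v))"
    by (intro borel_integrable_compact continuous_intros continuous_on_subset[OF \<phi>]
        continuous_on_compose2[OF tent_continuous[of UNIV]]) auto
  also have "(\<lambda>v. indicator {y - 1 / n..y + 1 / n} v *\<^sub>R (tent n (v - y) * \<phi> v)) = (\<lambda>v. tent n (v - y) * \<phi> v)"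
  proof (rule ext)
    fix v
    show "indicator {y - 1 / n..y + 1 / n} v *\<^sub>R (tent n (v - y) * \<phi> v) = tent n (v - y) * \<phi> v"
    proof (cases "1 / n < \<bar>v - y\<bar>")
      case True
      then show ?thesis using tent_eq_0[OF n, of "v - y"] by simp
    next
      case False
      then have "v \<in> {y - 1 / n..y + 1 / n}" by (auto simp: abs_if split: if_splits)
      then show ?thesis by simp
    qed
  qed
  finally show ?thesis .
qed

lemma tent_average_tendsto:
  fixes \<phi> :: "real \<Rightarrow> real"
  assumes \<phi>: "continuous_on UNIV \<phi>"
  shows "(\<lambda>i. \<integral>v. tent (real (Suc i)) (v - y) * \<phi> v \<partial>lborel) \<longlonglongrightarrow> \<phi> y"
proof (rule LIMSEQ_I)
  fix r :: real assume r: "0 < r"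
  have "isCont \<phi> y" using \<phi> by (simp add: continuous_on_eq_continuous_at)
  then obtain d where d: "0 < d" "\<And>v. \<bar>v - y\<bar> < d \<Longrightarrow> \<bar>\<phi> v - \<phi> y\<bar> < r / 2"
    using r unfolding continuous_at_eps_delta dist_real_def by (metis half_gt_zero)
  obtain N where N: "inverse (real (Suc N)) < d" using reals_Archimedean[OF d(1)] by auto
  show "\<exists>N. \<forall>i\<ge>N. norm ((\<integral>v. tent (real (Suc i)) (v - y) * \<phi> v \<partial>lborel) - \<phi> y) < r"
  proof (intro exI allI impI)
    fix i assume i: "N \<le> i"
    define n where "n = real (Suc i)"
    have n: "0 < n" by (simp add: n_def)
    have "1 / n \<le> inverse (real (Suc N))" using i by (simp add: n_def field_simps)
    with N have nd: "1 / n < d" by simp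
    have i1: "integrable lborel (\<lambda>v. tent n (v - y) * \<phi> v)" by (rule integrable_tent_mult[OF n \<phi>])
    have i2: "integrable lborel (\<lambda>v. tent n (v - y) * \<phi> y)"
      by (rule integrable_tent_mult[OF n]) simp
    have i3: "integrable lborel (\<lambda>v. tent n (v - y) * (r / 2))"
      by (rule integrable_tent_mult[OF n]) simp
    note c = integral_tent_mult[OF n]
    have "(\<integral>v. tent n (v - y) * \<phi> v \<partial>lborel) - \<phi> y = (\<integral>v. tent n (v - y) * \<phi> v - tent n (v - y) * \<phi> y \<partial>lborel)"
      unfolding Bochner_Integration.integral_diff[OF i1 i2] c ..
    then have "\<bar>(\<integral>v. tent n (v - y) * \<phi> v \<partial>lborel) - \<phi> y\<bar> =
        \<bar>\<integral>v. tent n (v - y) * \<phi> v - tent n (v - y) * \<phi> y \<partial>lborel\<bar>" by (rule arg_cong)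
    also have "\<dots> \<le> (\<integral>v. \<bar>tent n (v - y) * \<phi> v - tent n (v - y) * \<phi> y\<bar> \<partial>lborel)"
      by (rule integral_abs_bound)
    also have "\<dots> \<le> (\<integral>v. tent n (v - y) * (r / 2) \<partial>lborel)"
    proof (rule integral_mono)
      show "integrable lborel (\<lambda>v. \<bar>tent n (v - y) * \<phi> v - tent n (v - y) * \<phi> y\<bar>)"
        by (intro integrable_abs Bochner_Integration.integrable_diff i1 i2)
      show "integrable lborel (\<lambda>v. tent n (v - y) * (r / 2))" by (rule i3)
      fix v
      show "\<bar>tent n (v - y) * \<phi> v - tent n (v - y) * \<phi> y\<bar> \<le> tent n (v - y) * (r / 2)"
      proof (cases "1 / n < \<bar>v - y\<bar>")
        case True
        then show ?thesis using tent_eq_0[OF n, of "v - y"] by simp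
      next
        case False
        then have "\<bar>\<phi> v - \<phi> y\<bar> \<le> r / 2" using d(2)[of v] nd by (intro less_imp_le) simp
        then show ?thesis using tent_nonneg[of n "v - y"] n
          unfolding right_diff_distrib[symmetric] abs_mult by (intro mult_mono) auto
      qed
    qed
    also have "\<dots> = r / 2" by (rule c)
    also have "\<dots> < r" using r by simp
    finally show "norm ((\<integral>v. tent (real (Suc i)) (v - y) * \<phi> v \<partial>lborel) - \<phi> y) < r" by (simp add: n_def)
  qed
qed

lemma powr_add_le:
  fixes s t a :: real
  assumes "0 \<le> s" "0 \<le> t" "0 < a" "a \<le> 1"
  shows "(s + t) powr a \<le> s powr a + t powr a"
proof (cases "s + t = 0")
  case False
  then have st: "0 < s + t" using assms by simp
  have "s / (s + t) \<le> (s / (s + t)) powr a" "t / (s + t) \<le> (t / (s + t)) powr a"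
    using assms st powr_mono'[of a 1 "s / (s + t)"] powr_mono'[of a 1 "t / (s + t)"] by auto
  then have "s / (s + t) + t / (s + t) \<le> (s powr a + t powr a) / (s + t) powr a"
    using assms st by (simp add: powr_divide add_divide_distrib)
  moreover have "s / (s + t) + t / (s + t) = 1" using st by (simp add: add_divide_distrib[symmetric])
  ultimately show ?thesis using st by (simp add: field_simps)
qed (use assms in simp)

text \<open>The Hoelder continuity of the scale function is the only source of regularity in space: through
  \<open>potential_tent_diff_le\<close> it bounds the potentials of differences of tents, uniformly in their width.\<close>

lemma scale_diff_le:
  assumes "0 < \<alpha>" "\<alpha> \<le> 1"
  shows "\<bar>scale \<alpha> r - scale \<alpha> s\<bar> \<le> \<bar>r - s\<bar> powr \<alpha> / Gamma (1 + \<alpha>)"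
proof -
  have *: "scale \<alpha> r - scale \<alpha> s \<le> \<bar>r - s\<bar> powr \<alpha> / Gamma (1 + \<alpha>)" for r s
  proof -
    have "max 0 r powr \<alpha> \<le> (max 0 s + \<bar>r - s\<bar>) powr \<alpha>"
      using assms by (intro powr_mono2) auto
    also have "\<dots> \<le> max 0 s powr \<alpha> + \<bar>r - s\<bar> powr \<alpha>"
      using assms by (intro powr_add_le) auto
    finally show ?thesis
      using assms by (simp add: scale_def diff_divide_distrib[symmetric] divide_right_mono less_imp_le[OF Gamma_real_pos])
  qed
  from *[of r s] *[of s r] show ?thesis by (simp add: abs_le_iff abs_minus_commute)
qed

context stable_levy
begin

lemma potential_tent_diff_le:
  assumes n: "0 < n"
  shows "\<bar>potential (\<lambda>v. tent n (v - y)) z - potential (\<lambda>v. tent n (v - x)) z\<bar> \<le> \<bar>y - x\<bar> powr \<alpha> / Gamma (1 + \<alpha>)"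
    (is "_ \<le> ?D")
proof -
  have shift: "potential (\<lambda>v. tent n (v - y)) z = (\<integral>v. tent n (v - 0) * W (v + (y - z)) \<partial>lborel)" for y
    unfolding potential_def by (subst lborel_integral_real_affine[of 1 _ "y - z"]) (simp_all add: algebra_simps)
  have W: "continuous_on UNIV (\<lambda>v. W (v + c))" for c
    unfolding scale_def using \<alpha> less_imp_neq[OF Gamma_real_pos[of "1 + \<alpha>"]]
    by (intro continuous_intros continuous_on_powr') auto
  note i = integrable_tent_mult[OF n W]
  have i3: "integrable lborel (\<lambda>v. tent n (v - 0) * ?D)"
    by (rule integrable_tent_mult[OF n]) simp
  have "\<bar>potential (\<lambda>v. tent n (v - y)) z - potential (\<lambda>v. tent n (v - x)) z\<bar> =
      \<bar>\<integral>v. tent n (v - 0) * W (v + (y - z)) - tent n (v - 0) * W (v + (x - z)) \<partial>lborel\<bar>"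
    unfolding shift Bochner_Integration.integral_diff[OF i i] ..
  also have "\<dots> \<le> (\<integral>v. \<bar>tent n (v - 0) * W (v + (y - z)) - tent n (v - 0) * W (v + (x - z))\<bar> \<partial>lborel)"
    by (rule integral_abs_bound)
  also have "\<dots> \<le> (\<integral>v. tent n (v - 0) * ?D \<partial>lborel)"
  proof (rule integral_mono)
    show "integrable lborel (\<lambda>v. \<bar>tent n (v - 0) * W (v + (y - z)) - tent n (v - 0) * W (v + (x - z))\<bar>)"
      by (intro integrable_abs Bochner_Integration.integrable_diff i)
    show "integrable lborel (\<lambda>v. tent n (v - 0) * ?D)" by (rule i3)
    fix v
    have "\<bar>W (v + (y - z)) - W (v + (x - z))\<bar> \<le> ?D"
      using scale_diff_le[of \<alpha> "v + (y - z)" "v + (x - z)"] \<alpha> by simp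
    then show "\<bar>tent n (v - 0) * W (v + (y - z)) - tent n (v - 0) * W (v + (x - z))\<bar> \<le> tent n (v - 0) * ?D"
      using tent_nonneg[of n "v - 0"] n
      unfolding right_diff_distrib[symmetric] abs_mult by (intro mult_mono) auto
  qed
  also have "\<dots> = ?D" by (rule integral_tent_mult[OF n])
  finally show ?thesis .
qed

end

locale stable_levy_local_time = stable_levy +
  fixes l :: "real \<Rightarrow> real \<Rightarrow> 'a \<Rightarrow> real"
  assumes l_measurable: "\<And>y t. 0 \<le> t \<Longrightarrow> l y t \<in> borel_measurable M"
    and l_continuous: "AE \<omega> in M. continuous_on (UNIV \<times> {0..}) (\<lambda>(y, t). l y t \<omega>)"
    and occupation_formula: "\<And>f T. f \<in> borel_measurable borel \<Longrightarrow> bounded (range f) \<Longrightarrow> 0 \<le> T \<Longrightarrow>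
      AE \<omega> in M. (LINT t:{0..T}|lborel. f (X t \<omega>)) = (LINT y|lborel. f y * l y T \<omega>)"
begin

definition tilted :: "real \<Rightarrow> real \<Rightarrow> real \<Rightarrow> real \<Rightarrow> real \<Rightarrow> 'a \<Rightarrow> real" where
  "tilted \<theta> x y t \<kappa> \<omega> = \<theta> * (l y t \<omega> - l x t \<omega>) - \<kappa> * (l x t \<omega> + l y t \<omega>)"

lemma tilted_measurable: "0 \<le> t \<Longrightarrow> tilted \<theta> x y t \<kappa> \<in> borel_measurable M"
  unfolding tilted_def[abs_def] using l_measurable[of t x, measurable] l_measurable[of t y, measurable] by measurable

lemma occupation_tent:
  assumes T: "0 \<le> T" and n: "0 < n"
  shows "AE \<omega> in M. (\<integral>s. indicator {0<..T} s * tent n (Y (s, \<omega>) - y) \<partial>lborel) =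
    (\<integral>v. tent n (v - y) * l v T \<omega> \<partial>lborel)"
proof -
  note b = bump_tent[OF n order_refl, of y]
  have "bounded (range (\<lambda>v. tent n (v - y)))"
    using bumpD(1,2)[OF b] by (intro boundedI[where B = "n + n * n"]) auto
  from occupation_formula[OF bump_measurable[OF b] this T] Y_eq AE_space show ?thesis
  proof eventually_elim
    case (elim \<omega>)
    note [measurable] = measurable_compose[OF measurable_Pair2'[OF elim(3)] Y_measurable]
    have "(\<integral>s. indicator {0<..T} s * tent n (Y (s, \<omega>) - y) \<partial>lborel) =
        (\<integral>s. indicator {0..T} s * tent n (Y (s, \<omega>) - y) \<partial>lborel)"
    proof (rule integral_cong_AE)
      show "AE s in lborel. indicator {0<..T} s * tent n (Y (s, \<omega>) - y) = indicator {0..T} s * tent n (Y (s, \<omega>) - y)"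
        using AE_lborel_singleton[of 0] by eventually_elim (auto simp: indicator_def)
    qed measurable
    also have "\<dots> = (LINT t:{0..T}|lborel. tent n (X t \<omega> - y))"
      unfolding set_lebesgue_integral_def using elim(2)
      by (intro Bochner_Integration.integral_cong) (auto simp: indicator_def)
    finally show ?case using elim(1) by simp
  qed
qed

text \<open>The tents at \<open>x\<close> and \<open>y\<close> shrink to points. The bound \<open>D\<close> on the potentials does not depend on the width,
  so the inequality survives in the limit, where occupation integrals become local times.\<close>

lemma local_time_maximal_inequality_finite:
  assumes D: "D = \<bar>y - x\<bar> powr \<alpha> / Gamma (1 + \<alpha>)" and \<theta>: "0 < \<theta>" "\<theta> * D \<le> 1 / 2"
  shows "emeasure M {\<omega>\<in>space M. \<exists>k\<le>N. c < tilted \<theta> x y (real k / 2 ^ m) (2 * \<theta>\<^sup>2 * D) \<omega>} \<le> ennreal (3 * exp (- c))"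
proof -
  define \<kappa> where "\<kappa> = 2 * \<theta>\<^sup>2 * D"
  define K where "K = \<bar>x\<bar> + \<bar>y\<bar> + 1"
  define n where "n i = real (Suc i)" for i
  have n: "0 < n i" for i by (simp add: n_def)
  define g where "g i z v = tent (n i) (v - z)" for i z v
  have bump: "bump (n i + n i * n i) K (g i z)" if "z \<in> {x, y}" for i z
  proof -
    have "1 / n i \<le> 1" by (simp add: n_def)
    then show ?thesis unfolding g_def using that by (intro bump_tent n) (auto simp: K_def)
  qed
  have gx: "bump (n i + n i * n i) K (g i x)" and gy: "bump (n i + n i * n i) K (g i y)" for i
    by (rule bump; simp)+
  have DD: "\<bar>potential (g i y) z - potential (g i x) z\<bar> \<le> D" for i z
    unfolding g_def[abs_def] D by (rule potential_tent_diff_le[OF n])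
  define q where "q i z = \<theta> * (g i y z - g i x z) - \<kappa> * (g i y z + g i x z)" for i z
  define A where "A i = {\<omega>\<in>space M. \<exists>k\<le>N. c < (\<integral>s. indicator {0<..real k / 2 ^ m} s * q i (Y (s, \<omega>)) \<partial>lborel)}" for i
  have om: "A i \<in> sets M" "emeasure M (A i) \<le> ennreal (3 * exp (- c))" for i
    unfolding A_def q_def \<kappa>_def
    by (rule occupation_maximal_inequality[OF gy[of i] gx[of i] DD \<theta>])+
  have "emeasure M {\<omega>\<in>space M. \<exists>k\<le>N. c < tilted \<theta> x y (real k / 2 ^ m) \<kappa> \<omega>} \<le> ennreal (3 * exp (- c))"
  proof (rule emeasure_le_of_eventually[of A])
    show "A i \<in> sets M" for i by (rule om)
    show "emeasure M (A i) \<le> ennreal (3 * exp (- c))" for i by (rule om)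
    have [measurable]: "tilted \<theta> x y (real k / 2 ^ m) \<kappa> \<in> borel_measurable M" for k
      by (rule tilted_measurable) simp
    show "{\<omega>\<in>space M. \<exists>k\<le>N. c < tilted \<theta> x y (real k / 2 ^ m) \<kappa> \<omega>} \<in> sets M" by measurable
    have "AE \<omega> in M. \<forall>i k. (\<integral>s. indicator {0<..real k / 2 ^ m} s * g i z (Y (s, \<omega>)) \<partial>lborel) =
        (\<integral>v. g i z v * l v (real k / 2 ^ m) \<omega> \<partial>lborel)" for z
      unfolding AE_all_countable g_def by (intro allI occupation_tent n) simp
    from this[of x] this[of y] l_continuous AE_space
    show "AE \<omega> in M. \<omega> \<in> {\<omega>\<in>space M. \<exists>k\<le>N. c < tilted \<theta> x y (real k / 2 ^ m) \<kappa> \<omega>} \<longrightarrow>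
        eventually (\<lambda>i. \<omega> \<in> A i) sequentially"
    proof eventually_elim
      case (elim \<omega>)
      show ?case
      proof
        assume "\<omega> \<in> {\<omega>\<in>space M. \<exists>k\<le>N. c < tilted \<theta> x y (real k / 2 ^ m) \<kappa> \<omega>}"
        then obtain k where k: "k \<le> N" "c < tilted \<theta> x y (real k / 2 ^ m) \<kappa> \<omega>" by auto
        let ?t = "real k / 2 ^ m"
        note [measurable] = measurable_compose[OF measurable_Pair2'[OF elim(4)] Y_measurable]
        have cont: "continuous_on UNIV (\<lambda>v. l v ?t \<omega>)"
        proof -
          have "continuous_on UNIV (\<lambda>v. case (v, ?t) of (y, t) \<Rightarrow> l y t \<omega>)"
            by (rule continuous_on_compose2[OF elim(3)]) (auto intro!: continuous_intros)
          then show ?thesis by simp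
        qed
        define U where "U i z = (\<integral>s. indicator {0<..?t} s * g i z (Y (s, \<omega>)) \<partial>lborel)" for i z
        have U: "(\<lambda>i. U i z) \<longlonglongrightarrow> l z ?t \<omega>" if "z \<in> {x, y}" for z
        proof -
          have "U i z = (\<integral>v. tent (real (Suc i)) (v - z) * l v ?t \<omega> \<partial>lborel)" for i
            using that elim(1,2) by (auto simp: U_def g_def n_def)
          then show ?thesis using tent_average_tendsto[OF cont, of z] by simp
        qed
        have "(\<lambda>i. \<theta> * (U i y - U i x) - \<kappa> * (U i x + U i y)) \<longlonglongrightarrow>
            tilted \<theta> x y ?t \<kappa> \<omega>"
          unfolding tilted_def by (intro tendsto_intros U) auto
        then have "\<forall>\<^sub>F i in sequentially. c < \<theta> * (U i y - U i x) - \<kappa> * (U i x + U i y)"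
          using k(2) by (rule order_tendstoD)
        then show "\<forall>\<^sub>F i in sequentially. \<omega> \<in> A i"
        proof eventually_elim
          case (elim i)
          have int: "integrable lborel (\<lambda>s. indicator {0<..?t} s * g i z (Y (s, \<omega>)))" if "z \<in> {x, y}" for z
          proof (rule Bochner_Integration.integrable_bound)
            note [measurable] = bump_measurable[OF bump[OF that, of i]]
            show "integrable lborel (\<lambda>s. (n i + n i * n i) * indicator {0<..?t} s)"
              by (intro integrable_mult_right integrable_real_indicator) (auto simp: emeasure_lborel_Ioc)
            show "(\<lambda>s. indicator {0<..?t} s * g i z (Y (s, \<omega>))) \<in> borel_measurable lborel" by measurable
            show "AE s in lborel. norm (indicator {0<..?t} s * g i z (Y (s, \<omega>))) \<le>
                norm ((n i + n i * n i) * indicator {0<..?t} s)"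
              using bumpD(1,2,5)[OF bump[OF that, of i]] by (intro AE_I2) (auto simp: indicator_def)
          qed
          have ix: "integrable lborel (\<lambda>s. indicator {0<..?t} s * g i x (Y (s, \<omega>)))"
            and iy: "integrable lborel (\<lambda>s. indicator {0<..?t} s * g i y (Y (s, \<omega>)))" by (rule int; simp)+
          have "(\<integral>s. indicator {0<..?t} s * q i (Y (s, \<omega>)) \<partial>lborel) =
            (\<integral>s. \<theta> * (indicator {0<..?t} s * g i y (Y (s, \<omega>)) - indicator {0<..?t} s * g i x (Y (s, \<omega>))) -
              \<kappa> * (indicator {0<..?t} s * g i x (Y (s, \<omega>)) + indicator {0<..?t} s * g i y (Y (s, \<omega>))) \<partial>lborel)"
            by (intro Bochner_Integration.integral_cong) (auto simp: q_def indicator_def algebra_simps)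
          also have "\<dots> = \<theta> * (U i y - U i x) - \<kappa> * (U i x + U i y)"
            unfolding U_def using ix iy by simp
          finally show ?case using elim k(1) \<open>\<omega> \<in> space M\<close> by (auto simp: A_def)
        qed
      qed
    qed
  qed
  then show ?thesis by (simp add: \<kappa>_def)
qed

text \<open>Outside an event of exponentially small probability, the difference of two local times is at most
  \<open>2 * \<theta> * D\<close> times their sum plus \<open>c / \<theta>\<close> at all dyadic times,
  hence at all times by continuity. This uniformity in time is what makes stopping at a heavy-tailed random time harmless.\<close>

lemma local_time_maximal_inequality:
  assumes D: "D = \<bar>y - x\<bar> powr \<alpha> / Gamma (1 + \<alpha>)" and \<theta>: "0 < \<theta>" "\<theta> * D \<le> 1 / 2"
  shows "emeasure M {\<omega>\<in>space M. \<exists>m k. c < tilted \<theta> x y (real k / 2 ^ m) (2 * \<theta>\<^sup>2 * D) \<omega>} \<le> ennreal (3 * exp (- c))"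
proof -
  let ?T = "\<lambda>m k. tilted \<theta> x y (real k / 2 ^ m) (2 * \<theta>\<^sup>2 * D)"
  have [measurable]: "?T m k \<in> borel_measurable M" for m k by (rule tilted_measurable) simp
  \<comment> \<open>Increasing finite sets of times that exhaust the dyadic ones.\<close>
  define B where "B N = {\<omega>\<in>space M. \<exists>k\<le>4 ^ N. c < ?T N k \<omega>}" for N :: nat
  have Bm: "B N \<in> sets M" for N unfolding B_def by measurable
  have refine: "?T (m + i) (k * 2 ^ i) = ?T m k" for m i k
    by (simp add: power_add field_simps)
  have "B N \<subseteq> B (Suc N)" for N
  proof
    fix \<omega> assume "\<omega> \<in> B N"
    then obtain k where k: "\<omega> \<in> space M" "k \<le> 4 ^ N" "c < ?T N k \<omega>" by (auto simp: B_def)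
    then have "k * 2 ^ 1 \<le> 4 ^ Suc N" "c < ?T (N + 1) (k * 2 ^ 1) \<omega>" unfolding refine by auto
    then show "\<omega> \<in> B (Suc N)" unfolding B_def using k(1) by (metis (mono_tags, lifting) Suc_eq_plus1 mem_Collect_eq)
  qed
  then have inc: "incseq B" by (rule incseq_SucI)
  have "{\<omega>\<in>space M. \<exists>m k. c < ?T m k \<omega>} \<subseteq> (\<Union>N. B N)"
  proof
    fix \<omega> assume "\<omega> \<in> {\<omega>\<in>space M. \<exists>m k. c < ?T m k \<omega>}"
    then obtain m k where mk: "\<omega> \<in> space M" "c < ?T m k \<omega>" by auto
    have "k * 2 ^ k \<le> 2 ^ k * 2 ^ k" using less_exp[of k] by (intro mult_right_mono) auto
    also have "\<dots> = 4 ^ k" by (simp add: power_mult_distrib[symmetric])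
    also have "\<dots> \<le> 4 ^ (m + k)" by (intro power_increasing) auto
    finally have "k * 2 ^ k \<le> 4 ^ (m + k)" .
    moreover have "c < ?T (m + k) (k * 2 ^ k) \<omega>" unfolding refine by (rule mk(2))
    ultimately have "\<omega> \<in> B (m + k)" using mk(1) unfolding B_def by blast
    then show "\<omega> \<in> (\<Union>N. B N)" by blast
  qed
  then have "emeasure M {\<omega>\<in>space M. \<exists>m k. c < ?T m k \<omega>} \<le> emeasure M (\<Union>N. B N)"
    using Bm by (intro emeasure_mono) auto
  also have "\<dots> = (SUP N. emeasure M (B N))"
    using inc Bm by (intro SUP_emeasure_incseq[symmetric]) auto
  also have "\<dots> \<le> ennreal (3 * exp (- c))"
    unfolding B_def by (intro SUP_least local_time_maximal_inequality_finite[OF D \<theta>])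
  finally show ?thesis .
qed

end

section \<open>Chaining and exponential tails\<close>

lemma dyadic_floor_step:
  fixes x :: real
  assumes x: "0 \<le> x"
  defines "k \<equiv> \<lambda>n. nat \<lfloor>x * 2 ^ n\<rfloor>"
  shows "k (Suc n) = 2 * k n \<or> k (Suc n) = 2 * k n + 1"
proof -
  have "\<lfloor>x * 2 ^ Suc n\<rfloor> = \<lfloor>2 * (x * 2 ^ n)\<rfloor>" by (simp add: mult_ac)
  moreover have "\<lfloor>2 * z\<rfloor> = 2 * \<lfloor>z\<rfloor> \<or> \<lfloor>2 * z\<rfloor> = 2 * \<lfloor>z\<rfloor> + 1" for z :: real by linarith
  moreover have "0 \<le> \<lfloor>x * 2 ^ n\<rfloor>" using x by simp
  ultimately have "0 \<le> \<lfloor>x * 2 ^ n\<rfloor>"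
    "\<lfloor>x * 2 ^ Suc n\<rfloor> = 2 * \<lfloor>x * 2 ^ n\<rfloor> \<or> \<lfloor>x * 2 ^ Suc n\<rfloor> = 2 * \<lfloor>x * 2 ^ n\<rfloor> + 1" by simp_all
  then show ?thesis unfolding k_def by (auto simp only: nat_add_distrib nat_mult_distrib) simp_all
qed

lemma dyadic_floor_tendsto:
  fixes x :: real
  assumes x: "0 \<le> x"
  shows "(\<lambda>n. real (nat \<lfloor>x * 2 ^ n\<rfloor>) / 2 ^ n) \<longlonglongrightarrow> x"
proof (rule tendsto_sandwich)
  have r: "real (nat \<lfloor>x * 2 ^ n\<rfloor>) = of_int \<lfloor>x * 2 ^ n\<rfloor>" for n using x by simp
  show "\<forall>\<^sub>F n in sequentially. x - (1 / 2) ^ n \<le> real (nat \<lfloor>x * 2 ^ n\<rfloor>) / 2 ^ n"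
  proof (intro always_eventually allI)
    fix n :: nat
    have "x * 2 ^ n - 1 \<le> of_int \<lfloor>x * 2 ^ n\<rfloor>" by linarith
    then have "(x * 2 ^ n - 1) / 2 ^ n \<le> of_int \<lfloor>x * 2 ^ n\<rfloor> / 2 ^ n"
      by (intro divide_right_mono) auto
    then show "x - (1 / 2) ^ n \<le> real (nat \<lfloor>x * 2 ^ n\<rfloor>) / 2 ^ n"
      unfolding r by (simp add: diff_divide_distrib power_divide)
  qed
  show "\<forall>\<^sub>F n in sequentially. real (nat \<lfloor>x * 2 ^ n\<rfloor>) / 2 ^ n \<le> x"
    unfolding r by (intro always_eventually allI) (simp add: field_simps)
  have "(\<lambda>n. x - (1 / 2 :: real) ^ n) \<longlonglongrightarrow> x - 0"
    by (intro tendsto_intros LIMSEQ_power_zero) simp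
  then show "(\<lambda>n. x - (1 / 2 :: real) ^ n) \<longlonglongrightarrow> x" by simp
qed simp

text \<open>Both points are reached from dyadic points of level \<open>n\<close> by successive refinement, and the two dyadic
  points are equal or neighbours because \<open>y - x\<close> is at most the mesh.\<close>

lemma dyadic_chaining:
  fixes \<phi> :: "real \<Rightarrow> real"
  assumes \<phi>: "continuous_on {0..1} \<phi>" and r: "0 < r" "r < 1" and K: "0 \<le> K"
    and inc: "\<And>n i. i < 2 ^ n \<Longrightarrow> \<bar>\<phi> (real (Suc i) / 2 ^ n) - \<phi> (real i / 2 ^ n)\<bar> \<le> K * r ^ n"
    and xy: "0 \<le> x" "x < y" "y \<le> 1" and n: "y - x \<le> 1 / 2 ^ n"
  shows "\<bar>\<phi> y - \<phi> x\<bar> \<le> K * r ^ n * ((1 + r) / (1 - r))"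
proof -
  define k where "k z n = nat \<lfloor>z * 2 ^ n\<rfloor>" for z :: real and n :: nat
  have kle: "real (k z n) \<le> z * 2 ^ n" "k z n \<le> 2 ^ n" if "0 \<le> z" "z \<le> 1" for z n
  proof -
    show 1: "real (k z n) \<le> z * 2 ^ n" using that by (simp add: k_def)
    have "z * 2 ^ n \<le> 1 * 2 ^ n" using that by (intro mult_right_mono) auto
    with 1 have "real (k z n) \<le> 1 * 2 ^ n" by (rule order_trans)
    then show "k z n \<le> 2 ^ n" by simp
  qed
  have step: "\<bar>\<phi> (real (k z (Suc n)) / 2 ^ Suc n) - \<phi> (real (k z n) / 2 ^ n)\<bar> \<le> K * r ^ Suc n"
    if z: "0 \<le> z" "z \<le> 1" for z n
  proof -
    have e: "real (k z n) / 2 ^ n = real (2 * k z n) / 2 ^ Suc n" by simp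
    consider "k z (Suc n) = 2 * k z n" | "k z (Suc n) = Suc (2 * k z n)"
      using dyadic_floor_step[OF z(1), of n] by (auto simp: k_def)
    then show ?thesis
    proof cases
      case 1
      then show ?thesis unfolding e using K r by simp
    next
      case 2
      then show ?thesis unfolding e 2 using kle(2)[OF z, of "Suc n"] 2 by (intro inc) simp
    qed
  qed
  have sum: "\<bar>\<phi> (real (k z (n + d)) / 2 ^ (n + d)) - \<phi> (real (k z n) / 2 ^ n)\<bar> \<le>
      K * r ^ Suc n * ((1 - r ^ d) / (1 - r))" if z: "0 \<le> z" "z \<le> 1" for z n d
  proof (induction d)
    case (Suc d)
    have "\<bar>\<phi> (real (k z (n + Suc d)) / 2 ^ (n + Suc d)) - \<phi> (real (k z n) / 2 ^ n)\<bar> \<le>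
        K * r ^ Suc n * ((1 - r ^ d) / (1 - r)) + K * r ^ Suc (n + d)"
      using Suc step[OF z, of "n + d"] by simp
    also have "\<dots> = K * r ^ Suc n * ((1 - r ^ d) / (1 - r) + r ^ d)" by (simp add: power_add algebra_simps)
    also have "(1 - r ^ d) / (1 - r) + r ^ d = (1 - r ^ Suc d) / (1 - r)" using r by (simp add: field_simps)
    finally show ?case .
  qed simp
  have lim: "\<bar>\<phi> z - \<phi> (real (k z n) / 2 ^ n)\<bar> \<le> K * r ^ Suc n / (1 - r)" if z: "0 \<le> z" "z \<le> 1" for z n
  proof (rule LIMSEQ_le_const2)
    have "(\<lambda>d. real (k z d) / 2 ^ d) \<longlonglongrightarrow> z" using dyadic_floor_tendsto[OF z(1)] by (simp add: k_def)
    moreover have "real (k z d) / 2 ^ d \<in> {0..1}" for d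
      using kle(2)[OF z, of d] by (simp add: divide_le_eq_1)
    ultimately have "(\<lambda>d. \<phi> (real (k z d) / 2 ^ d)) \<longlonglongrightarrow> \<phi> z"
      using z by (intro continuous_on_tendsto_compose[OF \<phi>]) auto
    then have "(\<lambda>d. \<phi> (real (k z (d + n)) / 2 ^ (d + n))) \<longlonglongrightarrow> \<phi> z"
      by (rule LIMSEQ_ignore_initial_segment)
    then show "(\<lambda>d. \<bar>\<phi> (real (k z (n + d)) / 2 ^ (n + d)) - \<phi> (real (k z n) / 2 ^ n)\<bar>) \<longlonglongrightarrow>
        \<bar>\<phi> z - \<phi> (real (k z n) / 2 ^ n)\<bar>"
      by (intro tendsto_intros) (simp add: add.commute)
    show "\<exists>N. \<forall>d\<ge>N. \<bar>\<phi> (real (k z (n + d)) / 2 ^ (n + d)) - \<phi> (real (k z n) / 2 ^ n)\<bar> \<le> K * r ^ Suc n / (1 - r)"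
    proof (intro exI allI impI)
      fix d
      have "K * r ^ Suc n * ((1 - r ^ d) / (1 - r)) \<le> K * r ^ Suc n * (1 / (1 - r))"
        using K r by (intro mult_left_mono divide_right_mono) auto
      with sum[OF z, of n d] show "\<bar>\<phi> (real (k z (n + d)) / 2 ^ (n + d)) - \<phi> (real (k z n) / 2 ^ n)\<bar> \<le> K * r ^ Suc n / (1 - r)"
        by simp
    qed
  qed
  have x: "0 \<le> x" "x \<le> 1" and y: "0 \<le> y" "y \<le> 1" using xy by auto
  have mid: "\<bar>\<phi> (real (k y n) / 2 ^ n) - \<phi> (real (k x n) / 2 ^ n)\<bar> \<le> K * r ^ n"
  proof -
    have "(y - x) * 2 ^ n \<le> 1" using n by (simp add: field_simps)
    then have "y * 2 ^ n \<le> x * 2 ^ n + 1" by (simp add: algebra_simps)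
    moreover have "x * 2 ^ n \<le> y * 2 ^ n" using xy by (intro mult_right_mono) auto
    ultimately have "\<lfloor>x * 2 ^ n\<rfloor> \<le> \<lfloor>y * 2 ^ n\<rfloor>" "\<lfloor>y * 2 ^ n\<rfloor> \<le> \<lfloor>x * 2 ^ n\<rfloor> + 1" by linarith+
    moreover have "0 \<le> \<lfloor>x * 2 ^ n\<rfloor>" using x by simp
    ultimately consider "k y n = k x n" | "k y n = Suc (k x n)" unfolding k_def by linarith
    then show ?thesis
    proof cases
      case 2
      then show ?thesis using kle(2)[OF y, of n] inc[of "k x n" n] by simp
    qed (use K r in simp)
  qed
  have "\<bar>\<phi> y - \<phi> x\<bar> \<le> K * r ^ Suc n / (1 - r) + K * r ^ n + K * r ^ Suc n / (1 - r)"
    using lim[OF x, of n] lim[OF y, of n] mid by linarith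
  also have "\<dots> = K * r ^ n * (r / (1 - r) + 1 + r / (1 - r))" by (simp add: algebra_simps)
  also have "r / (1 - r) + 1 + r / (1 - r) = (1 + r) / (1 - r)" using r by (simp add: field_simps)
  finally show ?thesis .
qed

lemma holder_of_dyadic_increments:
  assumes b: "0 < b" and \<nu>: "0 < \<nu>"
  obtains C :: real where "0 < C"
    "\<And>\<phi> K x y. continuous_on {0..b} \<phi> \<Longrightarrow> 0 \<le> K \<Longrightarrow>
      (\<And>n i. i < 2 ^ n \<Longrightarrow> \<bar>\<phi> (b * real (Suc i) / 2 ^ n) - \<phi> (b * real i / 2 ^ n)\<bar> \<le> K * (1 / 2 ^ n) powr \<nu>) \<Longrightarrow>
      0 \<le> x \<Longrightarrow> x < y \<Longrightarrow> y \<le> b \<Longrightarrow> \<bar>\<phi> y - \<phi> x\<bar> \<le> C * K * ((y - x) / b) powr \<nu>"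
proof -
  define r where "r = (1 / 2 :: real) powr \<nu>"
  have r: "0 < r" "r < 1" using \<nu> powr_less_mono'[of "1 / 2" 0 \<nu>] by (auto simp: r_def)
  have rn: "(1 / 2 ^ n) powr \<nu> = r ^ n" for n
    unfolding r_def by (simp add: powr_realpow[symmetric] powr_powr powr_divide mult.commute)
  define C where "C = (1 + r) / (1 - r) / r"
  have "0 < C" using r by (simp add: C_def)
  moreover have "\<bar>\<phi> y - \<phi> x\<bar> \<le> C * K * ((y - x) / b) powr \<nu>"
    if \<phi>: "continuous_on {0..b} \<phi>" and K: "0 \<le> K"
      and inc: "\<And>n i. i < 2 ^ n \<Longrightarrow> \<bar>\<phi> (b * real (Suc i) / 2 ^ n) - \<phi> (b * real i / 2 ^ n)\<bar> \<le> K * (1 / 2 ^ n) powr \<nu>"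
      and xy: "0 \<le> x" "x < y" "y \<le> b" for \<phi> K x y
  proof -
    define d where "d = (y - x) / b"
    have d: "0 < d" "d \<le> 1" using xy b by (auto simp: d_def field_simps)
    have "(\<lambda>n. (1 / 2 :: real) ^ n) \<longlonglongrightarrow> 0" by (intro LIMSEQ_power_zero) simp
    then have "\<forall>\<^sub>F n in sequentially. (1 / 2) ^ n < d" using d(1) by (rule order_tendstoD)
    then have ex: "\<exists>n. (1 / 2) ^ n < d" by (auto simp: eventually_sequentially)
    define m where "m = (LEAST n. (1 / 2) ^ n < d)"
    have m: "(1 / 2) ^ m < d" unfolding m_def by (rule LeastI_ex[OF ex])
    then have "m \<noteq> 0" using d by (intro notI) simp
    then obtain n where mn: "m = Suc n" by (cases m) auto
    have "\<not> (1 / 2) ^ n < d" using not_less_Least[of n "\<lambda>n. (1 / 2) ^ n < d"] mn by (simp add: m_def)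
    then have dn: "d \<le> 1 / 2 ^ n" by (simp add: power_divide)
    have "\<bar>\<phi> (b * (y / b)) - \<phi> (b * (x / b))\<bar> \<le> K * r ^ n * ((1 + r) / (1 - r))"
    proof (rule dyadic_chaining[of "\<lambda>u. \<phi> (b * u)"])
      show "continuous_on {0..1} (\<lambda>u. \<phi> (b * u))"
        using b by (intro continuous_on_compose2[OF \<phi>] continuous_intros) (auto simp: mult_le_cancel_left1)
      show "\<bar>\<phi> (b * (real (Suc i) / 2 ^ n)) - \<phi> (b * (real i / 2 ^ n))\<bar> \<le> K * r ^ n" if "i < 2 ^ n" for n i
        using inc[OF that] by (simp add: rn)
      show "y / b - x / b \<le> 1 / 2 ^ n" using dn by (simp add: d_def diff_divide_distrib)
    qed (use r K xy b in \<open>auto simp: divide_strict_right_mono\<close>)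
    also have "\<dots> = C * K * r ^ m" using r by (simp add: C_def mn field_simps)
    also have "\<dots> \<le> C * K * d powr \<nu>"
    proof (intro mult_left_mono)
      have "r ^ m = ((1 / 2) ^ m) powr \<nu>" unfolding rn[symmetric] by (simp add: power_divide)
      also have "\<dots> \<le> d powr \<nu>" using m \<nu> by (intro powr_mono2) auto
      finally show "r ^ m \<le> d powr \<nu>" .
      show "0 \<le> C * K" using \<open>0 < C\<close> K by simp
    qed
    finally show ?thesis using b by (simp add: d_def)
  qed
  ultimately show ?thesis by (rule that)
qed

lemma linear_times_powr_bounded:
  assumes "0 < \<epsilon>"
  obtains c :: real where "0 < c" "\<And>n. real n * (1 / 2 ^ n) powr \<epsilon> \<le> c"
proof -
  define s where "s = (1 / 2 :: real) powr \<epsilon>"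
  have s: "0 < s" "s < 1" using assms powr_less_mono'[of "1 / 2" 0 \<epsilon>] by (auto simp: s_def)
  have sn: "(1 / 2 ^ n) powr \<epsilon> = s ^ n" for n
    unfolding s_def by (simp add: powr_realpow[symmetric] powr_powr powr_divide mult.commute)
  have "(\<lambda>n. real n * s ^ n) \<longlonglongrightarrow> 0"
    using powser_times_n_limit_0[of s] s by simp
  then have "Bseq (\<lambda>n. real n * s ^ n)" by (intro convergent_imp_Bseq convergentI)
  then obtain c where "0 < c" "\<And>n. norm (real n * s ^ n) \<le> c" by (auto elim: BseqE)
  then show ?thesis using s by (intro that[of c]) (auto simp: sn)
qed

text \<open>The bound on the increments involves \<open>\<phi>\<close> itself. Chaining gives a bound on the Hoelder constant in
  terms of the supremum of \<open>\<bar>\<phi>\<bar>\<close>, and hence a bound on the supremum in terms of itself; for small \<open>\<theta>\<close> it enters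
  with a factor at most 1/2 and can be absorbed, which leaves \<open>\<bar>\<phi> 0\<bar>\<close>. The term \<open>2 * n\<close> pays for the
  number of dyadic intervals in the union bound; it is absorbed by the gap between \<open>\<nu>\<close> and \<open>\<beta>\<close>.\<close>

lemma holder_of_self_bounding_increments:
  assumes b: "0 < b" and \<nu>: "0 < \<nu>" "\<nu> < \<beta>" and c: "0 < c" and m: "0 < \<theta>max"
  obtains \<theta> H :: real where "0 < \<theta>" "\<theta> \<le> \<theta>max" "0 < H"
    "\<And>\<phi> \<Lambda> x y. continuous_on {0..b} \<phi> \<Longrightarrow> 0 \<le> \<Lambda> \<Longrightarrow>
      (\<And>n i. i < 2 ^ n \<Longrightarrow> \<bar>\<phi> (b * real (Suc i) / 2 ^ n) - \<phi> (b * real i / 2 ^ n)\<bar> \<le>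
        (b / 2 ^ n) powr \<beta> * (c * \<theta> * (\<phi> (b * real i / 2 ^ n) + \<phi> (b * real (Suc i) / 2 ^ n)) + (\<Lambda> + 2 * real n) / \<theta>)) \<Longrightarrow>
      0 \<le> x \<Longrightarrow> x < y \<Longrightarrow> y \<le> b \<Longrightarrow> \<bar>\<phi> y - \<phi> x\<bar> \<le> H * (\<bar>\<phi> 0\<bar> + \<Lambda> + 1) * (y - x) powr \<nu>"
proof -
  obtain C where C: "0 < C" and hold: "\<And>\<phi> K x y. continuous_on {0..b} \<phi> \<Longrightarrow> 0 \<le> K \<Longrightarrow>
      (\<And>n i. i < 2 ^ n \<Longrightarrow> \<bar>\<phi> (b * real (Suc i) / 2 ^ n) - \<phi> (b * real i / 2 ^ n)\<bar> \<le> K * (1 / 2 ^ n) powr \<nu>) \<Longrightarrow>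
      0 \<le> x \<Longrightarrow> x < y \<Longrightarrow> y \<le> b \<Longrightarrow> \<bar>\<phi> y - \<phi> x\<bar> \<le> C * K * ((y - x) / b) powr \<nu>"
    using holder_of_dyadic_increments[OF b \<nu>(1)] by blast
  obtain e where e: "0 < e" "\<And>n. real n * (1 / 2 ^ n) powr (\<beta> - \<nu>) \<le> e"
    using linear_times_powr_bounded[of "\<beta> - \<nu>"] \<nu> by auto
  define B where "B = b powr \<beta>"
  have B: "0 < B" using b by (simp add: B_def)
  define \<theta> where "\<theta> = min \<theta>max (1 / (4 * c * C * B))"
  have \<theta>: "0 < \<theta>" "\<theta> \<le> \<theta>max" using m c C B by (auto simp: \<theta>_def)
  have "\<theta> \<le> 1 / (4 * c * C * B)" by (simp add: \<theta>_def)
  then have \<theta>C: "2 * c * C * B * \<theta> \<le> 1 / 2"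
    using c C B by (simp add: field_simps)
  define H where "H = C * (B * (4 * c * \<theta> * (1 + C * B * (1 + 2 * e) / \<theta>) + (1 + 2 * e) / \<theta>)) / b powr \<nu>"
  have H: "0 < H"
    unfolding H_def using C B c \<theta>(1) e(1) b
    by (intro divide_pos_pos mult_pos_pos add_pos_pos) auto
  show ?thesis
  proof (rule that[OF \<theta> H])
    fix \<phi> :: "real \<Rightarrow> real" and \<Lambda> x y :: real
    assume \<phi>: "continuous_on {0..b} \<phi>" and \<Lambda>: "0 \<le> \<Lambda>"
      and inc: "\<And>n i. i < 2 ^ n \<Longrightarrow> \<bar>\<phi> (b * real (Suc i) / 2 ^ n) - \<phi> (b * real i / 2 ^ n)\<bar> \<le>
        (b / 2 ^ n) powr \<beta> * (c * \<theta> * (\<phi> (b * real i / 2 ^ n) + \<phi> (b * real (Suc i) / 2 ^ n)) + (\<Lambda> + 2 * real n) / \<theta>)"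
      and xy: "0 \<le> x" "x < y" "y \<le> b"
    have "continuous_on {0..b} (\<lambda>z. \<bar>\<phi> z\<bar>)" using \<phi> by (intro continuous_intros)
    then obtain z0 where z0: "z0 \<in> {0..b}" "\<And>z. z \<in> {0..b} \<Longrightarrow> \<bar>\<phi> z\<bar> \<le> \<bar>\<phi> z0\<bar>"
      using continuous_attains_sup[of "{0..b}" "\<lambda>z. \<bar>\<phi> z\<bar>"] b by auto
    \<comment> \<open>The supremum of \<open>\<bar>\<phi>\<bar>\<close>, which is finite because \<open>\<phi>\<close> is continuous.\<close>
    define N where "N = \<bar>\<phi> z0\<bar>"
    define K where "K = B * (2 * c * \<theta> * N + (\<Lambda> + 2 * e) / \<theta>)"
    have K: "0 \<le> K" using B c \<theta> \<Lambda> e by (simp add: K_def N_def)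
    have kinc: "\<bar>\<phi> (b * real (Suc i) / 2 ^ n) - \<phi> (b * real i / 2 ^ n)\<bar> \<le> K * (1 / 2 ^ n) powr \<nu>"
      if i: "i < 2 ^ n" for n i
    proof -
      let ?p = "(1 / 2 ^ n :: real)"
      have pts: "b * real i / 2 ^ n \<in> {0..b}" "b * real (Suc i) / 2 ^ n \<in> {0..b}"
      proof -
        have *: "b * real j / 2 ^ n \<in> {0..b}" if "j \<le> 2 ^ n" for j
        proof -
          have "real j \<le> real (2 ^ n)" using that by (simp only: of_nat_le_iff)
          then show ?thesis using b by (simp add: field_simps)
        qed
        show "b * real i / 2 ^ n \<in> {0..b}" "b * real (Suc i) / 2 ^ n \<in> {0..b}" using i by (intro *; simp)+
      qed
      have "\<phi> (b * real i / 2 ^ n) + \<phi> (b * real (Suc i) / 2 ^ n) \<le> 2 * N"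
        using z0(2)[OF pts(1)] z0(2)[OF pts(2)] by (simp add: N_def)
      then have "c * \<theta> * (\<phi> (b * real i / 2 ^ n) + \<phi> (b * real (Suc i) / 2 ^ n)) \<le> c * \<theta> * (2 * N)"
        using c \<theta> by (intro mult_left_mono) auto
      then have "(b / 2 ^ n) powr \<beta> * (c * \<theta> * (\<phi> (b * real i / 2 ^ n) + \<phi> (b * real (Suc i) / 2 ^ n)) + (\<Lambda> + 2 * real n) / \<theta>) \<le>
          (b / 2 ^ n) powr \<beta> * (c * \<theta> * (2 * N) + (\<Lambda> + 2 * real n) / \<theta>)"
        by (intro mult_left_mono) auto
      also have "(b / 2 ^ n) powr \<beta> * (c * \<theta> * (2 * N) + (\<Lambda> + 2 * real n) / \<theta>) =
          B * ?p powr (\<beta> - \<nu>) * ?p powr \<nu> * (c * \<theta> * (2 * N) + (\<Lambda> + 2 * real n) / \<theta>)"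
        using b by (simp add: B_def powr_divide powr_diff)
      also have "\<dots> =
          B * ?p powr \<nu> * (?p powr (\<beta> - \<nu>) * (c * \<theta> * (2 * N) + \<Lambda> / \<theta>) + 2 * (real n * ?p powr (\<beta> - \<nu>)) / \<theta>)"
        by (simp add: algebra_simps add_divide_distrib)
      also have "\<dots> \<le> B * ?p powr \<nu> * (1 * (c * \<theta> * (2 * N) + \<Lambda> / \<theta>) + 2 * e / \<theta>)"
      proof (intro mult_left_mono add_mono mult_right_mono divide_right_mono e)
        show "?p powr (\<beta> - \<nu>) \<le> 1" using \<nu> by (intro powr_le1) auto
      qed (use B c \<theta> \<Lambda> in \<open>auto simp: N_def\<close>)
      also have "\<dots> = K * ?p powr \<nu>" by (simp add: K_def algebra_simps add_divide_distrib)
      finally show ?thesis by (rule order_trans[OF inc[OF i]])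
    qed
    have sup: "N \<le> \<bar>\<phi> 0\<bar> + C * K"
    proof (cases "z0 = 0")
      case True
      then show ?thesis using C K by (simp add: N_def)
    next
      case False
      then have "\<bar>\<phi> z0 - \<phi> 0\<bar> \<le> C * K * ((z0 - 0) / b) powr \<nu>"
        using z0(1) by (intro hold[OF \<phi> K kinc]) auto
      also have "\<dots> \<le> C * K * 1"
        using z0(1) b C K \<nu> by (intro mult_left_mono powr_le1) auto
      finally show ?thesis by (simp add: N_def)
    qed
    have "C * K = (2 * c * C * B * \<theta>) * N + C * B * (\<Lambda> + 2 * e) / \<theta>"
      by (simp add: K_def algebra_simps add_divide_distrib)
    also have "\<dots> \<le> 1 / 2 * N + C * B * (\<Lambda> + 2 * e) / \<theta>"
      using \<theta>C by (intro add_right_mono mult_right_mono) (auto simp: N_def)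
    finally have N1: "N \<le> 2 * \<bar>\<phi> 0\<bar> + 2 * (C * B * (\<Lambda> + 2 * e) / \<theta>)" using sup by linarith
    define G where "G = \<bar>\<phi> 0\<bar> + \<Lambda> + 1"
    have G: "\<bar>\<phi> 0\<bar> \<le> G" "1 \<le> G" using \<Lambda> by (auto simp: G_def)
    have "e \<le> e * G" using G(2) e(1) by simp
    then have eG: "\<Lambda> + 2 * e \<le> (1 + 2 * e) * G" by (simp add: G_def distrib_right)
    have "C * B * (\<Lambda> + 2 * e) / \<theta> \<le> C * B * ((1 + 2 * e) * G) / \<theta>"
      using eG C B \<theta> by (intro divide_right_mono mult_left_mono) auto
    then have "N \<le> 2 * G + 2 * (C * B * ((1 + 2 * e) * G) / \<theta>)" using N1 G(1) by linarith
    also have "\<dots> = 2 * (1 + C * B * (1 + 2 * e) / \<theta>) * G" by (simp add: algebra_simps)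
    finally have "2 * c * \<theta> * N \<le> 2 * c * \<theta> * (2 * (1 + C * B * (1 + 2 * e) / \<theta>) * G)"
      using c \<theta> by (intro mult_left_mono) auto
    moreover have "(\<Lambda> + 2 * e) / \<theta> \<le> (1 + 2 * e) * G / \<theta>"
      using eG \<theta> by (intro divide_right_mono) auto
    ultimately have "K \<le> B * (2 * c * \<theta> * (2 * (1 + C * B * (1 + 2 * e) / \<theta>) * G) + (1 + 2 * e) * G / \<theta>)"
      unfolding K_def using less_imp_le[OF B] by (intro mult_left_mono[OF add_mono])
    also have "\<dots> = B * (4 * c * \<theta> * (1 + C * B * (1 + 2 * e) / \<theta>) + (1 + 2 * e) / \<theta>) * G"
      by (simp add: algebra_simps)
    finally have KG: "C * K \<le> C * (B * (4 * c * \<theta> * (1 + C * B * (1 + 2 * e) / \<theta>) + (1 + 2 * e) / \<theta>) * G)"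
      using C by (intro mult_left_mono) auto
    have "\<bar>\<phi> y - \<phi> x\<bar> \<le> C * K * ((y - x) / b) powr \<nu>"
      by (rule hold[OF \<phi> K kinc xy])
    also have "\<dots> \<le> C * (B * (4 * c * \<theta> * (1 + C * B * (1 + 2 * e) / \<theta>) + (1 + 2 * e) / \<theta>) * G) * ((y - x) / b) powr \<nu>"
      using KG by (intro mult_right_mono) auto
    also have "\<dots> = H * G * (y - x) powr \<nu>"
      using b xy unfolding H_def by (simp add: powr_divide)
    finally show "\<bar>\<phi> y - \<phi> x\<bar> \<le> H * (\<bar>\<phi> 0\<bar> + \<Lambda> + 1) * (y - x) powr \<nu>" by (simp add: G_def)
  qed
qed

lemma powr_le_exp_half:
  fixes x p :: real
  assumes "0 \<le> x" "0 < p"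
  shows "x powr p \<le> (2 * p) powr p * exp (x / 2)"
proof -
  have "x / (2 * p) \<le> exp (x / (2 * p))" using exp_ge_add_one_self[of "x / (2 * p)"] by linarith
  then have "(x / (2 * p)) powr p \<le> exp (x / (2 * p)) powr p"
    using assms by (intro powr_mono2) auto
  also have "exp (x / (2 * p)) powr p = exp (x / 2)" using assms by (simp add: powr_def)
  finally show ?thesis using assms by (simp add: powr_divide field_simps)
qed

text \<open>Powers are dominated by \<open>exp (v / 2)\<close>, whose expectation is bounded by a geometric series over the
  unit intervals that contain \<open>v\<close>.\<close>

lemma (in prob_space) exponential_tail_moments:
  fixes V :: "'a \<Rightarrow> ennreal"
  assumes V[measurable]: "V \<in> borel_measurable M" and C: "0 \<le> C"
    and tail: "\<And>k::nat. emeasure M {\<omega>\<in>space M. ennreal (real k) < V \<omega>} \<le> ennreal (C * exp (- real k))"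
  shows "AE \<omega> in M. V \<omega> < \<infinity>" "0 < p \<Longrightarrow> integrable M (\<lambda>\<omega>. enn2real (V \<omega>) powr p)"
proof -
  have lim: "(\<lambda>k. C * exp (- real k)) \<longlonglongrightarrow> 0"
  proof -
    have "(\<lambda>k. exp (- 1 :: real) ^ k) \<longlonglongrightarrow> 0" by (intro LIMSEQ_power_zero) simp
    then have "(\<lambda>k. C * exp (- 1 :: real) ^ k) \<longlonglongrightarrow> C * 0" by (rule tendsto_mult_left)
    then show ?thesis by (simp add: exp_of_nat_mult[symmetric])
  qed
  have "emeasure M {\<omega>\<in>space M. V \<omega> = \<infinity>} \<le> ennreal (C * exp (- real k))" for k
    by (rule order_trans[OF emeasure_mono tail[of k]]) auto
  then have "emeasure M {\<omega>\<in>space M. V \<omega> = \<infinity>} \<le> ennreal 0"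
    using tendsto_ennrealI[OF lim] by (intro LIMSEQ_le_const) auto
  then have "emeasure M {\<omega>\<in>space M. V \<omega> = \<infinity>} = 0" by simp
  then show fin: "AE \<omega> in M. V \<omega> < \<infinity>"
    by (intro AE_I[of _ _ "{\<omega>\<in>space M. V \<omega> = \<infinity>}"]) (auto simp: less_top[symmetric])
  assume p: "0 < p"
  have term_le: "f k \<le> (\<Sum>k. f k)" for f :: "nat \<Rightarrow> ennreal" and k
    using sum_le_suminf[OF summableI, of "{k}" f] by simp
  let ?T = "\<lambda>k::nat. {\<omega>\<in>space M. ennreal (real k) < V \<omega>}"
  have pt: "ennreal (exp (enn2real (V \<omega>) / 2)) \<le> 1 + (\<Sum>k. ennreal (exp (real (Suc k) / 2)) * indicator (?T k) \<omega>)"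
    if \<omega>: "\<omega> \<in> space M" "V \<omega> < \<infinity>" for \<omega>
  proof (cases "V \<omega> = 0")
    case False
    define v where "v = enn2real (V \<omega>)"
    have v: "V \<omega> = ennreal v" "0 < v" using \<omega>(2) False by (auto simp: v_def enn2real_positive_iff less_top[symmetric] zero_less_iff_neq_zero)
    define k where "k = nat (\<lceil>v\<rceil> - 1)"
    have k: "real k < v" "v \<le> real (Suc k)"
    proof -
      have "0 \<le> \<lceil>v\<rceil> - 1" using v(2) by linarith
      then have "real k = of_int \<lceil>v\<rceil> - 1" by (simp add: k_def)
      then show "real k < v" "v \<le> real (Suc k)" by linarith+
    qed
    have "ennreal (exp (enn2real (V \<omega>) / 2)) \<le> ennreal (exp (real (Suc k) / 2)) * indicator (?T k) \<omega>"
      using k v \<omega>(1) by (auto simp: ennreal_less_iff v_def[symmetric] intro!: ennreal_leI)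
    also have "\<dots> \<le> (\<Sum>k. ennreal (exp (real (Suc k) / 2)) * indicator (?T k) \<omega>)"
      by (rule term_le)
    finally show ?thesis by (simp add: add_increasing)
  qed simp
  have "(\<integral>\<^sup>+\<omega>. ennreal (exp (enn2real (V \<omega>) / 2)) \<partial>M) \<le>
      (\<integral>\<^sup>+\<omega>. 1 + (\<Sum>k. ennreal (exp (real (Suc k) / 2)) * indicator (?T k) \<omega>) \<partial>M)"
  proof (rule nn_integral_mono_AE)
    show "AE \<omega> in M. ennreal (exp (enn2real (V \<omega>) / 2)) \<le>
        1 + (\<Sum>k. ennreal (exp (real (Suc k) / 2)) * indicator (?T k) \<omega>)"
      using fin AE_space by eventually_elim (rule pt)
  qed
  also have "\<dots> = 1 + (\<Sum>k. ennreal (exp (real (Suc k) / 2)) * emeasure M (?T k))"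
    by (subst nn_integral_add) (auto simp: nn_integral_suminf nn_integral_cmult_indicator emeasure_space_1)
  also have "\<dots> \<le> 1 + (\<Sum>k. ennreal (C * exp (1 / 2) * exp (- (1 / 2)) ^ k))"
  proof (intro add_left_mono suminf_le)
    fix k
    have "ennreal (exp (real (Suc k) / 2)) * emeasure M (?T k) \<le> ennreal (exp (real (Suc k) / 2)) * ennreal (C * exp (- real k))"
      by (intro mult_left_mono tail) simp
    also have "\<dots> = ennreal (C * exp (1 / 2) * exp (- (1 / 2)) ^ k)"
      using C by (simp add: ennreal_mult[symmetric] exp_of_nat_mult[symmetric] exp_add[symmetric] field_simps)
    finally show "ennreal (exp (real (Suc k) / 2)) * emeasure M (?T k) \<le> ennreal (C * exp (1 / 2) * exp (- (1 / 2)) ^ k)" .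
  qed auto
  also have "\<dots> < \<infinity>"
  proof -
    have "summable (\<lambda>k. C * exp (1 / 2) * exp (- (1 / 2)) ^ k :: real)"
      by (intro summable_mult summable_geometric) simp
    then show ?thesis using C by (subst suminf_ennreal2) auto
  qed
  finally have "integrable M (\<lambda>\<omega>. exp (enn2real (V \<omega>) / 2))"
    by (intro integrableI_nonneg) auto
  then have "integrable M (\<lambda>\<omega>. (2 * p) powr p * exp (enn2real (V \<omega>) / 2))" by simp
  then show "integrable M (\<lambda>\<omega>. enn2real (V \<omega>) powr p)"
    by (rule Bochner_Integration.integrable_bound)
       (auto intro!: AE_I2 order_trans[OF powr_le_exp_half[OF _ p]])
qed

section \<open>A Hoelder bound uniform in time\<close>

lemma dyadic_ceiling_eq: "0 \<le> t \<Longrightarrow> \<exists>k::nat. dyadic_ceiling n t = real k / 2 ^ n"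
  unfolding dyadic_ceiling_def by (intro exI[of _ "nat \<lceil>t * 2 ^ n\<rceil>"]) simp

lemma le_enn2realI: "x < \<infinity> \<Longrightarrow> ennreal r \<le> x \<Longrightarrow> r \<le> enn2real x"
  using enn2real_mono[of "ennreal r" x] by (cases "0 \<le> r") (auto intro: order_trans[OF _ enn2real_nonneg])

lemma jointly_continuous_slices:
  fixes l :: "real \<Rightarrow> real \<Rightarrow> real"
  assumes l: "continuous_on (UNIV \<times> {0..}) (\<lambda>(y, t). l y t)"
  shows "0 \<le> t \<Longrightarrow> continuous_on A (\<lambda>y. l y t)" "continuous_on {0..} (l y)"
    "0 \<le> t \<Longrightarrow> (\<lambda>n. l y (dyadic_ceiling n t)) \<longlonglongrightarrow> l y t"
proof -
  show "continuous_on A (\<lambda>y. l y t)" if "0 \<le> t"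
  proof -
    have "continuous_on A (\<lambda>y. case (y, t) of (y, t) \<Rightarrow> l y t)"
      using that by (intro continuous_on_compose2[OF l]) (auto intro!: continuous_intros)
    then show ?thesis by simp
  qed
  have "continuous_on {0..} (\<lambda>t. case (y, t) of (y, t) \<Rightarrow> l y t)"
    by (intro continuous_on_compose2[OF l]) (auto intro!: continuous_intros)
  then show c: "continuous_on {0..} (l y)" by simp
  show "(\<lambda>n. l y (dyadic_ceiling n t)) \<longlonglongrightarrow> l y t" if "0 \<le> t"
    using that by (intro continuous_on_tendsto_compose[OF c dyadic_ceiling_tendsto])
      (auto intro!: always_eventually order_trans[OF _ dyadic_ceiling_ge])
qed

context stable_levy_local_time
begin

lemma local_time_nonneg: "AE \<omega> in M. (\<forall>t\<ge>0. 0 \<le> l y t \<omega>) \<and> l y 0 \<omega> = 0"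
proof -
  have "AE \<omega> in M. \<forall>i m k. (\<integral>s. indicator {0<..real k / 2 ^ m} s * tent (real (Suc i)) (Y (s, \<omega>) - y) \<partial>lborel) =
      (\<integral>v. tent (real (Suc i)) (v - y) * l v (real k / 2 ^ m) \<omega> \<partial>lborel)"
    unfolding AE_all_countable by (intro allI occupation_tent) simp_all
  with l_continuous show ?thesis
  proof eventually_elim
    case (elim \<omega>)
    note slices = jointly_continuous_slices[OF elim(1)]
    have lim: "(\<lambda>i. \<integral>s. indicator {0<..real k / 2 ^ m} s * tent (real (Suc i)) (Y (s, \<omega>) - y) \<partial>lborel)
        \<longlonglongrightarrow> l y (real k / 2 ^ m) \<omega>" for k m
      unfolding elim(2)[rule_format] by (rule tent_average_tendsto) (intro slices, simp)
    have dy: "0 \<le> l y (real k / 2 ^ m) \<omega>" for k m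
      by (rule LIMSEQ_le_const[OF lim])
         (auto intro!: exI[of _ 0] integral_nonneg_AE AE_I2 mult_nonneg_nonneg tent_nonneg)
    have "0 \<le> l y t \<omega>" if t: "0 \<le> t" for t
    proof (rule LIMSEQ_le_const[OF slices(3)[OF t]])
      have "0 \<le> l y (dyadic_ceiling n t) \<omega>" for n
        using dyadic_ceiling_eq[OF t, of n] dy by auto
      then show "\<exists>N. \<forall>n\<ge>N. 0 \<le> l y (dyadic_ceiling n t) \<omega>" by blast
    qed
    moreover have "l y 0 \<omega> = 0"
      using lim[of 0 0] by (simp add: LIMSEQ_const_iff)
    ultimately show ?case by blast
  qed
qed

text \<open>The maximal inequality is applied to both orders of every pair of dyadic neighbours of level \<open>n\<close>, with
  \<open>\<theta>\<close> divided by the square root \<open>s n\<close> of the \<open>\<alpha>\<close>-th power of their distance. This choice keeps the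
  coefficient of the sum of the local times independent of \<open>n\<close> and yields increments of order \<open>s n\<close>.
  All exceptional events are collected in one variable \<open>\<Lambda>\<close> that does not depend on time.\<close>

lemma uniform_holder_bound:
  assumes b: "0 < b" and \<nu>: "0 < \<nu>" "\<nu> < \<alpha> / 2"
  obtains H :: real and \<Lambda> :: "'a \<Rightarrow> ennreal" where "0 < H" "\<Lambda> \<in> borel_measurable M"
    "\<And>c. 0 \<le> c \<Longrightarrow> emeasure M {\<omega>\<in>space M. ennreal c < \<Lambda> \<omega>} \<le> ennreal (12 * exp (- c))"
    "AE \<omega> in M. \<Lambda> \<omega> < \<infinity> \<longrightarrow> (\<forall>t x y. 0 \<le> t \<longrightarrow> 0 \<le> x \<longrightarrow> x < y \<longrightarrow> y \<le> b \<longrightarrow>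
      \<bar>l y t \<omega> - l x t \<omega>\<bar> \<le> H * (\<bar>l 0 t \<omega>\<bar> + enn2real (\<Lambda> \<omega>) + 1) * (y - x) powr \<nu>)"
proof -
  define \<Gamma> where "\<Gamma> = Gamma (1 + \<alpha>)"
  have \<Gamma>: "0 < \<Gamma>" unfolding \<Gamma>_def using \<alpha> by (intro Gamma_real_pos) simp
  define c where "c = 2 / \<Gamma>"
  have c: "0 < c" using \<Gamma> by (simp add: c_def)
  have \<theta>max: "0 < \<Gamma> / (2 * b powr (\<alpha> / 2))" using \<Gamma> b by simp
  obtain \<theta> H where \<theta>: "0 < \<theta>" "\<theta> \<le> \<Gamma> / (2 * b powr (\<alpha> / 2))" and H: "0 < H"
    and hold: "\<And>\<phi> \<Lambda> x y. continuous_on {0..b} \<phi> \<Longrightarrow> 0 \<le> \<Lambda> \<Longrightarrow>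
      (\<And>n i. i < 2 ^ n \<Longrightarrow> \<bar>\<phi> (b * real (Suc i) / 2 ^ n) - \<phi> (b * real i / 2 ^ n)\<bar> \<le>
        (b / 2 ^ n) powr (\<alpha> / 2) * (c * \<theta> * (\<phi> (b * real i / 2 ^ n) + \<phi> (b * real (Suc i) / 2 ^ n)) + (\<Lambda> + 2 * real n) / \<theta>)) \<Longrightarrow>
      0 \<le> x \<Longrightarrow> x < y \<Longrightarrow> y \<le> b \<Longrightarrow> \<bar>\<phi> y - \<phi> x\<bar> \<le> H * (\<bar>\<phi> 0\<bar> + \<Lambda> + 1) * (y - x) powr \<nu>"
    using holder_of_self_bounding_increments[OF b \<nu> c \<theta>max] by blast
  define s where "s n = (b / 2 ^ n) powr (\<alpha> / 2)" for n :: nat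
  define p where "p n i = b * real i / 2 ^ n" for n i :: nat
  have s: "0 < s n" for n using b by (simp add: s_def)
  have s_le: "s n \<le> b powr (\<alpha> / 2)" for n
  proof -
    have "b / 2 ^ n \<le> b / 1" using b by (intro divide_left_mono) auto
    then show ?thesis unfolding s_def using b \<alpha> by (intro powr_mono2) auto
  qed
  define \<kappa> where "\<kappa> = c * \<theta> * \<theta>"
  define T where "T n x y m k = tilted (\<theta> / s n) x y (real k / 2 ^ m) \<kappa>" for n :: nat and x y and m k :: nat
  have T_measurable[measurable]: "T n x y m k \<in> borel_measurable M" for n x y m k
    unfolding T_def by (rule tilted_measurable) simp
  have max_ineq: "emeasure M {\<omega>\<in>space M. \<exists>m k. e < T n x y m k \<omega>} \<le> ennreal (3 * exp (- e))"
    if xy: "\<bar>y - x\<bar> = b / 2 ^ n" for n x y e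
  proof -
    define D where "D = \<bar>y - x\<bar> powr \<alpha> / Gamma (1 + \<alpha>)"
    have D: "D = s n * s n / \<Gamma>"
      unfolding D_def xy s_def \<Gamma>_def by (simp add: powr_add[symmetric])
    have k: "2 * (\<theta> / s n)\<^sup>2 * D = \<kappa>"
      using s[of n] \<Gamma> by (simp add: D \<kappa>_def c_def power2_eq_square)
    have "\<theta> / s n * D = \<theta> * s n / \<Gamma>" using s[of n] by (simp add: D)
    also have "\<dots> \<le> \<Gamma> / (2 * b powr (\<alpha> / 2)) * b powr (\<alpha> / 2) / \<Gamma>"
      using \<theta> \<Gamma> s[of n] s_le[of n] by (intro divide_right_mono mult_mono) auto
    also have "\<dots> = 1 / 2" using \<Gamma> b by simp
    finally have "\<theta> / s n * D \<le> 1 / 2" .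
    from local_time_maximal_inequality[OF D_def _ this, of e] k show ?thesis
      using \<theta> s[of n] by (simp add: T_def)
  qed
  \<comment> \<open>The smallest level that makes all bounds hold at once; \<open>ennreal\<close> cuts negative values off at 0.
      The shift by \<open>2 * n\<close> beats the \<open>2 ^ n\<close> intervals of level \<open>n\<close>, as \<open>2 * exp (- 2) \<le> 1 / 2\<close>.\<close>
  define \<Lambda> where "\<Lambda> \<omega> = (SUP n. SUP i\<in>{..<2 ^ n}. SUP m. SUP k.
      max (ennreal (T n (p n i) (p n (Suc i)) m k \<omega> - 2 * real n))
          (ennreal (T n (p n (Suc i)) (p n i) m k \<omega> - 2 * real n)))" for \<omega>
  have \<Lambda>_measurable[measurable]: "\<Lambda> \<in> borel_measurable M" unfolding \<Lambda>_def[abs_def] by measurable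
  have p: "\<bar>p n (Suc i) - p n i\<bar> = b / 2 ^ n" "\<bar>p n i - p n (Suc i)\<bar> = b / 2 ^ n" for n i
  proof -
    have "p n (Suc i) - p n i = b / 2 ^ n" by (simp add: p_def diff_divide_distrib[symmetric] algebra_simps)
    then show "\<bar>p n (Suc i) - p n i\<bar> = b / 2 ^ n" "\<bar>p n i - p n (Suc i)\<bar> = b / 2 ^ n"
      using b by (simp_all add: abs_minus_commute[of "p n i"])
  qed
  show ?thesis
  proof (rule that[OF H \<Lambda>_measurable])
    fix e :: real assume e: "0 \<le> e"
    define E where "E n x y = {\<omega>\<in>space M. \<exists>m k. e + 2 * real n < T n x y m k \<omega>}" for n x y
    have Em[measurable]: "E n x y \<in> sets M" for n x y unfolding E_def by measurable
    define F where "F n = (\<Union>i\<in>{..<2 ^ n}. E n (p n i) (p n (Suc i)) \<union> E n (p n (Suc i)) (p n i))" for n :: nat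
    have Fm[measurable]: "F n \<in> sets M" for n unfolding F_def by measurable
    have "{\<omega>\<in>space M. ennreal e < \<Lambda> \<omega>} \<subseteq> (\<Union>n. F n)"
    proof
      fix \<omega> assume "\<omega> \<in> {\<omega>\<in>space M. ennreal e < \<Lambda> \<omega>}"
      then obtain n i m k where *: "\<omega> \<in> space M" "i < 2 ^ n"
        "ennreal e < ennreal (T n (p n i) (p n (Suc i)) m k \<omega> - 2 * real n) \<or>
         ennreal e < ennreal (T n (p n (Suc i)) (p n i) m k \<omega> - 2 * real n)"
        unfolding \<Lambda>_def less_SUP_iff less_max_iff_disj by blast
      then have "e + 2 * real n < T n (p n i) (p n (Suc i)) m k \<omega> \<or> e + 2 * real n < T n (p n (Suc i)) (p n i) m k \<omega>"
        using e by (auto simp: ennreal_less_iff)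
      then have "\<omega> \<in> E n (p n i) (p n (Suc i)) \<union> E n (p n (Suc i)) (p n i)" using *(1) unfolding E_def by blast
      with *(2) show "\<omega> \<in> (\<Union>n. F n)" unfolding F_def by blast
    qed
    then have "emeasure M {\<omega>\<in>space M. ennreal e < \<Lambda> \<omega>} \<le> emeasure M (\<Union>n. F n)"
      by (intro emeasure_mono) auto
    also have "\<dots> \<le> (\<Sum>n. emeasure M (F n))"
      by (intro emeasure_subadditive_countably) auto
    also have "\<dots> \<le> (\<Sum>n. ennreal (6 * exp (- e) * (1 / 2) ^ n))"
    proof (rule suminf_le)
      fix n
      let ?e = "3 * exp (- (e + 2 * real n))"
      have "emeasure M (F n) \<le> (\<Sum>i<2 ^ n. emeasure M (E n (p n i) (p n (Suc i)) \<union> E n (p n (Suc i)) (p n i)))"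
        unfolding F_def by (rule emeasure_subadditive_finite) auto
      also have "\<dots> \<le> (\<Sum>i<(2::nat) ^ n. ennreal ?e + ennreal ?e)"
      proof (rule sum_mono)
        fix i
        have "emeasure M (E n (p n i) (p n (Suc i)) \<union> E n (p n (Suc i)) (p n i)) \<le>
            emeasure M (E n (p n i) (p n (Suc i))) + emeasure M (E n (p n (Suc i)) (p n i))"
          by (rule emeasure_subadditive) auto
        also have "\<dots> \<le> ennreal ?e + ennreal ?e"
          unfolding E_def by (intro add_mono max_ineq p)
        finally show "emeasure M (E n (p n i) (p n (Suc i)) \<union> E n (p n (Suc i)) (p n i)) \<le> ennreal ?e + ennreal ?e" .
      qed
      also have "\<dots> = (\<Sum>i<(2::nat) ^ n. ennreal (2 * ?e))"
        by (intro sum.cong refl) (simp add: ennreal_plus[symmetric] del: ennreal_plus)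
      also have "\<dots> = ennreal (2 ^ n * (2 * ?e))"
        by (simp add: sum_ennreal[symmetric] ennreal_mult' ennreal_power[symmetric] ennreal_of_nat_eq_real_of_nat)
      also have "2 ^ n * (2 * ?e) = 6 * exp (- e) * (2 * exp (- 2)) ^ n"
        by (simp add: exp_add[symmetric] exp_of_nat_mult[symmetric] power_mult_distrib exp_diff exp_minus field_simps)
      also have "ennreal (6 * exp (- e) * (2 * exp (- 2)) ^ n) \<le> ennreal (6 * exp (- e) * (1 / 2) ^ n)"
      proof (intro ennreal_leI mult_left_mono power_mono)
        have "(2::real) \<le> exp 1" using exp_ge_add_one_self[of 1] by simp
        then have "2 * 2 \<le> exp 1 * exp (1::real)" by (intro mult_mono) auto
        then have "4 \<le> exp (2::real)" by (simp add: exp_add[symmetric])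
        then show "2 * exp (- 2 :: real) \<le> 1 / 2" by (simp add: exp_minus field_simps)
      qed auto
      finally show "emeasure M (F n) \<le> ennreal (6 * exp (- e) * (1 / 2) ^ n)" .
    qed auto
    also have "\<dots> = ennreal (\<Sum>n. 6 * exp (- e) * (1 / 2) ^ n)"
      by (rule suminf_ennreal2) (auto intro!: summable_mult summable_geometric)
    also have "(\<Sum>n. 6 * exp (- e) * (1 / 2) ^ n) = 12 * exp (- e)"
      by (subst suminf_mult) (auto simp: suminf_geometric intro!: summable_geometric)
    finally show "emeasure M {\<omega>\<in>space M. ennreal e < \<Lambda> \<omega>} \<le> ennreal (12 * exp (- e))" .
  next
    show "AE \<omega> in M. \<Lambda> \<omega> < \<infinity> \<longrightarrow> (\<forall>t x y. 0 \<le> t \<longrightarrow> 0 \<le> x \<longrightarrow> x < y \<longrightarrow> y \<le> b \<longrightarrow>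
      \<bar>l y t \<omega> - l x t \<omega>\<bar> \<le> H * (\<bar>l 0 t \<omega>\<bar> + enn2real (\<Lambda> \<omega>) + 1) * (y - x) powr \<nu>)"
      using l_continuous
    proof eventually_elim
      case (elim \<omega>)
      note slices = jointly_continuous_slices[OF elim]
      show ?case
      proof (intro impI allI)
        fix t x y :: real
        assume fin: "\<Lambda> \<omega> < \<infinity>" and t: "0 \<le> t" and xy: "0 \<le> x" "x < y" "y \<le> b"
        define r where "r = enn2real (\<Lambda> \<omega>)"
        have dyadic: "T n (p n i) (p n (Suc i)) m k \<omega> \<le> r + 2 * real n" (is ?A)
          "T n (p n (Suc i)) (p n i) m k \<omega> \<le> r + 2 * real n" (is ?B) if i: "i < 2 ^ n" for n i m k
        proof -
          have "max (ennreal (T n (p n i) (p n (Suc i)) m k \<omega> - 2 * real n))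
              (ennreal (T n (p n (Suc i)) (p n i) m k \<omega> - 2 * real n)) \<le> \<Lambda> \<omega>"
            unfolding \<Lambda>_def using i
            by (intro SUP_upper2[of n] SUP_upper2[of i] SUP_upper2[of m] SUP_upper2[of k]) auto
          then have "T n (p n i) (p n (Suc i)) m k \<omega> - 2 * real n \<le> r" "T n (p n (Suc i)) (p n i) m k \<omega> - 2 * real n \<le> r"
            unfolding r_def using fin by (auto intro!: le_enn2realI)
          then show ?A ?B by auto
        qed
        have all_times: "tilted (\<theta> / s n) u v t \<kappa> \<omega> \<le> r + 2 * real n"
          if "\<And>m k. T n u v m k \<omega> \<le> r + 2 * real n" for n u v
        proof (rule LIMSEQ_le_const2)
          show "(\<lambda>m. tilted (\<theta> / s n) u v (dyadic_ceiling m t) \<kappa> \<omega>) \<longlonglongrightarrow> tilted (\<theta> / s n) u v t \<kappa> \<omega>"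
            unfolding tilted_def by (intro tendsto_intros slices(3)[OF t])
          have "tilted (\<theta> / s n) u v (dyadic_ceiling m t) \<kappa> \<omega> \<le> r + 2 * real n" for m
            using dyadic_ceiling_eq[OF t, of m] that[of m] by (auto simp: T_def)
          then show "\<exists>N. \<forall>m\<ge>N. tilted (\<theta> / s n) u v (dyadic_ceiling m t) \<kappa> \<omega> \<le> r + 2 * real n" by blast
        qed
        show "\<bar>l y t \<omega> - l x t \<omega>\<bar> \<le> H * (\<bar>l 0 t \<omega>\<bar> + enn2real (\<Lambda> \<omega>) + 1) * (y - x) powr \<nu>"
        proof (rule hold[OF slices(1)[OF t] _ _ xy])
          show "0 \<le> enn2real (\<Lambda> \<omega>)" by simp
          fix n i :: nat assume i: "i < 2 ^ n"
          let ?u = "l (p n i) t \<omega>" and ?v = "l (p n (Suc i)) t \<omega>"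
          have "\<theta> / s n * (?v - ?u) - \<kappa> * (?u + ?v) \<le> r + 2 * real n" "\<theta> / s n * (?u - ?v) - \<kappa> * (?v + ?u) \<le> r + 2 * real n"
            using all_times[OF dyadic(1)[OF i]] all_times[OF dyadic(2)[OF i]] by (simp_all add: tilted_def)
          then have "\<theta> / s n * (?v - ?u) \<le> \<kappa> * (?u + ?v) + (r + 2 * real n)"
              "\<theta> / s n * (?u - ?v) \<le> \<kappa> * (?u + ?v) + (r + 2 * real n)"
            unfolding add.commute[of ?v ?u] by linarith+
          then have "\<theta> / s n * \<bar>?v - ?u\<bar> \<le> \<kappa> * (?u + ?v) + (r + 2 * real n)"
            by (cases "?u \<le> ?v") simp_all
          then have "s n / \<theta> * (\<theta> / s n * \<bar>?v - ?u\<bar>) \<le> s n / \<theta> * (\<kappa> * (?u + ?v) + (r + 2 * real n))"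
            using \<theta> s[of n] by (intro mult_left_mono) auto
          also have "s n / \<theta> * (\<theta> / s n * \<bar>?v - ?u\<bar>) = \<bar>?v - ?u\<bar>" using \<theta> s[of n] by simp
          also have "s n / \<theta> * (\<kappa> * (?u + ?v) + (r + 2 * real n)) = s n * (c * \<theta> * (?u + ?v) + (r + 2 * real n) / \<theta>)"
            using \<theta> by (simp add: \<kappa>_def field_simps)
          finally show "\<bar>l (b * real (Suc i) / 2 ^ n) t \<omega> - l (b * real i / 2 ^ n) t \<omega>\<bar> \<le>
              (b / 2 ^ n) powr (\<alpha> / 2) * (c * \<theta> * (l (b * real i / 2 ^ n) t \<omega> + l (b * real (Suc i) / 2 ^ n) t \<omega>) +
                (enn2real (\<Lambda> \<omega>) + 2 * real n) / \<theta>)"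
            by (simp only: p_def s_def r_def)
        qed
      qed
    qed
  qed
qed

end

section \<open>Moments of the Hoelder constant\<close>

lemma borel_measurable_completion_AE_eq:
  fixes f g :: "'a \<Rightarrow> 'b :: topological_space"
  assumes g: "g \<in> borel_measurable M" and eq: "AE x in M. f x = g x"
  shows "f \<in> borel_measurable (completion M)"
proof (rule measurableI)
  fix A :: "'b set" assume "A \<in> sets borel"
  then have mem: "g -` A \<inter> space M \<in> sets (completion M)"
    using g by (auto intro: measurable_sets)
  have ae: "AE x in completion M. x \<in> g -` A \<inter> space M \<longleftrightarrow> x \<in> f -` A \<inter> space M"
    by (rule AE_completion) (use eq in eventually_elim, simp)
  then show "f -` A \<inter> space (completion M) \<in> sets (completion M)"
    using completion.in_sets_AE[OF ae mem] by auto
qed simp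

text \<open>Strictly before the inverse local time the bound holds by definition; at that time itself it holds by
  left-continuity, except that at time 0 it must be assumed.\<close>

lemma local_time_le_until_inverse:
  assumes l: "continuous_on {0..} (\<lambda>t. l y t \<omega>)" and l0: "l y 0 \<omega> \<le> s"
    and t: "0 \<le> t" "ereal t \<le> inverse_local_time l y s \<omega>"
  shows "l y t \<omega> \<le> s"
proof (cases "t = 0")
  case False
  have before: "l y u \<omega> \<le> s" if "0 \<le> u" "u < t" for u
  proof (rule ccontr)
    assume "\<not> l y u \<omega> \<le> s"
    then have "inverse_local_time l y s \<omega> \<le> ereal u"
      unfolding inverse_local_time_def using that by (intro INF_lower) simp
    with t(2) have "ereal t \<le> ereal u" by (rule order_trans)
    with that show False by simp
  qed
  define u where "u n = t - t * inverse (real (Suc n))" for n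
  have u: "0 \<le> u n" "u n < t" for n
    using t(1) False by (auto simp: u_def field_simps)
  have "u \<longlonglongrightarrow> t - t * 0" unfolding u_def[abs_def]
    by (intro tendsto_intros LIMSEQ_inverse_real_of_nat)
  then have "(\<lambda>n. l y (u n) \<omega>) \<longlonglongrightarrow> l y t \<omega>"
    using u t(1) by (intro continuous_on_tendsto_compose[OF l]) (auto intro!: always_eventually)
  then show ?thesis
    by (rule LIMSEQ_le_const2) (use before[OF u] in blast)
qed (use l0 in simp)

text \<open>
  A countable supremum, hence measurable, that agrees with \<open>holder_const\<close> on continuous paths. The
  constraint that the time be at most the inverse local time is expressed by the values of the local
  time at earlier dyadic times.\<close>

definition dyadic_holder_const ::
    "(real \<Rightarrow> real \<Rightarrow> 'a \<Rightarrow> real) \<Rightarrow> real \<Rightarrow> real \<Rightarrow> ('a \<Rightarrow> real) \<Rightarrow> 'a \<Rightarrow> ennreal" where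
  "dyadic_holder_const l \<nu> b S \<omega> = (SUP m :: nat. SUP k :: nat. SUP i :: nat. SUP j :: nat.
     if i < j \<and> real j / 2 ^ m \<le> b \<and>
        (\<forall>m' k'. real k' / 2 ^ m' < real k / 2 ^ m \<longrightarrow> l 0 (real k' / 2 ^ m') \<omega> \<le> S \<omega>)
     then ennreal (\<bar>l (real j / 2 ^ m) (real k / 2 ^ m) \<omega> - l (real i / 2 ^ m) (real k / 2 ^ m) \<omega>\<bar> /
        \<bar>real j / 2 ^ m - real i / 2 ^ m\<bar> powr \<nu>)
     else 0)"

lemma dyadic_holder_const_measurable:
  assumes l: "\<And>y t. 0 \<le> t \<Longrightarrow> l y t \<in> borel_measurable M" and [measurable]: "S \<in> borel_measurable M"
  shows "dyadic_holder_const l \<nu> b S \<in> borel_measurable M"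
proof -
  have [measurable]: "l y (real k / 2 ^ m) \<in> borel_measurable M" for y and k m :: nat
    by (rule l) simp
  show ?thesis unfolding dyadic_holder_const_def[abs_def] by measurable
qed

text \<open>Rounding \<open>t\<close>, \<open>x\<close>, \<open>y\<close> down to dyadic numbers respects all upper bounds on them, and continuity controls
  the quotient. Conversely, if the local time exceeds \<open>S\<close> at some time, then by right-continuity it does so
  at dyadic times just after it.\<close>

lemma holder_const_eq_dyadic:
  fixes l :: "real \<Rightarrow> real \<Rightarrow> 'a \<Rightarrow> real"
  assumes l: "continuous_on (UNIV \<times> {0..}) (\<lambda>(y, t). l y t \<omega>)"
  shows "holder_const l \<nu> b (inverse_local_time l 0 (S \<omega>) \<omega>) \<omega> = dyadic_holder_const l \<nu> b S \<omega>"
proof (rule antisym)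
  note slices = jointly_continuous_slices[OF l]
  let ?\<tau> = "inverse_local_time l 0 (S \<omega>) \<omega>"
  show "dyadic_holder_const l \<nu> b S \<omega> \<le> holder_const l \<nu> b ?\<tau> \<omega>"
    unfolding dyadic_holder_const_def
  proof (intro SUP_least)
    fix m k i j :: nat
    let ?t = "real k / 2 ^ m" and ?x = "real i / 2 ^ m" and ?y = "real j / 2 ^ m"
    have "ennreal (\<bar>l ?y ?t \<omega> - l ?x ?t \<omega>\<bar> / \<bar>?y - ?x\<bar> powr \<nu>) \<le> holder_const l \<nu> b ?\<tau> \<omega>"
      if ij: "i < j" "?y \<le> b" and le: "\<forall>m' k'. real k' / 2 ^ m' < ?t \<longrightarrow> l 0 (real k' / 2 ^ m') \<omega> \<le> S \<omega>"
    proof -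
      have "ereal ?t \<le> ?\<tau>"
        unfolding inverse_local_time_def
      proof (rule INF_greatest)
        fix u assume "u \<in> {t. 0 \<le> t \<and> S \<omega> < l 0 t \<omega>}"
        then have u: "0 \<le> u" "S \<omega> < l 0 u \<omega>" by auto
        show "ereal ?t \<le> ereal u"
        proof (rule ccontr)
          assume "\<not> ereal ?t \<le> ereal u"
          then have "u < ?t" by simp
          have "\<forall>\<^sub>F n in sequentially. dyadic_ceiling n u < ?t"
            using dyadic_ceiling_tendsto \<open>u < ?t\<close> by (rule order_tendstoD)
          moreover have "\<forall>\<^sub>F n in sequentially. S \<omega> < l 0 (dyadic_ceiling n u) \<omega>"
            using slices(3)[OF u(1)] u(2) by (rule order_tendstoD)
          ultimately have "\<forall>\<^sub>F n in sequentially. False"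
          proof eventually_elim
            case (elim n)
            obtain k' :: nat where "dyadic_ceiling n u = real k' / 2 ^ n"
              using dyadic_ceiling_eq[OF u(1)] by blast
            with elim le show ?case by fastforce
          qed
          then show False by simp
        qed
      qed
      moreover have "0 \<le> ?x" "?x < ?y" using ij by (auto simp: divide_strict_right_mono)
      ultimately show ?thesis
        unfolding holder_const_def using ij
        by (intro SUP_upper2[of ?t] SUP_upper2[of "(?x, ?y)"]) auto
    qed
    then show "(if i < j \<and> ?y \<le> b \<and> (\<forall>m' k'. real k' / 2 ^ m' < ?t \<longrightarrow> l 0 (real k' / 2 ^ m') \<omega> \<le> S \<omega>)
        then ennreal (\<bar>l ?y ?t \<omega> - l ?x ?t \<omega>\<bar> / \<bar>?y - ?x\<bar> powr \<nu>) else 0) \<le> holder_const l \<nu> b ?\<tau> \<omega>"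
      by simp
  qed
  show "holder_const l \<nu> b ?\<tau> \<omega> \<le> dyadic_holder_const l \<nu> b S \<omega>"
    unfolding holder_const_def
  proof (intro SUP_least, clarify)
    fix t x y :: real
    assume t: "0 \<le> t" "ereal t \<le> ?\<tau>" and xy: "0 \<le> x" "x < y" "y \<le> b"
    have y0: "0 \<le> y" using xy by simp
    define d where "d z n = real (nat \<lfloor>z * 2 ^ n\<rfloor>) / 2 ^ n" for z :: real and n :: nat
    have d_le: "d z n \<le> z" "0 \<le> d z n" if "0 \<le> z" for z n
      using that by (simp_all add: d_def field_simps)
    have d: "d z \<longlonglongrightarrow> z" if "0 \<le> z" for z
      unfolding d_def[abs_def] by (rule dyadic_floor_tendsto[OF that])
    have "(\<lambda>n. d y n - d x n) \<longlonglongrightarrow> y - x" by (intro tendsto_diff d y0 xy(1))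
    then have "\<forall>\<^sub>F n in sequentially. 0 < d y n - d x n" using xy by (intro order_tendstoD) auto
    then have ev: "\<forall>\<^sub>F n in sequentially. d x n < d y n" by simp
    have l_lim: "(\<lambda>n. l (d z n) (d t n) \<omega>) \<longlonglongrightarrow> l z t \<omega>" if "0 \<le> z" for z
    proof -
      have "(\<lambda>n. case (d z n, d t n) of (y, t) \<Rightarrow> l y t \<omega>) \<longlonglongrightarrow> (case (z, t) of (y, t) \<Rightarrow> l y t \<omega>)"
        using t(1) d_le by (intro continuous_on_tendsto_compose[OF l] tendsto_Pair d that) (auto intro!: always_eventually)
      then show ?thesis by simp
    qed
    show "ennreal (\<bar>l y t \<omega> - l x t \<omega>\<bar> / \<bar>y - x\<bar> powr \<nu>) \<le> dyadic_holder_const l \<nu> b S \<omega>"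
    proof (rule tendsto_upperbound)
      show "(\<lambda>n. ennreal (\<bar>l (d y n) (d t n) \<omega> - l (d x n) (d t n) \<omega>\<bar> / \<bar>d y n - d x n\<bar> powr \<nu>)) \<longlonglongrightarrow>
          ennreal (\<bar>l y t \<omega> - l x t \<omega>\<bar> / \<bar>y - x\<bar> powr \<nu>)"
        using xy by (intro tendsto_ennrealI tendsto_intros l_lim d) auto
      show "\<forall>\<^sub>F n in sequentially. ennreal (\<bar>l (d y n) (d t n) \<omega> - l (d x n) (d t n) \<omega>\<bar> / \<bar>d y n - d x n\<bar> powr \<nu>)
          \<le> dyadic_holder_const l \<nu> b S \<omega>"
        using ev
      proof eventually_elim
        case (elim n)
        define k i j where "k = nat \<lfloor>t * 2 ^ n\<rfloor>" and "i = nat \<lfloor>x * 2 ^ n\<rfloor>" and "j = nat \<lfloor>y * 2 ^ n\<rfloor>"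
        have ds: "d t n = real k / 2 ^ n" "d x n = real i / 2 ^ n" "d y n = real j / 2 ^ n"
          by (simp_all add: d_def k_def i_def j_def)
        have "i < j" using elim unfolding ds by (simp add: divide_less_cancel)
        moreover have "real j / 2 ^ n \<le> b" using d_le(1)[OF y0, of n] xy(3) unfolding ds by linarith
        moreover have "l 0 (real k' / 2 ^ m') \<omega> \<le> S \<omega>" if "real k' / 2 ^ m' < real k / 2 ^ n" for m' k' :: nat
        proof (rule ccontr)
          assume "\<not> l 0 (real k' / 2 ^ m') \<omega> \<le> S \<omega>"
          then have "?\<tau> \<le> ereal (real k' / 2 ^ m')"
            unfolding inverse_local_time_def by (intro INF_lower) simp
          with t(2) have "ereal t \<le> ereal (real k' / 2 ^ m')" by (rule order_trans)
          with that d_le(1)[OF t(1), of n] show False unfolding ds by simp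
        qed
        ultimately show ?case
          unfolding ds dyadic_holder_const_def
          by (intro SUP_upper2[of n] SUP_upper2[of k] SUP_upper2[of i] SUP_upper2[of j]) auto
      qed
    qed simp
  qed
qed

lemma add3_powr_le:
  fixes a b c p :: real
  assumes "0 \<le> a" "0 \<le> b" "0 \<le> c" "0 \<le> p"
  shows "(a + b + c) powr p \<le> 3 powr p * (a powr p + b powr p + c powr p)"
proof -
  define m where "m = max a (max b c)"
  have "(a + b + c) powr p \<le> (3 * m) powr p"
    using assms by (intro powr_mono2) (auto simp: m_def)
  also have "\<dots> = 3 powr p * m powr p" by (simp add: powr_mult)
  also have "m powr p \<le> a powr p + b powr p + c powr p"
    by (auto simp: m_def max_def add_increasing add_increasing2)
  finally show ?thesis by (simp add: mult_left_mono)
qed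

context stable_levy_local_time
begin

text \<open>Up to the inverse local time the uniform Hoelder bound contains \<open>l 0 t\<close> only through \<open>S\<close>, so the
  constant is at most \<open>H * (S + \<Lambda> + 1)\<close> pathwise.\<close>

lemma holder_const_moments:
  assumes b: "0 < b" and \<nu>: "0 < \<nu>" "\<nu> < \<alpha> / 2"
    and S: "moments_of_all_orders M S" "AE \<omega> in M. 0 \<le> S \<omega>"
  shows "ext_moments_of_all_orders M
    (\<lambda>\<omega>. holder_const l \<nu> b (inverse_local_time l 0 (S \<omega>) \<omega>) \<omega>)"
proof -
  have [measurable]: "S \<in> borel_measurable M" using S(1) by (simp add: moments_of_all_orders_def)
  obtain H \<Lambda> where H: "0 < H" and \<Lambda>[measurable]: "\<Lambda> \<in> borel_measurable M"
    and tail: "\<And>c. 0 \<le> c \<Longrightarrow> emeasure M {\<omega>\<in>space M. ennreal c < \<Lambda> \<omega>} \<le> ennreal (12 * exp (- c))"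
    and hold: "AE \<omega> in M. \<Lambda> \<omega> < \<infinity> \<longrightarrow> (\<forall>t x y. 0 \<le> t \<longrightarrow> 0 \<le> x \<longrightarrow> x < y \<longrightarrow> y \<le> b \<longrightarrow>
      \<bar>l y t \<omega> - l x t \<omega>\<bar> \<le> H * (\<bar>l 0 t \<omega>\<bar> + enn2real (\<Lambda> \<omega>) + 1) * (y - x) powr \<nu>)"
    using uniform_holder_bound[OF b \<nu>] by blast
  have tail': "emeasure M {\<omega>\<in>space M. ennreal (real k) < \<Lambda> \<omega>} \<le> ennreal (12 * exp (- real k))" for k
    by (rule tail) simp
  have \<Lambda>_finite: "AE \<omega> in M. \<Lambda> \<omega> < \<infinity>"
    by (rule exponential_tail_moments(1)[OF \<Lambda> _ tail']) simp
  have \<Lambda>_moments: "integrable M (\<lambda>\<omega>. enn2real (\<Lambda> \<omega>) powr p)" if "0 < p" for p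
    by (rule exponential_tail_moments(2)[OF \<Lambda> _ tail' that]) simp
  let ?V = "\<lambda>\<omega>. holder_const l \<nu> b (inverse_local_time l 0 (S \<omega>) \<omega>) \<omega>"
  define V where "V = dyadic_holder_const l \<nu> b S"
  have V_measurable[measurable]: "V \<in> borel_measurable M"
    unfolding V_def by (intro dyadic_holder_const_measurable l_measurable) simp_all
  have V_eq: "AE \<omega> in M. ?V \<omega> = V \<omega>"
    using l_continuous unfolding V_def by eventually_elim (rule holder_const_eq_dyadic)
  have bound: "AE \<omega> in M. V \<omega> \<le> ennreal (H * (S \<omega> + enn2real (\<Lambda> \<omega>) + 1))"
    using hold \<Lambda>_finite V_eq l_continuous local_time_nonneg[of 0] S(2)
  proof eventually_elim
    case (elim \<omega>)
    note slices = jointly_continuous_slices[OF elim(4)]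
    have "?V \<omega> \<le> ennreal (H * (S \<omega> + enn2real (\<Lambda> \<omega>) + 1))"
      unfolding holder_const_def
    proof (intro SUP_least, clarify)
      fix t x y :: real
      assume t: "0 \<le> t" "ereal t \<le> inverse_local_time l 0 (S \<omega>) \<omega>" and xy: "0 \<le> x" "x < y" "y \<le> b"
      have "l 0 t \<omega> \<le> S \<omega>"
      proof (rule local_time_le_until_inverse[OF slices(2) _ t])
        show "l 0 0 \<omega> \<le> S \<omega>" using elim(5,6) by simp
      qed
      moreover have "0 \<le> l 0 t \<omega>" using elim(5) t(1) by blast
      ultimately have "H * (\<bar>l 0 t \<omega>\<bar> + enn2real (\<Lambda> \<omega>) + 1) * (y - x) powr \<nu> \<le>
          H * (S \<omega> + enn2real (\<Lambda> \<omega>) + 1) * (y - x) powr \<nu>"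
        using H by (intro mult_right_mono mult_left_mono) auto
      moreover have "\<bar>l y t \<omega> - l x t \<omega>\<bar> \<le> H * (\<bar>l 0 t \<omega>\<bar> + enn2real (\<Lambda> \<omega>) + 1) * (y - x) powr \<nu>"
        using elim(1,2) t(1) xy by blast
      ultimately have "\<bar>l y t \<omega> - l x t \<omega>\<bar> \<le> H * (S \<omega> + enn2real (\<Lambda> \<omega>) + 1) * (y - x) powr \<nu>" by linarith
      then show "ennreal (\<bar>l y t \<omega> - l x t \<omega>\<bar> / \<bar>y - x\<bar> powr \<nu>) \<le> ennreal (H * (S \<omega> + enn2real (\<Lambda> \<omega>) + 1))"
        using xy by (intro ennreal_leI) (simp add: divide_le_eq)
    qed
    then show ?case using elim(3) by simp
  qed
  have "AE \<omega> in M. ?V \<omega> < \<infinity>"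
    using bound V_eq by eventually_elim (auto simp: less_top[symmetric] top_unique)
  moreover have eq': "AE \<omega> in M. enn2real (?V \<omega>) = enn2real (V \<omega>)"
    using V_eq by eventually_elim simp
  have V_completion: "(\<lambda>\<omega>. enn2real (?V \<omega>)) \<in> borel_measurable (completion M)"
    by (rule borel_measurable_completion_AE_eq[OF _ eq']) measurable
  moreover have "integrable (completion M) (\<lambda>\<omega>. \<bar>enn2real (?V \<omega>)\<bar> powr p)" if p: "0 < p" for p
  proof -
    have "integrable M (\<lambda>\<omega>. (3 * H) powr p * (\<bar>S \<omega>\<bar> powr p + enn2real (\<Lambda> \<omega>) powr p + 1))"
      using S(1) \<Lambda>_moments[OF p] p by (simp add: moments_of_all_orders_def)
    then have "integrable M (\<lambda>\<omega>. \<bar>enn2real (V \<omega>)\<bar> powr p)"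
    proof (rule Bochner_Integration.integrable_bound)
      show "AE \<omega> in M. norm (\<bar>enn2real (V \<omega>)\<bar> powr p) \<le>
          norm ((3 * H) powr p * (\<bar>S \<omega>\<bar> powr p + enn2real (\<Lambda> \<omega>) powr p + 1))"
        using bound S(2)
      proof eventually_elim
        case (elim \<omega>)
        have nn: "0 \<le> S \<omega> + enn2real (\<Lambda> \<omega>) + 1" using elim(2) by (simp add: add_nonneg_nonneg)
        have "enn2real (V \<omega>) \<le> H * (S \<omega> + enn2real (\<Lambda> \<omega>) + 1)"
          using enn2real_mono[OF elim(1)] H nn by simp
        then have "enn2real (V \<omega>) powr p \<le> (H * (S \<omega> + enn2real (\<Lambda> \<omega>) + 1)) powr p"
          using p by (intro powr_mono2) auto
        also have "\<dots> = H powr p * (S \<omega> + enn2real (\<Lambda> \<omega>) + 1) powr p" by (simp add: powr_mult)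
        also have "\<dots> \<le> H powr p * (3 powr p * (S \<omega> powr p + enn2real (\<Lambda> \<omega>) powr p + 1 powr p))"
          using elim(2) p by (intro mult_left_mono add3_powr_le) auto
        also have "\<dots> = (3 * H) powr p * (\<bar>S \<omega>\<bar> powr p + enn2real (\<Lambda> \<omega>) powr p + 1)"
          using elim(2) H by (simp add: powr_mult)
        finally show ?case by (simp add: abs_of_nonneg)
      qed
    qed measurable
    then have "integrable (completion M) (\<lambda>\<omega>. \<bar>enn2real (V \<omega>)\<bar> powr p)"
      by (subst integrable_completion) measurable
    moreover have "integrable (completion M) (\<lambda>\<omega>. \<bar>enn2real (?V \<omega>)\<bar> powr p) \<longleftrightarrow>
        integrable (completion M) (\<lambda>\<omega>. \<bar>enn2real (V \<omega>)\<bar> powr p)"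
    proof (rule integrable_cong_AE)
      show "(\<lambda>\<omega>. \<bar>enn2real (?V \<omega>)\<bar> powr p) \<in> borel_measurable (completion M)"
        using V_completion by measurable
      show "(\<lambda>\<omega>. \<bar>enn2real (V \<omega>)\<bar> powr p) \<in> borel_measurable (completion M)"
        by (rule measurable_completion) measurable
      show "AE \<omega> in completion M. \<bar>enn2real (?V \<omega>)\<bar> powr p = \<bar>enn2real (V \<omega>)\<bar> powr p"
        using AE_completion[OF eq'] by eventually_elim simp
    qed
    ultimately show ?thesis by simp
  qed
  ultimately show ?thesis
    by (simp add: ext_moments_of_all_orders_def moments_of_all_orders_def)
qed

end

theorem theorem3:
  fixes M :: "'a measure"
    and X :: "real \<Rightarrow> 'a \<Rightarrow> real"
    and l :: "real \<Rightarrow> real \<Rightarrow> 'a \<Rightarrow> real"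
    and S :: "'a \<Rightarrow> real"
    and \<alpha> b \<nu> :: real
  assumes "0 < \<alpha>" "\<alpha> < 1"
    and "0 < b"
    and "0 < \<nu>" "\<nu> < \<alpha> / 2"
    and "stable_process M (1 + \<alpha>) X"
    and "no_negative_jumps M X"
    and "has_laplace_exponent M X (\<lambda>\<eta>. \<eta> powr (1 + \<alpha>))"
    and "jointly_continuous_local_times M X l"
    and "moments_of_all_orders M S"
    and "AE \<omega> in M. 0 \<le> S \<omega>"
  shows "ext_moments_of_all_orders M
           (\<lambda>\<omega>. holder_const l \<nu> b (inverse_local_time l 0 (S \<omega>) \<omega>) \<omega>)"
proof -
  have levy: "levy_process M X" using assms(6) by (simp add: stable_process_def)
  have X: "X t \<in> borel_measurable M" if "0 \<le> t" for t
    using levy that by (simp add: levy_process_def)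
  have "AE \<omega> in M. cadlag (\<lambda>t. X t \<omega>)" using levy by (simp add: levy_process_def)
  then have rc: "AE \<omega> in M. \<forall>t\<ge>0. ((\<lambda>t. X t \<omega>) \<longlongrightarrow> X t \<omega>) (at_right t)"
    by eventually_elim (simp add: cadlag_def)
  obtain Y where Y: "Y \<in> borel_measurable (borel \<Otimes>\<^sub>M M)" "AE \<omega> in M. \<forall>s\<ge>0. Y (s, \<omega>) = X s \<omega>"
    using right_continuous_version[OF X rc] by blast
  interpret prob_space M using levy by (simp add: levy_process_def)
  interpret stable_levy_local_time M X \<alpha> Y l
  proof unfold_locales
    show "AE \<omega> in M. X 0 \<omega> = 0" using levy by (simp add: levy_process_def)
    show "indep_vars (\<lambda>_. borel) (\<lambda>i \<omega>. X (t (Suc i)) \<omega> - X (t i) \<omega>) {..<n}"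
      if "0 \<le> t 0" "mono t" for n and t :: "nat \<Rightarrow> real"
      using levy that by (simp add: levy_process_def)
    show "distr M borel (\<lambda>\<omega>. X (s + h) \<omega> - X s \<omega>) = distr M borel (X h)" if "0 \<le> s" "0 \<le> h" for s h
      using levy that by (simp add: levy_process_def)
    show "integrable M (\<lambda>\<omega>. exp (- \<eta> * X t \<omega>))"
      "(\<integral>\<omega>. exp (- \<eta> * X t \<omega>) \<partial>M) = exp (t * \<eta> powr (1 + \<alpha>))" if "0 \<le> \<eta>" "0 \<le> t" for \<eta> t
      using assms(8) that unfolding has_laplace_exponent_def by blast+
    show "l y t \<in> borel_measurable M" if "0 \<le> t" for y t
      using assms(9) that by (simp add: jointly_continuous_local_times_def)
    show "AE \<omega> in M. continuous_on (UNIV \<times> {0..}) (\<lambda>(y, t). l y t \<omega>)"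
      using assms(9) by (simp add: jointly_continuous_local_times_def)
    show "AE \<omega> in M. (LINT t:{0..T}|lborel. f (X t \<omega>)) = (LINT y|lborel. f y * l y T \<omega>)"
      if "f \<in> borel_measurable borel" "bounded (range f)" "0 \<le> T" for f T
      using assms(9) that by (simp add: jointly_continuous_local_times_def)
  qed (use assms(1,2) X rc Y in auto)
  show ?thesis by (rule holder_const_moments[OF assms(3,4,5,10,11)])
qed

end
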